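(* Let $k\ge1$, $n=k+2$, and let $\varphi:S^k\times\mathbb{R}\times\mathbb{R}\to M\subset S^{k+3}\subset\mathbb{R}^{k+4}$ be the immersion $$\varphi(y,u,v)=\left(\sqrt{1-f_1^2(u)-f_2^2(u)}\;y,\;f_1(u),\;f_2(u)\cos v,\;f_2(u)\sin v\right),$$ where $y\in S^k\subset\mathbb{R}^{k+1}$ and $f_1,f_2$ are smooth $T$-periodic functions with $f_2(u)>0$, $f_1(u)^2+f_2(u)^2<1$ and $f_1'(u)^2+f_2'(u)^2=1$ for all $u$. Let $\alpha_i=i(k+i-1)$, $i=0,1,2,\dots$, denote the eigenvalues of the Laplacian of the $k$-dimensional unit sphere $S^k$. (1) The spectrum of the Laplace operator $\Delta$ on $M$ is the union $\bigcup_{i,j=0}^\infty\Gamma_{ij}$, where $\Gamma_{ij}=\{\lambda_{ij}(1),\lambda_{ij}(2),\dots\}$ is the ordered spectrum of the second order differential operator $$L_{ij}(\eta)=\frac{1}{1+(f')^2}\left(\eta''+\left(k\frac{f'}{f}+\frac{f_2'}{f_2}-\frac{f'f''}{1+(f')^2}\right)\eta'\right)-\left(\frac{\alpha_i}{f^2}+\frac{j^2}{f_2^2}\right)\eta$$ defined on the set of $T$-periodic real functions. (2) The spectrum of the stability operator $J=\Delta+k+2+|A|^2$ on $M$ is the union $\bigcup_{i,j=0}^\infty\bar\Gamma_{ij}$, where $\bar\Gamma_{ij}=\{\bar\lambda_{ij}(1),\bar\lambda_{ij}(2),\dots\}$ is the ordered spectrum of the second order differential operator $$S_{ij}(\eta)=\frac{1}{1+(f')^2}\left(\eta''+\left(k\frac{f'}{f}+\frac{f_2'}{f_2}-\frac{f'f''}{1+(f')^2}\right)\eta'\right)-\left(\frac{\alpha_i}{f^2}+\frac{j^2}{f_2^2}-n-\left(k\lambda_0^2+\lambda_1^2+\lambda_2^2\right)\right)\eta$$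 defined on the set of $T$-periodic real functions.
   Context: Functions on $M$ are regarded as functions of $(y,u,v)$, $T$-periodic in $u$ and $2\pi$-periodic in $v$ (i.e. functions on the compact manifold $S^k\times\mathbb{R}/T\mathbb{Z}\times\mathbb{R}/2\pi\mathbb{Z}$ immersed by $\varphi$), and $\Delta=\operatorname{div}\nabla$ is the Laplace operator of the metric induced by $\varphi$. Sign convention: $\lambda$ is an eigenvalue (belongs to the spectrum) of an operator $P\in\{\Delta,J,\Delta_{S^k},L_{ij},S_{ij}\}$ if $P\zeta+\lambda\zeta=0$ for some nonzero $\zeta$ in its domain. $|A|^2$ is the sum of the squares of the principal curvatures of $M$ in $S^{k+3}$, counted with multiplicity. Notation (functions of $u$): $$f=\sqrt{1-f_1^2-f_2^2},\quad g=f_2f_1'-f_1f_2',\quad h=\sqrt{1-g^2},\quad \kappa_1=f_2''f_1'-f_1''f_2',\quad \kappa_2=-\frac{f_1'}{f_2},$$ $$\lambda_0=\frac gh,\quad \lambda_1=\frac{g+\kappa_1}{h}-\frac{\kappa_1(ff')^2}{h^3},\quad \lambda_2=\frac{g+\kappa_2}{h}.$$ *)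

theory Defs
  imports "HOL-Analysis.Analysis"
begin

section \<open>Smooth functions\<close>

primrec Ck_on :: "nat \<Rightarrow> 'm::real_normed_vector set \<Rightarrow> ('m \<Rightarrow> 'e::real_normed_vector) \<Rightarrow> bool" where
  "Ck_on 0 W F \<longleftrightarrow> continuous_on W F"
| "Ck_on (Suc r) W F \<longleftrightarrow> F differentiable_on W \<and> (\<forall>X. Ck_on r W (\<lambda>p. frechet_derivative F (at p) X))"

text \<open>Only meant for open \<open>W\<close>: the derivatives are taken in the ambient space.\<close>

definition smooth_on_open :: "'m::real_normed_vector set \<Rightarrow> ('m \<Rightarrow> 'e::real_normed_vector) \<Rightarrow> bool" where
  "smooth_on_open W F \<longleftrightarrow> (\<forall>r. Ck_on r W F)"

text \<open>Smoothness on a subset \<open>N\<close> of the ambient space (here always an embedded submanifold):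
  existence of local smooth extensions.\<close>

definition smooth_map_on :: "'m::real_normed_vector set \<Rightarrow> ('m \<Rightarrow> 'e::real_normed_vector) \<Rightarrow> bool" where
  "smooth_map_on N F \<longleftrightarrow>
     (\<forall>p\<in>N. \<exists>W G. open W \<and> p \<in> W \<and> smooth_on_open W G \<and> (\<forall>q\<in>N \<inter> W. G q = F q))"


section \<open>Geometry of an immersion of a submanifold into a Euclidean space\<close>

text \<open>Throughout, \<open>N\<close> is an embedded submanifold of a Euclidean space and \<open>\<phi>\<close> is an immersion
  of \<open>N\<close> into a Euclidean space. Everything on the immersed manifold is expressed on \<open>N\<close>.\<close>

definition tangent_space :: "'m::real_normed_vector set \<Rightarrow> 'm \<Rightarrow> 'm set" where
  "tangent_space N p =
     {X. \<exists>\<gamma>::real \<Rightarrow> 'm. (\<forall>t. \<gamma> t \<in> N) \<and> \<gamma> 0 = p \<and> (\<gamma> has_vector_derivative X) (at 0)}"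

text \<open>The Frechet derivative within \<open>N\<close> is determined on tangent vectors only, so
  \<open>differential N F p X\<close> is meaningful for \<open>X \<in> tangent_space N p\<close>, where it is the usual
  differential \<open>dF\<^sub>p(X)\<close>. It is used for such \<open>X\<close> only.\<close>

definition differential ::
    "'m::real_normed_vector set \<Rightarrow> ('m \<Rightarrow> 'e::real_normed_vector) \<Rightarrow> 'm \<Rightarrow> 'm \<Rightarrow> 'e" where
  "differential N F p X = frechet_derivative F (at p within N) X"

definition induced_metric ::
    "'m::real_normed_vector set \<Rightarrow> ('m \<Rightarrow> 'e::euclidean_space) \<Rightarrow> 'm \<Rightarrow> 'm \<Rightarrow> 'm \<Rightarrow> real" where
  "induced_metric N \<phi> p X Y = differential N \<phi> p X \<bullet> differential N \<phi> p Y"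

definition gradient ::
    "'m::real_normed_vector set \<Rightarrow> ('m \<Rightarrow> 'e::euclidean_space) \<Rightarrow> ('m \<Rightarrow> real) \<Rightarrow> 'm \<Rightarrow> 'm" where
  "gradient N \<phi> \<zeta> p =
     (THE G. G \<in> tangent_space N p \<and>
        (\<forall>X\<in>tangent_space N p. induced_metric N \<phi> p G X = differential N \<zeta> p X))"

definition orthonormal_frame ::
    "'m::real_normed_vector set \<Rightarrow> ('m \<Rightarrow> 'e::euclidean_space) \<Rightarrow> 'm \<Rightarrow> 'm set \<Rightarrow> bool" where
  "orthonormal_frame N \<phi> p B \<longleftrightarrow>
     B \<subseteq> tangent_space N p \<and> span B = tangent_space N p \<and>
     (\<forall>X\<in>B. \<forall>Y\<in>B. induced_metric N \<phi> p X Y = (if X = Y then 1 else 0))"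

text \<open>The divergence of a tangent field \<open>V\<close> is the trace of \<open>X \<mapsto> \<nabla>\<^sub>X V\<close>. For the metric
  induced by \<open>\<phi>\<close>, the Levi-Civita derivative \<open>\<nabla>\<^sub>X V\<close> is the tangential part of the Euclidean
  derivative along \<open>X\<close> of the field \<open>d\<phi>(V)\<close>; in the trace the normal part drops out. The value
  does not depend on the orthonormal frame that is chosen.\<close>

definition divergence ::
    "'m::real_normed_vector set \<Rightarrow> ('m \<Rightarrow> 'e::euclidean_space) \<Rightarrow> ('m \<Rightarrow> 'm) \<Rightarrow> 'm \<Rightarrow> real" where
  "divergence N \<phi> V p =
     (\<Sum>X\<in>(SOME B. orthonormal_frame N \<phi> p B).
        differential N (\<lambda>q. differential N \<phi> q (V q)) p X \<bullet> differential N \<phi> p X)"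

definition laplacian ::
    "'m::real_normed_vector set \<Rightarrow> ('m \<Rightarrow> 'e::euclidean_space) \<Rightarrow> ('m \<Rightarrow> real) \<Rightarrow> 'm \<Rightarrow> real" where
  "laplacian N \<phi> \<zeta> p = divergence N \<phi> (gradient N \<phi> \<zeta>) p"

text \<open>Hypersurfaces of the unit sphere: \<open>\<nu>\<close> is a unit normal field tangent to the sphere. Since
  \<open>d\<nu>(X)\<close> is then orthogonal to both \<open>\<nu>\<close> and \<open>\<phi>\<close>, the shape operator is \<open>-d\<nu>\<close> under the
  identification of tangent vectors \<open>X\<close> with \<open>d\<phi>(X)\<close>.\<close>

definition unit_normal_field ::
    "'m::real_normed_vector set \<Rightarrow> ('m \<Rightarrow> 'e::euclidean_space) \<Rightarrow> ('m \<Rightarrow> 'e) \<Rightarrow> bool" where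
  "unit_normal_field N \<phi> \<nu> \<longleftrightarrow>
     smooth_map_on N \<nu> \<and>
     (\<forall>p\<in>N. norm (\<nu> p) = 1 \<and> \<nu> p \<bullet> \<phi> p = 0 \<and>
        (\<forall>X\<in>tangent_space N p. \<nu> p \<bullet> differential N \<phi> p X = 0))"

text \<open>The choice of a unit normal field affects the principal curvatures only by a sign.\<close>

definition gauss_map ::
    "'m::real_normed_vector set \<Rightarrow> ('m \<Rightarrow> 'e::euclidean_space) \<Rightarrow> 'm \<Rightarrow> 'e" where
  "gauss_map N \<phi> = (SOME \<nu>. unit_normal_field N \<phi> \<nu>)"

definition curvature_space ::
    "'m::real_normed_vector set \<Rightarrow> ('m \<Rightarrow> 'e::euclidean_space) \<Rightarrow> 'm \<Rightarrow> real \<Rightarrow> 'm set" where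
  "curvature_space N \<phi> p \<kappa> =
     {X \<in> tangent_space N p.
        - differential N (gauss_map N \<phi>) p X = \<kappa> *\<^sub>R differential N \<phi> p X}"

definition principal_curvatures ::
    "'m::real_normed_vector set \<Rightarrow> ('m \<Rightarrow> 'e::euclidean_space) \<Rightarrow> 'm \<Rightarrow> real set" where
  "principal_curvatures N \<phi> p = {\<kappa>. \<exists>X\<in>curvature_space N \<phi> p \<kappa>. X \<noteq> 0}"

definition norm_A_squared ::
    "'m::real_normed_vector set \<Rightarrow> ('m \<Rightarrow> 'e::euclidean_space) \<Rightarrow> 'm \<Rightarrow> real" where
  "norm_A_squared N \<phi> p =
     (\<Sum>\<kappa>\<in>principal_curvatures N \<phi> p. real (dim (curvature_space N \<phi> p \<kappa>)) * \<kappa>\<^sup>2)"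

definition stability_operator ::
    "nat \<Rightarrow> 'm::real_normed_vector set \<Rightarrow> ('m \<Rightarrow> 'e::euclidean_space) \<Rightarrow>
     ('m \<Rightarrow> real) \<Rightarrow> 'm \<Rightarrow> real" where
  "stability_operator k N \<phi> \<zeta> p =
     laplacian N \<phi> \<zeta> p + (real k + 2 + norm_A_squared N \<phi> p) * \<zeta> p"


section \<open>Spectra\<close>

text \<open>\<open>spectrum_of N D P\<close>: eigenvalues, with the sign convention \<open>P \<zeta> + \<mu> \<zeta> = 0\<close>, of an
  operator \<open>P\<close> with domain \<open>D\<close>, a space of functions of which only the values on \<open>N\<close> matter.\<close>

definition spectrum_of ::
    "'m set \<Rightarrow> ('m \<Rightarrow> real) set \<Rightarrow> (('m \<Rightarrow> real) \<Rightarrow> 'm \<Rightarrow> real) \<Rightarrow> real set" where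
  "spectrum_of N D P =
     {\<mu>. \<exists>\<zeta>\<in>D. (\<exists>p\<in>N. \<zeta> p \<noteq> 0) \<and> (\<forall>p\<in>N. P \<zeta> p + \<mu> * \<zeta> p = 0)}"

definition periodic_functions :: "real \<Rightarrow> (real \<Rightarrow> real) set" where
  "periodic_functions T = {\<eta>. smooth_on_open UNIV \<eta> \<and> (\<forall>u. \<eta> (u + T) = \<eta> u)}"


section \<open>The immersed hypersurface\<close>

text \<open>\<open>\<real>\<^bsup>k+1\<^esup>\<close> is rendered as a Euclidean space \<open>'a\<close> of dimension \<open>k + 1\<close>, and \<open>\<real>\<^bsup>k+4\<^esup>\<close> as
  \<open>'a \<times> real \<times> real \<times> real\<close>.\<close>

definition M_dom :: "('a::euclidean_space \<times> real \<times> real) set" where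
  "M_dom = sphere 0 1 \<times> UNIV \<times> UNIV"

definition prof_f :: "(real \<Rightarrow> real) \<Rightarrow> (real \<Rightarrow> real) \<Rightarrow> real \<Rightarrow> real" where
  "prof_f f1 f2 u = sqrt (1 - (f1 u)\<^sup>2 - (f2 u)\<^sup>2)"

definition immersion_\<phi> ::
    "(real \<Rightarrow> real) \<Rightarrow> (real \<Rightarrow> real) \<Rightarrow> 'a::euclidean_space \<times> real \<times> real \<Rightarrow>
     'a \<times> real \<times> real \<times> real" where
  "immersion_\<phi> f1 f2 = (\<lambda>(y, u, v).
     (sqrt (1 - (f1 u)\<^sup>2 - (f2 u)\<^sup>2) *\<^sub>R y, f1 u, f2 u * cos v, f2 u * sin v))"

definition M_functions :: "real \<Rightarrow> ('a::euclidean_space \<times> real \<times> real \<Rightarrow> real) set" where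
  "M_functions T =
     {\<zeta>. smooth_map_on M_dom \<zeta> \<and>
        (\<forall>(y, u, v)\<in>M_dom. \<zeta> (y, u + T, v) = \<zeta> (y, u, v) \<and> \<zeta> (y, u, v + 2 * pi) = \<zeta> (y, u, v))}"

definition prof_g :: "(real \<Rightarrow> real) \<Rightarrow> (real \<Rightarrow> real) \<Rightarrow> real \<Rightarrow> real" where
  "prof_g f1 f2 u = f2 u * deriv f1 u - f1 u * deriv f2 u"

definition prof_h :: "(real \<Rightarrow> real) \<Rightarrow> (real \<Rightarrow> real) \<Rightarrow> real \<Rightarrow> real" where
  "prof_h f1 f2 u = sqrt (1 - (prof_g f1 f2 u)\<^sup>2)"

definition \<kappa>1 :: "(real \<Rightarrow> real) \<Rightarrow> (real \<Rightarrow> real) \<Rightarrow> real \<Rightarrow> real" where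
  "\<kappa>1 f1 f2 u = deriv (deriv f2) u * deriv f1 u - deriv (deriv f1) u * deriv f2 u"

definition \<kappa>2 :: "(real \<Rightarrow> real) \<Rightarrow> (real \<Rightarrow> real) \<Rightarrow> real \<Rightarrow> real" where
  "\<kappa>2 f1 f2 u = - (deriv f1 u / f2 u)"

definition lam0 :: "(real \<Rightarrow> real) \<Rightarrow> (real \<Rightarrow> real) \<Rightarrow> real \<Rightarrow> real" where
  "lam0 f1 f2 u = prof_g f1 f2 u / prof_h f1 f2 u"

definition lam1 :: "(real \<Rightarrow> real) \<Rightarrow> (real \<Rightarrow> real) \<Rightarrow> real \<Rightarrow> real" where
  "lam1 f1 f2 u =
     (prof_g f1 f2 u + \<kappa>1 f1 f2 u) / prof_h f1 f2 u
     - \<kappa>1 f1 f2 u * (prof_f f1 f2 u * deriv (prof_f f1 f2) u)\<^sup>2 / (prof_h f1 f2 u) ^ 3"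

definition lam2 :: "(real \<Rightarrow> real) \<Rightarrow> (real \<Rightarrow> real) \<Rightarrow> real \<Rightarrow> real" where
  "lam2 f1 f2 u = (prof_g f1 f2 u + \<kappa>2 f1 f2 u) / prof_h f1 f2 u"


section \<open>The ordinary differential operators\<close>

definition \<alpha> :: "nat \<Rightarrow> nat \<Rightarrow> real" where
  "\<alpha> k i = real i * (real k + real i - 1)"

definition L_op ::
    "(real \<Rightarrow> real) \<Rightarrow> (real \<Rightarrow> real) \<Rightarrow> nat \<Rightarrow> nat \<Rightarrow> nat \<Rightarrow> (real \<Rightarrow> real) \<Rightarrow> real \<Rightarrow> real" where
  "L_op f1 f2 k i j \<eta> u =
     (let f = prof_f f1 f2 in
        1 / (1 + (deriv f u)\<^sup>2) *
          (deriv (deriv \<eta>) u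
           + (real k * (deriv f u / f u) + deriv f2 u / f2 u
              - deriv f u * deriv (deriv f) u / (1 + (deriv f u)\<^sup>2)) * deriv \<eta> u)
        - (\<alpha> k i / (f u)\<^sup>2 + (real j)\<^sup>2 / (f2 u)\<^sup>2) * \<eta> u)"

definition S_op ::
    "(real \<Rightarrow> real) \<Rightarrow> (real \<Rightarrow> real) \<Rightarrow> nat \<Rightarrow> nat \<Rightarrow> nat \<Rightarrow> nat \<Rightarrow> (real \<Rightarrow> real) \<Rightarrow> real \<Rightarrow> real" where
  "S_op f1 f2 k n i j \<eta> u =
     (let f = prof_f f1 f2 in
        1 / (1 + (deriv f u)\<^sup>2) *
          (deriv (deriv \<eta>) u
           + (real k * (deriv f u / f u) + deriv f2 u / f2 u
              - deriv f u * deriv (deriv f) u / (1 + (deriv f u)\<^sup>2)) * deriv \<eta> u)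
        - (\<alpha> k i / (f u)\<^sup>2 + (real j)\<^sup>2 / (f2 u)\<^sup>2 - real n
           - (real k * (lam0 f1 f2 u)\<^sup>2 + (lam1 f1 f2 u)\<^sup>2 + (lam2 f1 f2 u)\<^sup>2)) * \<eta> u)"

end

theory Submission
  imports Defs
begin

text \<open>In the coordinates \<open>(y, u, v)\<close> the Laplacian of \<open>M\<close> separates into the Laplacian of \<open>S\<^sup>k\<close>, an
  operator in \<open>u\<close>, and \<open>\<partial>\<^sub>v\<^sup>2\<close>, and \<open>|A|\<^sup>2\<close> depends on \<open>u\<close> only. Multiplying a solution \<open>\<eta>\<close> of the
  ordinary equation by \<open>Re (y\<^sub>1 + \<i> y\<^sub>2)\<^sup>i\<close> and \<open>cos (j v)\<close> gives an eigenfunction on \<open>M\<close>.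

  Conversely, pair an eigenfunction \<open>\<zeta>\<close> with the functions \<open>s\<^sup>m t\<^sup>j\<close>, where \<open>s = y \<bullet> w\<close> and
  \<open>t = (cos v, sin v) \<bullet> z\<close>. Since \<open>\<Delta> s\<^sup>m = - m (m + k - 1) s\<^sup>m + m (m - 1) |w|\<^sup>2 s\<^bsup>m-2\<^esup>\<close> on the sphere, and likewise
  for \<open>t\<^sup>j\<close>, the first pairing (in the order of \<open>m + j\<close>) that does not vanish identically in \<open>u\<close> is a
  periodic solution of the ordinary equation with parameters \<open>m, j\<close>; no theory of spherical harmonics is
  needed. Some pairing is nonzero because the pairings determine the integrals of \<open>\<zeta>\<close> against the
  exponentials \<open>e\<^bsup>s + t\<^esup>\<close>, whose span is dense by the Stone-Weierstrass theorem. Integrals over the sphere are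
  replaced by integrals over an annulus with a radial weight, so that integration by parts on the sphere
  becomes the divergence theorem for compactly supported functions on \<open>\<real>\<^bsup>k+1\<^esup>\<close>.\<close>

section \<open>Calculus of smooth functions\<close>

text \<open>Smoothness on \<open>M_dom\<close> is given by local extensions, and
  \<open>laplacian\<close> hides two choices: a definite description (the gradient) and an arbitrary
  orthonormal frame. Both disappear in a formula valid for every smooth extension to an open set.
  The extension may then be taken constant along rays, which gives one smooth function off y = 0.
  The same constancy permits the radial weight: the field in Green's identity is tangential, and the
  derivative of the weight pairs only with its radial part.

  The vectors w and z are real, so s^m is not an eigenfunction on the sphere; its defect is a
  multiple of s^(m-2) with the same w, and least order disposes of it. An isotropic complex vector
  would make the power harmonic, and this is the choice made when lifting a solution. Real vectors
  keep the moments real and let the exponentials e^(s + t) span an algebra that separates points.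

  The potential n + |A|^2 depends on u alone, so it is constant in the integrations over y and v.
  Both spectra, eigenvalue included, are thus instances of one equation with a potential
  b(u).\<close>

lemma has_derivative_frechet:
  "F differentiable (at p) \<Longrightarrow> (F has_derivative frechet_derivative F (at p)) (at p)"
  by (simp add: frechet_derivative_works)

lemma Ck_on_cong:
  assumes "open W" "\<And>p. p \<in> W \<Longrightarrow> F p = G p" "Ck_on r W F"
  shows "Ck_on r W G"
  using assms(2,3)
proof (induction r arbitrary: F G)
  case 0
  then show ?case by (simp cong: continuous_on_cong)
next
  case (Suc r)
  have D: "(G has_derivative frechet_derivative F (at p)) (at p)" if "p \<in> W" for p
  proof -
    have "F differentiable at p"
      using Suc.prems(2) that \<open>open W\<close> by (simp add: differentiable_on_eq_differentiable_at)
    then show ?thesis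
      by (metis Suc.prems(1) \<open>open W\<close> has_derivative_frechet has_derivative_transform_within_open that)
  qed
  then have "G differentiable_on W"
    by (auto simp: differentiable_on_def differentiable_def intro: has_derivative_at_withinI)
  moreover have "Ck_on r W (\<lambda>p. frechet_derivative G (at p) X)" for X
  proof (rule Suc.IH)
    show "frechet_derivative F (at p) X = frechet_derivative G (at p) X" if "p \<in> W" for p
      using frechet_derivative_at[OF D[OF that]] by simp
  qed (use Suc.prems(2) in simp)
  ultimately show ?case by simp
qed

lemma Ck_on_Suc_intro:
  assumes "open W" "\<And>p. p \<in> W \<Longrightarrow> (F has_derivative F' p) (at p)"
    and "\<And>X. Ck_on r W (\<lambda>p. F' p X)"
  shows "Ck_on (Suc r) W F"
proof -
  have "F differentiable_on W"
    using assms(1,2) by (auto simp: differentiable_on_def differentiable_def intro: has_derivative_at_withinI)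
  moreover have "Ck_on r W (\<lambda>p. frechet_derivative F (at p) X)" for X
  proof (rule Ck_on_cong[OF assms(1) _ assms(3)[of X]])
    show "F' p X = frechet_derivative F (at p) X" if "p \<in> W" for p
      using frechet_derivative_at[OF assms(2)[OF that]] by simp
  qed
  ultimately show ?thesis by simp
qed

lemma Ck_on_Suc_imp_Ck_on:
  "Ck_on (Suc r) W F \<Longrightarrow> Ck_on r W F"
proof (induction r arbitrary: F)
  case 0
  then show ?case by (simp add: differentiable_imp_continuous_on)
next
  case (Suc r)
  from Suc.prems have F: "F differentiable_on W" and D: "Ck_on (Suc r) W (\<lambda>p. frechet_derivative F (at p) X)" for X
    by (simp_all del: Ck_on.simps add: Ck_on.simps(2)[of "Suc r"])
  show ?case
    using F Suc.IH[OF D] by simp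
qed

lemma Ck_on_subset:
  assumes "Ck_on r W F" "V \<subseteq> W"
  shows "Ck_on r V F"
  using assms(1)
proof (induction r arbitrary: F)
  case 0
  then show ?case using continuous_on_subset[OF _ assms(2)] by simp
next
  case (Suc r)
  then have F: "F differentiable_on W" and D: "Ck_on r W (\<lambda>p. frechet_derivative F (at p) X)" for X
    by simp_all
  show ?case
    using differentiable_on_subset[OF F assms(2)] Suc.IH[OF D] by simp
qed

lemma Ck_on_Un_local:
  assumes "open W" "\<And>p. p \<in> W \<Longrightarrow> \<exists>V. open V \<and> p \<in> V \<and> Ck_on r V F"
  shows "Ck_on r W F"
  using assms(2)
proof (induction r arbitrary: F)
  case 0
  then have "isCont F p" if "p \<in> W" for p
    by (metis Ck_on.simps(1) continuous_on_eq_continuous_at that)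
  then show ?case by (simp add: continuous_at_imp_continuous_on)
next
  case (Suc r)
  have "F differentiable (at p)" if "p \<in> W" for p
    by (metis Ck_on.simps(2) Suc.prems differentiable_on_eq_differentiable_at that)
  then have "F differentiable_on W"
    using \<open>open W\<close> by (simp add: differentiable_on_eq_differentiable_at)
  moreover have "Ck_on r W (\<lambda>p. frechet_derivative F (at p) X)" for X
    by (rule Suc.IH) (metis Ck_on.simps(2) Suc.prems)
  ultimately show ?case by simp
qed

lemma Ck_on_SucD:
  assumes "Ck_on (Suc r) W F" "open W"
  shows "p \<in> W \<Longrightarrow> (F has_derivative frechet_derivative F (at p)) (at p)"
    and "Ck_on r W (\<lambda>p. frechet_derivative F (at p) X)"
  using assms by (auto simp: differentiable_on_eq_differentiable_at has_derivative_frechet)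

lemma Ck_on_const: "open W \<Longrightarrow> Ck_on r W (\<lambda>_. c)"
  by (induction r arbitrary: c) auto

lemma Ck_on_add:
  assumes "open W" "Ck_on r W F" "Ck_on r W G"
  shows "Ck_on r W (\<lambda>p. F p + G p)"
  using assms(2,3)
proof (induction r arbitrary: F G)
  case 0
  then show ?case by (simp add: continuous_on_add)
next
  case (Suc r)
  show ?case
    by (rule Ck_on_Suc_intro[OF \<open>open W\<close> has_derivative_add[OF Ck_on_SucD(1)[OF Suc.prems(1)] Ck_on_SucD(1)[OF Suc.prems(2)]] Suc.IH])
       (use Suc.prems \<open>open W\<close> in auto)
qed

lemma Ck_on_linear:
  assumes "open W" "bounded_linear L" "Ck_on r W F"
  shows "Ck_on r W (\<lambda>p. L (F p))"
  using assms(3)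
proof (induction r arbitrary: F)
  case 0
  then show ?case by (simp add: assms(2) bounded_linear.continuous_on)
next
  case (Suc r)
  show ?case
    by (rule Ck_on_Suc_intro[OF \<open>open W\<close> bounded_linear.has_derivative[OF assms(2) Ck_on_SucD(1)[OF Suc.prems]] Suc.IH])
       (use Suc.prems \<open>open W\<close> in auto)
qed

lemma Ck_on_ident: "open W \<Longrightarrow> Ck_on r W (\<lambda>p. p)"
  by (cases r) (auto simp: Ck_on_const)

lemma (in bounded_bilinear) Ck_on:
  assumes "open W" "Ck_on r W F" "Ck_on r W G"
  shows "Ck_on r W (\<lambda>p. prod (F p) (G p))"
  using assms(2,3)
proof (induction r arbitrary: F G)
  case 0
  then show ?case by (simp add: continuous_on)
next
  case (Suc r)
  show ?case
    by (rule Ck_on_Suc_intro[OF \<open>open W\<close> FDERIV[OF Ck_on_SucD(1)[OF Suc.prems(1)] Ck_on_SucD(1)[OF Suc.prems(2)]]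
         Ck_on_add[OF \<open>open W\<close> Suc.IH Suc.IH]])
       (use Suc.prems \<open>open W\<close> Ck_on_Suc_imp_Ck_on in auto)
qed

lemma Ck_on_sum:
  assumes "open W" "\<And>i. i \<in> I \<Longrightarrow> Ck_on r W (F i)"
  shows "Ck_on r W (\<lambda>p. \<Sum>i\<in>I. F i p)"
  using assms(2) by (induction I rule: infinite_finite_induct) (auto simp: Ck_on_const Ck_on_add assms(1))

text \<open>The derivative of \<open>G\<close> is taken in the direction \<open>F' p X\<close>,
  which moves with \<open>p\<close>, whereas \<open>Ck_on\<close> speaks of fixed directions.
  Expanding that direction in \<open>Basis\<close> gives a finite sum of products to which the
  induction hypothesis applies; hence the Euclidean space in the middle.\<close>

lemma Ck_on_compose:
  fixes G :: "'b::euclidean_space \<Rightarrow> 'e::real_normed_vector"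
  assumes "open W" "open V" "Ck_on r V G" "Ck_on r W F" "F ` W \<subseteq> V"
  shows "Ck_on r W (\<lambda>p. G (F p))"
  using assms(3,4,5)
proof (induction r arbitrary: F G)
  case 0
  then show ?case by (auto intro: continuous_on_compose2)
next
  case (Suc r)
  let ?F' = "\<lambda>p. frechet_derivative F (at p)" and ?G' = "\<lambda>q. frechet_derivative G (at q)"
  have D: "((\<lambda>p. G (F p)) has_derivative (\<lambda>X. \<Sum>b\<in>Basis. (?F' p X \<bullet> b) *\<^sub>R ?G' (F p) b)) (at p)" if "p \<in> W" for p
  proof -
    have "F p \<in> V" using Suc.prems(3) that by auto
    then have G: "(G has_derivative ?G' (F p)) (at (F p))"
      using Ck_on_SucD(1)[OF Suc.prems(1) \<open>open V\<close>] by auto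
    have F: "(F has_derivative ?F' p) (at p)"
      using Ck_on_SucD(1)[OF Suc.prems(2) \<open>open W\<close> that] .
    have "?G' (F p) (?F' p X) = (\<Sum>b\<in>Basis. (?F' p X \<bullet> b) *\<^sub>R ?G' (F p) b)" for X
    proof -
      have "?G' (F p) (?F' p X) = ?G' (F p) (\<Sum>b\<in>Basis. (?F' p X \<bullet> b) *\<^sub>R b)"
        by (simp add: euclidean_representation)
      then show ?thesis
        using has_derivative_linear[OF G] by (simp add: linear_sum linear_cmul)
    qed
    with has_derivative_compose[OF F G] show ?thesis by simp
  qed
  have "Ck_on r W (\<lambda>p. (?F' p X \<bullet> b) *\<^sub>R ?G' (F p) b)" for X b
  proof (rule bounded_bilinear.Ck_on[OF bounded_bilinear_scaleR \<open>open W\<close>])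
    show "Ck_on r W (\<lambda>p. ?F' p X \<bullet> b)"
      using Ck_on_linear[OF \<open>open W\<close> bounded_linear_inner_left Ck_on_SucD(2)[OF Suc.prems(2) \<open>open W\<close>]] .
    show "Ck_on r W (\<lambda>p. ?G' (F p) b)"
      using Suc.IH[OF Ck_on_SucD(2)[OF Suc.prems(1) \<open>open V\<close>] Ck_on_Suc_imp_Ck_on[OF Suc.prems(2)] Suc.prems(3)] .
  qed
  then have C: "Ck_on r W (\<lambda>p. \<Sum>b\<in>Basis. (?F' p X \<bullet> b) *\<^sub>R ?G' (F p) b)" for X
    by (rule Ck_on_sum[OF \<open>open W\<close>])
  show ?case
  proof (rule Ck_on_Suc_intro[OF \<open>open W\<close>])
    show "((\<lambda>p. G (F p)) has_derivative (\<lambda>X. \<Sum>b\<in>Basis. (?F' p X \<bullet> b) *\<^sub>R ?G' (F p) b)) (at p)" if "p \<in> W" for p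
      using D[OF that] .
    show "Ck_on r W (\<lambda>p. \<Sum>b\<in>Basis. (?F' p X \<bullet> b) *\<^sub>R ?G' (F p) b)" for X
      using C .
  qed
qed

lemma smooth_on_openD:
  assumes "smooth_on_open W F" "open W"
  shows "p \<in> W \<Longrightarrow> (F has_derivative frechet_derivative F (at p)) (at p)"
    and "smooth_on_open W (\<lambda>p. frechet_derivative F (at p) X)"
    and "continuous_on W F"
proof -
  have C: "Ck_on r W F" for r using assms(1) by (simp add: smooth_on_open_def)
  show "p \<in> W \<Longrightarrow> (F has_derivative frechet_derivative F (at p)) (at p)"
    using Ck_on_SucD(1)[OF C \<open>open W\<close>] .
  show "smooth_on_open W (\<lambda>p. frechet_derivative F (at p) X)"
    unfolding smooth_on_open_def using Ck_on_SucD(2)[OF C \<open>open W\<close>] by (rule allI)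
  show "continuous_on W F"
    using C[of 0] by simp
qed

text \<open>This avoids computing higher derivatives: a concrete function is placed in an explicit
  family \<open>P\<close> that differentiation does not leave, such as all
  \<open>a * cos x + b * sin x\<close>, and one derivative per member suffices.\<close>

lemma smooth_on_openI:
  assumes "open W" "P F"
    and "\<And>F. P F \<Longrightarrow> \<exists>F'. (\<forall>p\<in>W. (F has_derivative F' p) (at p)) \<and> (\<forall>X. P (\<lambda>p. F' p X))"
  shows "smooth_on_open W F"
proof -
  have C: "Ck_on r W F" if "P F" for r F
    using that
  proof (induction r arbitrary: F)
    case 0
    from assms(3)[OF this] obtain F' where "\<forall>p\<in>W. (F has_derivative F' p) (at p)" by blast
    then show ?case
      by (auto intro!: continuous_at_imp_continuous_on has_derivative_continuous)
  next
    case (Suc r)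
    from assms(3)[OF this(2)] obtain F' where F': "\<forall>p\<in>W. (F has_derivative F' p) (at p)" "\<forall>X. P (\<lambda>p. F' p X)" by blast
    show ?case
    proof (rule Ck_on_Suc_intro[OF \<open>open W\<close>])
      show "(F has_derivative F' p) (at p)" if "p \<in> W" for p using F'(1) that by blast
      show "Ck_on r W (\<lambda>p. F' p X)" for X using F'(2) by (intro Suc.IH) simp
    qed
  qed
  show ?thesis unfolding smooth_on_open_def using C[OF \<open>P F\<close>] by (rule allI)
qed

lemma smooth_on_open_cong:
  assumes "open W" "\<And>p. p \<in> W \<Longrightarrow> F p = G p" "smooth_on_open W F"
  shows "smooth_on_open W G"
  unfolding smooth_on_open_def
proof
  fix r show "Ck_on r W G"
    using assms(3) by (intro Ck_on_cong[OF assms(1,2)]) (simp_all add: smooth_on_open_def)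
qed

lemma smooth_on_open_subset:
  assumes "smooth_on_open W F" "V \<subseteq> W"
  shows "smooth_on_open V F"
  unfolding smooth_on_open_def
proof
  fix r show "Ck_on r V F"
    using assms(1) by (intro Ck_on_subset[OF _ assms(2)]) (simp add: smooth_on_open_def)
qed

lemma smooth_on_open_local:
  assumes "open W" "\<And>p. p \<in> W \<Longrightarrow> \<exists>V. open V \<and> p \<in> V \<and> smooth_on_open V F"
  shows "smooth_on_open W F"
  unfolding smooth_on_open_def
proof
  fix r show "Ck_on r W F"
  proof (rule Ck_on_Un_local[OF assms(1)])
    fix p assume "p \<in> W"
    with assms(2) obtain V where "open V" "p \<in> V" "smooth_on_open V F" by blast
    then show "\<exists>V. open V \<and> p \<in> V \<and> Ck_on r V F" by (auto simp: smooth_on_open_def)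
  qed
qed

section \<open>Closure properties of smooth functions\<close>

lemma smooth_on_open_const: "open W \<Longrightarrow> smooth_on_open W (\<lambda>_. c)"
  and smooth_on_open_ident: "open W \<Longrightarrow> smooth_on_open W (\<lambda>p. p)"
  and smooth_on_open_add: "open W \<Longrightarrow> smooth_on_open W F \<Longrightarrow> smooth_on_open W G \<Longrightarrow> smooth_on_open W (\<lambda>p. F p + G p)"
  and smooth_on_open_linear: "open W \<Longrightarrow> bounded_linear L \<Longrightarrow> smooth_on_open W F \<Longrightarrow> smooth_on_open W (\<lambda>p. L (F p))"
  and smooth_on_open_bilinear: "open W \<Longrightarrow> bounded_bilinear B \<Longrightarrow> smooth_on_open W F' \<Longrightarrow> smooth_on_open W G' \<Longrightarrow> smooth_on_open W (\<lambda>p. B (F' p) (G' p))"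
  and smooth_on_open_sum: "open W \<Longrightarrow> (\<And>i. i \<in> I \<Longrightarrow> smooth_on_open W (H i)) \<Longrightarrow> smooth_on_open W (\<lambda>p. \<Sum>i\<in>I. H i p)"
  unfolding smooth_on_open_def
  by (auto intro: Ck_on_const Ck_on_ident Ck_on_add Ck_on_linear bounded_bilinear.Ck_on Ck_on_sum)

lemma smooth_on_open_compose:
  fixes G :: "'b::euclidean_space \<Rightarrow> 'e::real_normed_vector"
  shows "open W \<Longrightarrow> open V \<Longrightarrow> smooth_on_open V G \<Longrightarrow> smooth_on_open W F \<Longrightarrow> F ` W \<subseteq> V
    \<Longrightarrow> smooth_on_open W (\<lambda>p. G (F p))"
  by (simp add: smooth_on_open_def Ck_on_compose)

lemmas smooth_on_open_mult = smooth_on_open_bilinear[OF _ bounded_bilinear_mult]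
  and smooth_on_open_scaleR = smooth_on_open_bilinear[OF _ bounded_bilinear_scaleR]
  and smooth_on_open_inner = smooth_on_open_bilinear[OF _ bounded_bilinear_inner]
  and smooth_on_open_minus = smooth_on_open_linear[OF _ bounded_linear_minus[OF bounded_linear_ident]]
  and smooth_on_open_fst = smooth_on_open_linear[OF _ bounded_linear_fst]
  and smooth_on_open_snd = smooth_on_open_linear[OF _ bounded_linear_snd]

lemma smooth_on_open_diff:
  "open W \<Longrightarrow> smooth_on_open W F \<Longrightarrow> smooth_on_open W G \<Longrightarrow> smooth_on_open W (\<lambda>p. F p - G p)"
  using smooth_on_open_add[of W F "\<lambda>p. - G p"] smooth_on_open_minus[of W G] by simp

lemma smooth_on_open_Pair:
  assumes "open W" "smooth_on_open W F" "smooth_on_open W G"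
  shows "smooth_on_open W (\<lambda>p. (F p, G p))"
proof -
  have "bounded_linear (\<lambda>x::'b. (x, 0::'c))" "bounded_linear (\<lambda>x::'c. (0::'b, x))"
    by (auto intro!: bounded_linear_intros)
  from smooth_on_open_add[OF assms(1) smooth_on_open_linear[OF assms(1) this(1) assms(2)]
      smooth_on_open_linear[OF assms(1) this(2) assms(3)]]
  show ?thesis by simp
qed

lemma smooth_on_open_power:
  fixes F :: "'m::real_normed_vector \<Rightarrow> real"
  shows "open W \<Longrightarrow> smooth_on_open W F \<Longrightarrow> smooth_on_open W (\<lambda>p. F p ^ n)"
  by (induction n) (auto intro: smooth_on_open_const smooth_on_open_mult)

lemma smooth_on_open_field_derivI:
  fixes F :: "real \<Rightarrow> real"
  assumes "open W" "P F"
    and "\<And>F. P F \<Longrightarrow> \<exists>F'. (\<forall>p\<in>W. (F has_field_derivative F' p) (at p)) \<and> (\<forall>X. P (\<lambda>p. F' p * X))"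
  shows "smooth_on_open W F"
proof (rule smooth_on_openI[where P=P, OF assms(1,2)])
  fix F assume "P F"
  from assms(3)[OF this] obtain F' where "\<forall>p\<in>W. (F has_field_derivative F' p) (at p)" "\<forall>X. P (\<lambda>p. F' p * X)"
    by blast
  then show "\<exists>F'. (\<forall>p\<in>W. (F has_derivative F' p) (at p)) \<and> (\<forall>X. P (\<lambda>p. F' p X))"
    by (intro exI[of _ "\<lambda>p X. F' p * X"]) (auto simp: has_field_derivative_def)
qed

lemma smooth_on_open_cos_sin: "smooth_on_open UNIV (\<lambda>x::real. a * cos x + b * sin x)"
proof (rule smooth_on_open_field_derivI[where P="\<lambda>F. \<exists>a b. F = (\<lambda>x. a * cos x + b * sin x)"])
  fix F :: "real \<Rightarrow> real" assume "\<exists>a b. F = (\<lambda>x. a * cos x + b * sin x)"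
  then obtain a b where F: "F = (\<lambda>x. a * cos x + b * sin x)" by blast
  show "\<exists>F'. (\<forall>p\<in>UNIV. (F has_field_derivative F' p) (at p)) \<and>
        (\<forall>X. \<exists>a b. (\<lambda>p. F' p * X) = (\<lambda>x. a * cos x + b * sin x))"
    unfolding F
  proof (intro exI[of _ "\<lambda>x. b * cos x - a * sin x"] conjI ballI allI)
    show "\<exists>a' b'. (\<lambda>p. (b * cos p - a * sin p) * X) = (\<lambda>x. a' * cos x + b' * sin x)" for X
      by (intro exI[of _ "b * X"] exI[of _ "- (a * X)"] ext) (simp add: algebra_simps)
  qed (auto intro!: derivative_eq_intros simp: algebra_simps)
qed auto

lemma smooth_on_open_inverse_real: "smooth_on_open (- {0}) (\<lambda>x::real. inverse x)"
proof -
  have "smooth_on_open (- {0}) (\<lambda>x::real. 1 * inverse x ^ 1)"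
  proof (rule smooth_on_open_field_derivI[where P="\<lambda>F. \<exists>c n. F = (\<lambda>x. c * inverse x ^ n)"])
    fix F :: "real \<Rightarrow> real" assume "\<exists>c n. F = (\<lambda>x. c * inverse x ^ n)"
    then obtain c n where F: "F = (\<lambda>x. c * inverse x ^ n)" by blast
    have "(\<forall>p\<in>-{0}. (F has_field_derivative (- c * n * inverse p ^ (Suc n))) (at p))"
    proof
      fix p :: real assume "p \<in> -{0}"
      then have "((\<lambda>x. inverse x) has_field_derivative - (inverse p ^ 2)) (at p)"
        by (auto intro!: derivative_eq_intros simp: power2_eq_square)
      from DERIV_cmult[OF DERIV_power[OF this, of n], of c]
      show "(F has_field_derivative (- c * n * inverse p ^ (Suc n))) (at p)"
        unfolding F by (cases n) (simp_all add: power2_eq_square mult_ac)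
    qed
    moreover have "\<exists>a b. (\<lambda>p. - c * n * inverse p ^ (Suc n) * X) = (\<lambda>x. a * inverse x ^ b)" for X
      by (intro exI[of _ "-c * n * X"] exI[of _ "Suc n"]) auto
    ultimately show "\<exists>F'. (\<forall>p\<in>-{0}. (F has_field_derivative F' p) (at p)) \<and>
        (\<forall>X. \<exists>a b. (\<lambda>p. F' p * X) = (\<lambda>x. a * inverse x ^ b))"
      by (intro exI[of _ "\<lambda>p. - c * n * inverse p ^ Suc n"]) simp
  next
    show "\<exists>c n. (\<lambda>x::real. 1 * inverse x ^ 1) = (\<lambda>x. c * inverse x ^ n)" by blast
  qed (auto simp: open_delete)
  then show ?thesis by simp
qed

text \<open>The family consists of the multiples of x^(1/2 - n), written as
  \<open>sqrt x * inverse x ^ n\<close> to stay with natural exponents.\<close>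

lemma smooth_on_open_sqrt_real: "smooth_on_open {0<..} (\<lambda>x::real. sqrt x)"
proof -
  have "smooth_on_open {0<..} (\<lambda>x::real. 1 * (sqrt x * inverse x ^ 0))"
  proof (rule smooth_on_open_field_derivI[where P="\<lambda>F. \<exists>c n. F = (\<lambda>x. c * (sqrt x * inverse x ^ n))"])
    fix F :: "real \<Rightarrow> real" assume "\<exists>c n. F = (\<lambda>x. c * (sqrt x * inverse x ^ n))"
    then obtain c n where F: "F = (\<lambda>x. c * (sqrt x * inverse x ^ n))" by blast
    have "(F has_field_derivative (c * (1/2 - n) * (sqrt p * inverse p ^ (Suc n)))) (at p)" if "p > 0" for p
    proof -
      have sq: "inverse (sqrt p) = sqrt p * inverse p"
        using that by (simp add: real_div_sqrt field_simps)
      have "((\<lambda>x. inverse x) has_field_derivative - (inverse p ^ 2)) (at p)"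
        using that by (auto intro!: derivative_eq_intros simp: power2_eq_square)
      from DERIV_cmult[OF DERIV_mult[OF DERIV_real_sqrt[OF that] DERIV_power[OF this, of n]], of c]
      show ?thesis
        unfolding F sq by (elim DERIV_cong, cases n) (simp_all add: power2_eq_square algebra_simps)
    qed
    moreover have "\<exists>a b. (\<lambda>p. c * (1/2 - n) * (sqrt p * inverse p ^ (Suc n)) * X) = (\<lambda>x. a * (sqrt x * inverse x ^ b))" for X
      by (intro exI[of _ "c * (1/2 - n) * X"] exI[of _ "Suc n"]) auto
    ultimately show "\<exists>F'. (\<forall>p\<in>{0<..}. (F has_field_derivative F' p) (at p)) \<and>
        (\<forall>X. \<exists>a b. (\<lambda>p. F' p * X) = (\<lambda>x. a * (sqrt x * inverse x ^ b)))"
      by (intro exI[of _ "\<lambda>p. c * (1/2 - n) * (sqrt p * inverse p ^ Suc n)"]) simp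
  next
    show "\<exists>c n. (\<lambda>x::real. 1 * (sqrt x * inverse x ^ 0)) = (\<lambda>x. c * (sqrt x * inverse x ^ n))" by blast
  qed auto
  then show ?thesis by simp
qed

lemma smooth_on_open_cos: "open W \<Longrightarrow> smooth_on_open W F \<Longrightarrow> smooth_on_open W (\<lambda>p. cos (F p :: real))"
  and smooth_on_open_sin: "open W \<Longrightarrow> smooth_on_open W F \<Longrightarrow> smooth_on_open W (\<lambda>p. sin (F p :: real))"
  using smooth_on_open_compose[OF _ _ smooth_on_open_cos_sin[of 1 0]]
    smooth_on_open_compose[OF _ _ smooth_on_open_cos_sin[of 0 1]] by auto

lemma smooth_on_open_inverse:
  fixes F :: "'m::real_normed_vector \<Rightarrow> real"
  shows "open W \<Longrightarrow> smooth_on_open W F \<Longrightarrow> (\<And>p. p \<in> W \<Longrightarrow> F p \<noteq> 0) \<Longrightarrow> smooth_on_open W (\<lambda>p. inverse (F p))"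
  by (rule smooth_on_open_compose[OF _ _ smooth_on_open_inverse_real]) (auto simp: open_delete)

lemma smooth_on_open_divide:
  fixes F G :: "'m::real_normed_vector \<Rightarrow> real"
  shows "open W \<Longrightarrow> smooth_on_open W F \<Longrightarrow> smooth_on_open W G \<Longrightarrow> (\<And>p. p \<in> W \<Longrightarrow> G p \<noteq> 0)
     \<Longrightarrow> smooth_on_open W (\<lambda>p. F p / G p)"
  unfolding divide_inverse by (intro smooth_on_open_mult smooth_on_open_inverse) auto

lemma smooth_on_open_sqrt:
  fixes F :: "'m::real_normed_vector \<Rightarrow> real"
  shows "open W \<Longrightarrow> smooth_on_open W F \<Longrightarrow> (\<And>p. p \<in> W \<Longrightarrow> F p > 0) \<Longrightarrow> smooth_on_open W (\<lambda>p. sqrt (F p))"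
  by (rule smooth_on_open_compose[OF _ _ smooth_on_open_sqrt_real]) auto

lemmas smooth_on_open_intros =
  smooth_on_open_const smooth_on_open_ident smooth_on_open_add smooth_on_open_diff smooth_on_open_minus
  smooth_on_open_mult smooth_on_open_scaleR smooth_on_open_inner smooth_on_open_fst smooth_on_open_snd
  smooth_on_open_sum smooth_on_open_Pair smooth_on_open_power smooth_on_open_cos smooth_on_open_sin
  smooth_on_open_inverse smooth_on_open_divide smooth_on_open_sqrt

lemma smooth_on_open_norm:
  fixes F :: "'m::real_normed_vector \<Rightarrow> 'b::euclidean_space"
  assumes "open W" "smooth_on_open W F" "\<And>p. p \<in> W \<Longrightarrow> F p \<noteq> 0"
  shows "smooth_on_open W (\<lambda>p. norm (F p))"
  unfolding norm_eq_sqrt_inner by (intro smooth_on_open_intros assms) (use assms(3) in auto)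

lemma smooth_real_deriv:
  fixes F :: "real \<Rightarrow> real"
  assumes "smooth_on_open UNIV F"
  shows "(F has_field_derivative deriv F x) (at x)" "smooth_on_open UNIV (deriv F)"
proof -
  have *: "(F has_field_derivative frechet_derivative F (at x) 1) (at x)" for x
  proof -
    have D: "(F has_derivative frechet_derivative F (at x)) (at x)"
      using smooth_on_openD(1)[OF assms] by auto
    have "frechet_derivative F (at x) h = frechet_derivative F (at x) 1 * h" for h
      using linear_cmul[OF has_derivative_linear[OF D], of h 1] by simp
    with D show ?thesis by (metis has_derivative_eq_rhs has_field_derivative_def ext)
  qed
  then have "deriv F x = frechet_derivative F (at x) 1" for x by (rule DERIV_imp_deriv)
  then have "deriv F = (\<lambda>x. frechet_derivative F (at x) 1)" by (simp add: fun_eq_iff)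
  with * smooth_on_openD(2)[OF assms, of 1] show "(F has_field_derivative deriv F x) (at x)" "smooth_on_open UNIV (deriv F)"
    by simp_all
qed

section \<open>The Laplacian of the immersed manifold\<close>

text \<open>Within a submanifold the Frechet derivative is not unique as a map on the ambient space,
  and \<open>frechet_derivative\<close> picks one of the candidates. Any two agree on
  \<open>X\<close>, because both, composed with a curve in \<open>N\<close> of velocity
  \<open>X\<close>, give the derivative of \<open>F\<close> along that curve.\<close>

lemma differential_eqI:
  assumes F: "(F has_derivative F') (at p within N)" and X: "X \<in> tangent_space N p"
  shows "differential N F p X = F' X"
proof -
  from X obtain \<gamma> :: "real \<Rightarrow> 'a" where \<gamma>: "\<forall>t. \<gamma> t \<in> N" "\<gamma> 0 = p"
      and D: "(\<gamma> has_derivative (\<lambda>h. h *\<^sub>R X)) (at 0)"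
    by (auto simp: tangent_space_def has_vector_derivative_def)
  have *: "((\<lambda>t. F (\<gamma> t)) has_derivative (\<lambda>h. L (h *\<^sub>R X))) (at 0)"
    if "(F has_derivative L) (at p within N)" for L
    by (rule has_derivative_in_compose[OF D has_derivative_subset])
       (use \<gamma> that in auto)
  have "(F has_derivative differential N F p) (at p within N)"
    unfolding differential_def using F frechet_derivative_works differentiableI by blast
  from has_derivative_unique[OF *[OF this] *[OF F]]
  show ?thesis by (metis scaleR_one)
qed

lemma has_derivative_within_extension:
  assumes "(G has_derivative G') (at p)" "open W" "p \<in> N \<inter> W" "\<And>q. q \<in> N \<inter> W \<Longrightarrow> G q = F q"
  shows "(F has_derivative G') (at p within N)"
proof -
  obtain d where "d > 0" "ball p d \<subseteq> W" using assms(2,3) openE by blast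
  then show ?thesis
    using assms(3,4)
    by (intro has_derivative_transform_within[OF has_derivative_at_withinI[OF assms(1)], of d])
       (auto simp: dist_commute subset_iff)
qed

text \<open>Frames are orthonormal for the inner product pulled back along a linear map \<open>L\<close>, as the induced metric
  is pulled back along the differential of the immersion.\<close>

lemma orthonormal_expansion:
  fixes L :: "'m::real_vector \<Rightarrow> 'e::real_inner"
  assumes "linear L" "finite B" "\<forall>X\<in>B. \<forall>Y\<in>B. L X \<bullet> L Y = (if X = Y then 1 else 0)" "X \<in> span B"
  shows "X = (\<Sum>Y\<in>B. (L X \<bullet> L Y) *\<^sub>R Y)"
proof -
  obtain c where c: "X = (\<Sum>Y\<in>B. c Y *\<^sub>R Y)"
    using assms(4) span_finite[OF assms(2)] by auto
  have "L X \<bullet> L Z = c Z" if "Z \<in> B" for Z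
  proof -
    have "L X \<bullet> L Z = (\<Sum>Y\<in>B. c Y * (L Y \<bullet> L Z))"
      by (simp add: c linear_sum[OF assms(1)] linear_cmul[OF assms(1)] inner_sum_left)
    also have "\<dots> = (\<Sum>Y\<in>B. c Y * (if Y = Z then 1 else 0))"
      using assms(3) that by (intro sum.cong) auto
    finally show ?thesis using that assms(2) by (simp add: if_distrib cong: if_cong)
  qed
  then show ?thesis by (subst c) (auto intro: sum.cong)
qed

lemma orthonormal_finite:
  fixes L :: "'m \<Rightarrow> 'e::euclidean_space"
  assumes "\<forall>X\<in>B. \<forall>Y\<in>B. L X \<bullet> L Y = (if X = Y then 1 else 0)"
  shows "finite B"
proof (rule finite_imageD)
  show "inj_on L B"
    by (rule inj_onI) (metis assms zero_neq_one)
  have "pairwise orthogonal (L ` B)"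
    using assms by (auto simp: pairwise_def orthogonal_def)
  then show "finite (L ` B)" by (rule pairwise_orthogonal_imp_finite)
qed

text \<open>Makes the \<open>SOME\<close> in \<open>divergence\<close> harmless. Each vector of
  \<open>B\<close> is expanded in \<open>B'\<close>; after exchanging the sums, the coefficients
  collapse by Parseval's identity in \<open>B\<close>.\<close>

lemma orthonormal_trace_unique:
  fixes L :: "'m::real_vector \<Rightarrow> 'e::euclidean_space" and \<beta> :: "'m \<Rightarrow> 'm \<Rightarrow> real"
  assumes L: "linear L" and \<beta>: "bilinear \<beta>"
    and B: "\<forall>X\<in>B. \<forall>Y\<in>B. L X \<bullet> L Y = (if X = Y then 1 else 0)"
    and B': "\<forall>X\<in>B'. \<forall>Y\<in>B'. L X \<bullet> L Y = (if X = Y then 1 else 0)"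
    and sp: "span B = span B'"
  shows "(\<Sum>X\<in>B. \<beta> X X) = (\<Sum>X\<in>B'. \<beta> X X)"
proof -
  have fin: "finite B" "finite B'" using B B' by (auto intro: orthonormal_finite)
  have *: "\<beta> X X = (\<Sum>Y\<in>B'. \<Sum>Z\<in>B'. ((L X \<bullet> L Y) * (L X \<bullet> L Z)) * \<beta> Y Z)" if "X \<in> B" for X
  proof -
    have "X = (\<Sum>Y\<in>B'. (L X \<bullet> L Y) *\<^sub>R Y)"
      using that sp span_superset by (intro orthonormal_expansion L fin B') blast
    then have "\<beta> X X = \<beta> (\<Sum>Y\<in>B'. (L X \<bullet> L Y) *\<^sub>R Y) (\<Sum>Z\<in>B'. (L X \<bullet> L Z) *\<^sub>R Z)"
      by simp
    also have "\<dots> = (\<Sum>(Y,Z)\<in>B'\<times>B'. \<beta> ((L X \<bullet> L Y) *\<^sub>R Y) ((L X \<bullet> L Z) *\<^sub>R Z))"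
      by (rule bilinear_sum[OF \<beta>])
    also have "\<dots> = (\<Sum>(Y,Z)\<in>B'\<times>B'. ((L X \<bullet> L Y) * (L X \<bullet> L Z)) * \<beta> Y Z)"
      by (intro sum.cong) (auto simp: bilinear_lmul[OF \<beta>] bilinear_rmul[OF \<beta>])
    finally show ?thesis by (simp add: sum.cartesian_product)
  qed
  have **: "(\<Sum>X\<in>B. (L X \<bullet> L Y) * (L X \<bullet> L Z)) = L Y \<bullet> L Z" if "Y \<in> B'" for Y Z
  proof -
    have "Y = (\<Sum>X\<in>B. (L Y \<bullet> L X) *\<^sub>R X)"
      using that sp span_superset by (intro orthonormal_expansion L fin B) blast
    then have "L Y = (\<Sum>X\<in>B. (L Y \<bullet> L X) *\<^sub>R L X)"
      by (metis (mono_tags, lifting) L linear_cmul linear_sum sum.cong)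
    from arg_cong[OF this, of "\<lambda>w. w \<bullet> L Z"] have "L Y \<bullet> L Z = (\<Sum>X\<in>B. (L Y \<bullet> L X) * (L X \<bullet> L Z))"
      by (simp add: inner_sum_left)
    then show ?thesis by (simp add: inner_commute[of "L Y"])
  qed
  have "(\<Sum>X\<in>B. \<beta> X X) = (\<Sum>X\<in>B. \<Sum>Y\<in>B'. \<Sum>Z\<in>B'. ((L X \<bullet> L Y) * (L X \<bullet> L Z)) * \<beta> Y Z)"
    using * by simp
  also have "\<dots> = (\<Sum>Y\<in>B'. \<Sum>X\<in>B. \<Sum>Z\<in>B'. ((L X \<bullet> L Y) * (L X \<bullet> L Z)) * \<beta> Y Z)"
    by (rule sum.swap)
  also have "\<dots> = (\<Sum>Y\<in>B'. \<Sum>Z\<in>B'. \<Sum>X\<in>B. ((L X \<bullet> L Y) * (L X \<bullet> L Z)) * \<beta> Y Z)"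
    by (intro sum.cong refl sum.swap)
  also have "\<dots> = (\<Sum>Y\<in>B'. \<Sum>Z\<in>B'. (L Y \<bullet> L Z) * \<beta> Y Z)"
    by (intro sum.cong refl) (simp add: ** sum_distrib_right[symmetric])
  also have "\<dots> = (\<Sum>Y\<in>B'. \<Sum>Z\<in>B'. (if Y = Z then 1 else 0) * \<beta> Y Z)"
    using B' by (intro sum.cong refl) auto
  also have "\<dots> = (\<Sum>Y\<in>B'. \<beta> Y Y)"
    using fin by (intro sum.cong refl) (simp add: if_distrib if_distribR cong: if_cong)
  finally show ?thesis .
qed

section \<open>Tangent spaces and partial derivatives on the product of the sphere and the
  plane\<close>

type_synonym 'a coords = "'a \<times> real \<times> real"

lemma tangent_space_M_dom:
  fixes y :: "'a::euclidean_space"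
  assumes "norm y = 1"
  shows "tangent_space M_dom (y, u, v) = {X. fst X \<bullet> y = 0}"
proof (intro equalityI subsetI)
  fix X :: "'a coords" assume "X \<in> tangent_space M_dom (y, u, v)"
  then obtain \<gamma> where \<gamma>: "\<forall>t::real. \<gamma> t \<in> M_dom" "\<gamma> 0 = (y, u, v)" "(\<gamma> has_vector_derivative X) (at 0)"
    by (auto simp: tangent_space_def)
  have D: "((\<lambda>t. fst (\<gamma> t)) has_vector_derivative fst X) (at 0)"
    using bounded_linear.has_vector_derivative[OF bounded_linear_fst \<gamma>(3)] .
  have "((\<lambda>t. fst (\<gamma> t) \<bullet> fst (\<gamma> t)) has_vector_derivative (fst (\<gamma> 0) \<bullet> fst X + fst X \<bullet> fst (\<gamma> 0))) (at 0)"
    by (rule bounded_bilinear.has_vector_derivative[OF bounded_bilinear_inner D D])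
  moreover have "fst (\<gamma> t) \<bullet> fst (\<gamma> t) = 1" for t
    using \<gamma>(1) by (auto simp: M_dom_def mem_Times_iff dot_square_norm)
  ultimately have "((\<lambda>t::real. 1::real) has_vector_derivative (fst (\<gamma> 0) \<bullet> fst X + fst X \<bullet> fst (\<gamma> 0))) (at 0)"
    by simp
  then have "fst (\<gamma> 0) \<bullet> fst X + fst X \<bullet> fst (\<gamma> 0) = 0"
    using vector_derivative_unique_at has_vector_derivative_const by blast
  then show "X \<in> {X. fst X \<bullet> y = 0}" using \<gamma>(2) by (simp add: inner_commute)
next
  fix X :: "'a coords" assume X: "X \<in> {X. fst X \<bullet> y = 0}"
  obtain Y a b where XY: "X = (Y, a, b)" by (metis prod_cases3)
  \<comment> \<open>\<open>c t\<close> projects the line y + t Y back to the sphere. It is even in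
    \<open>t\<close>, so its derivative at 0 vanishes and the curve keeps the velocity
    \<open>Y\<close>.\<close>
  define c where "c t = inverse (sqrt (1 + t\<^sup>2 * (Y \<bullet> Y)))" for t
  define \<gamma> where "\<gamma> t = (c t *\<^sub>R (y + t *\<^sub>R Y), u + t * a, v + t * b)" for t
  have "\<gamma> t \<in> M_dom" for t
  proof -
    have "(y + t *\<^sub>R Y) \<bullet> (y + t *\<^sub>R Y) = 1 + t\<^sup>2 * (Y \<bullet> Y)"
      using X XY assms
      by (simp add: inner_add_left inner_add_right norm_eq_1 inner_commute power2_eq_square)
    then have "norm (y + t *\<^sub>R Y) = sqrt (1 + t\<^sup>2 * (Y \<bullet> Y))"
      by (simp add: norm_eq_sqrt_inner)
    moreover have "1 + t\<^sup>2 * (Y \<bullet> Y) > 0" by (simp add: add_pos_nonneg)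
    ultimately show ?thesis by (simp add: \<gamma>_def M_dom_def c_def)
  qed
  moreover have "\<gamma> 0 = (y, u, v)" by (simp add: \<gamma>_def c_def)
  moreover have "(\<gamma> has_vector_derivative X) (at 0)"
  proof -
    have "(c has_real_derivative 0) (at 0)"
      unfolding c_def by (auto intro!: derivative_eq_intros)
    then have "((\<lambda>t. c t *\<^sub>R (y + t *\<^sub>R Y)) has_vector_derivative (c 0 *\<^sub>R Y + 0 *\<^sub>R (y + 0 *\<^sub>R Y))) (at 0)"
      by (intro has_vector_derivative_scaleR) (auto intro!: derivative_eq_intros)
    moreover have "((\<lambda>t. (u + t * a, v + t * b)) has_vector_derivative (a, b)) (at 0)"
      by (intro has_vector_derivative_Pair) (auto intro!: derivative_eq_intros)
    ultimately show ?thesis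
      unfolding \<gamma>_def XY using has_vector_derivative_Pair by (fastforce simp: c_def)
  qed
  ultimately show "X \<in> tangent_space M_dom (y, u, v)"
    unfolding tangent_space_def by blast
qed

lemma has_vector_derivative_along_line:
  assumes "(H has_derivative H') (at p)"
  shows "((\<lambda>t. H (p + t *\<^sub>R X)) has_vector_derivative H' X) (at (0::real))"
proof -
  have "((\<lambda>t. p + t *\<^sub>R X) has_derivative (\<lambda>h. h *\<^sub>R X)) (at 0)"
    by (auto intro!: derivative_eq_intros)
  from has_derivative_compose[OF this, of H H'] assms
  have "((\<lambda>t. H (p + t *\<^sub>R X)) has_derivative (\<lambda>h. H' (h *\<^sub>R X))) (at 0)" by simp
  then show ?thesis
    using linear_cmul[OF has_derivative_linear[OF assms]] by (simp add: has_vector_derivative_def)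
qed

abbreviation Dy :: "'a::euclidean_space \<Rightarrow> ('a coords \<Rightarrow> real) \<Rightarrow> 'a coords \<Rightarrow> real" where
  "Dy e G q \<equiv> frechet_derivative G (at q) (e, 0, 0)"

definition gradv :: "('a::euclidean_space coords \<Rightarrow> real) \<Rightarrow> 'a coords \<Rightarrow> 'a" where
  "gradv G q = (\<Sum>e\<in>Basis. Dy e G q *\<^sub>R e)"

abbreviation Du :: "('a::euclidean_space coords \<Rightarrow> real) \<Rightarrow> 'a coords \<Rightarrow> real" where
  "Du G q \<equiv> frechet_derivative G (at q) (0, 1, 0)"

abbreviation Dv :: "('a::euclidean_space coords \<Rightarrow> real) \<Rightarrow> 'a coords \<Rightarrow> real" where
  "Dv G q \<equiv> frechet_derivative G (at q) (0, 0, 1)"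

lemma frechet_split:
  assumes "(G has_derivative frechet_derivative G (at q)) (at q)"
  shows "frechet_derivative G (at q) (Y, a, b) = gradv G q \<bullet> Y + a * Du G q + b * Dv G q"
proof -
  have L: "linear (frechet_derivative G (at q))" using assms has_derivative_linear by blast
  have *: "(Y, a, b) = (\<Sum>e\<in>Basis. (Y \<bullet> e) *\<^sub>R (e, 0, 0)) + a *\<^sub>R (0, 1, 0) + b *\<^sub>R (0, 0, 1)"
    by (simp add: prod_eq_iff fst_sum snd_sum euclidean_representation)
  show ?thesis
    unfolding * linear_add[OF L] linear_cmul[OF L] linear_sum[OF L] gradv_def
    by (simp add: inner_sum_left inner_commute[of Y] mult.commute)
qed

text \<open>The flat Laplacian of the ambient space in \<open>y\<close>; the Laplacian of the sphere
  arises from it by removing the radial derivatives.\<close>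

definition lap_y :: "('a::euclidean_space coords \<Rightarrow> real) \<Rightarrow> 'a coords \<Rightarrow> real" where
  "lap_y G p = (\<Sum>e\<in>Basis. Dy e (Dy e G) p)"

lemma has_derivative_snd_comp:
  assumes "\<And>x. (F has_field_derivative F' x) (at x)"
  shows "((\<lambda>q. F (fst (snd q))) has_derivative (\<lambda>X. F' (fst (snd p)) * fst (snd X))) (at p)"
    and "((\<lambda>q. F (snd (snd q))) has_derivative (\<lambda>X. F' (snd (snd p)) * snd (snd X))) (at p)"
proof -
  have "((\<lambda>q. fst (snd q)) has_derivative (\<lambda>X. fst (snd X))) (at p)"
    "((\<lambda>q. snd (snd q)) has_derivative (\<lambda>X. snd (snd X))) (at p)"
    by (auto intro!: derivative_eq_intros)
  from this[THEN has_derivative_compose] assms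
  show "((\<lambda>q. F (fst (snd q))) has_derivative (\<lambda>X. F' (fst (snd p)) * fst (snd X))) (at p)"
    and "((\<lambda>q. F (snd (snd q))) has_derivative (\<lambda>X. F' (snd (snd p)) * snd (snd X))) (at p)"
    unfolding has_field_derivative_def by blast+
qed

lemma smooth_comp_u:
  assumes "open W" "smooth_on_open UNIV F"
  shows "smooth_on_open W (\<lambda>q::'a::real_normed_vector coords. F (fst (snd q)))"
  by (rule smooth_on_open_compose[OF assms(1) open_UNIV assms(2)
        smooth_on_open_fst[OF assms(1) smooth_on_open_snd[OF assms(1) smooth_on_open_ident[OF assms(1)]]]]) simp

lemma smooth_gradv:
  assumes "open W" "smooth_on_open W G"
  shows "smooth_on_open W (gradv G)"
  unfolding gradv_def by (intro smooth_on_open_intros smooth_on_openD(2) assms)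

section \<open>The profile curve, the induced metric and the gradient\<close>

locale profile_curve =
  fixes f1 f2 :: "real \<Rightarrow> real"
  assumes smooth_f1: "smooth_on_open UNIV f1" and smooth_f2: "smooth_on_open UNIV f2"
    and f2_pos: "f2 u > 0"
    and in_disc: "(f1 u)\<^sup>2 + (f2 u)\<^sup>2 < 1"
    and unit_speed: "(deriv f1 u)\<^sup>2 + (deriv f2 u)\<^sup>2 = 1"
begin

abbreviation f where "f \<equiv> prof_f f1 f2"

abbreviation \<phi> :: "'a::euclidean_space coords \<Rightarrow> 'a \<times> real \<times> real \<times> real"
  where "\<phi> \<equiv> immersion_\<phi> f1 f2"

abbreviation f' where "f' \<equiv> deriv f"
abbreviation f1' where "f1' \<equiv> deriv f1"
abbreviation f2' where "f2' \<equiv> deriv f2"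
abbreviation f'' where "f'' \<equiv> deriv f'"
abbreviation f1'' where "f1'' \<equiv> deriv f1'"
abbreviation f2'' where "f2'' \<equiv> deriv f2'"

text \<open>The squared length of \<open>\<partial>\<^sub>u \<phi>\<close>.\<close>

definition w2 where "w2 u = 1 + (deriv f u)\<^sup>2"

lemma f_sq: "(f u)\<^sup>2 = 1 - (f1 u)\<^sup>2 - (f2 u)\<^sup>2" and f_pos: "f u > 0"
  using in_disc[of u] by (auto simp: prof_f_def)

lemma smooth_f: "smooth_on_open UNIV f"
  unfolding prof_f_def using in_disc
  by (intro smooth_on_open_intros smooth_f1 smooth_f2) (auto simp: algebra_simps)

lemma w2_pos: "w2 u > 0"
  by (simp add: w2_def add_pos_nonneg)

lemmas smooth_deriv =
  smooth_real_deriv(2)[OF smooth_f] smooth_real_deriv(2)[OF smooth_f1] smooth_real_deriv(2)[OF smooth_f2]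

lemmas has_deriv =
  smooth_real_deriv(1)[OF smooth_f] smooth_real_deriv(1)[OF smooth_f1] smooth_real_deriv(1)[OF smooth_f2]
  smooth_real_deriv(1)[OF smooth_real_deriv(2)[OF smooth_f]]
  smooth_real_deriv(1)[OF smooth_real_deriv(2)[OF smooth_f1]]
  smooth_real_deriv(1)[OF smooth_real_deriv(2)[OF smooth_f2]]

lemma smooth_w2: "smooth_on_open UNIV w2"
  unfolding w2_def by (intro smooth_on_open_intros smooth_deriv) auto

lemma speed_orth: "f1' u * f1'' u + f2' u * f2'' u = 0"
proof -
  have "((\<lambda>u. (f1' u)\<^sup>2 + (f2' u)\<^sup>2) has_field_derivative
      (2 * f1' u * f1'' u + 2 * f2' u * f2'' u)) (at u)"
    by (auto intro!: derivative_eq_intros has_deriv)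
  moreover have "((\<lambda>u. (f1' u)\<^sup>2 + (f2' u)\<^sup>2) has_field_derivative 0) (at u)"
    by (simp add: unit_speed)
  ultimately have "2 * f1' u * f1'' u + 2 * f2' u * f2'' u = 0"
    by (rule DERIV_unique)
  then show ?thesis by simp
qed

lemma f_deriv: "f u * f' u = - (f1 u * f1' u + f2 u * f2' u)"
proof -
  have "((\<lambda>u. (f u)\<^sup>2) has_field_derivative 2 * f u * f' u) (at u)"
    by (auto intro!: derivative_eq_intros has_deriv)
  moreover have "((\<lambda>u. (f u)\<^sup>2) has_field_derivative - 2 * (f1 u * f1' u + f2 u * f2' u)) (at u)"
    unfolding f_sq by (auto intro!: derivative_eq_intros has_deriv)
  ultimately have "2 * f u * f' u = - 2 * (f1 u * f1' u + f2 u * f2' u)"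
    by (rule DERIV_unique)
  then show ?thesis by simp
qed

definition dphi :: "'a::euclidean_space coords \<Rightarrow> 'a coords \<Rightarrow> 'a \<times> real \<times> real \<times> real" where
  "dphi = (\<lambda>(y, u, v) (Y, a, b). (f u *\<^sub>R Y + (f' u * a) *\<^sub>R y, f1' u * a,
     f2' u * a * cos v - f2 u * b * sin v, f2' u * a * sin v + f2 u * b * cos v))"

lemma phi_has_derivative:
  fixes p :: "'a::euclidean_space coords"
  shows "(\<phi> has_derivative dphi p) (at p)"
proof -
  have [simp]: "sqrt (1 - (f1 u)\<^sup>2 - (f2 u)\<^sup>2) = f u" for u by (simp add: prof_f_def)
  note D = has_derivative_snd_comp(1)[OF has_deriv(1)] has_derivative_snd_comp(1)[OF has_deriv(2)]
    has_derivative_snd_comp(1)[OF has_deriv(3)] has_derivative_snd_comp(2)[OF DERIV_cos] has_derivative_snd_comp(2)[OF DERIV_sin]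
  have \<phi>: "(\<phi> :: 'a coords \<Rightarrow> _) = (\<lambda>q. (f (fst (snd q)) *\<^sub>R fst q, f1 (fst (snd q)), f2 (fst (snd q)) * cos (snd (snd q)),
          f2 (fst (snd q)) * sin (snd (snd q))))"
    by (auto simp: immersion_\<phi>_def)
  show ?thesis
    unfolding \<phi> dphi_def
    by (rule has_derivative_eq_rhs, (rule has_derivative_Pair has_derivative_scaleR has_derivative_mult D has_derivative_fst has_derivative_ident)+)
       (auto simp: fun_eq_iff algebra_simps split: prod.splits)
qed

lemma linear_dphi: "linear (dphi p)"
  using has_derivative_linear[OF phi_has_derivative] .

lemma differential_phi:
  "X \<in> tangent_space N p \<Longrightarrow> differential N \<phi> p X = dphi p X"
  by (rule differential_eqI[OF has_derivative_at_withinI[OF phi_has_derivative]])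

text \<open>This is the warped product metric f^2 g + \<open>w2\<close> du^2 + \<open>f2\<close>^2
  dv^2, where g is the metric of the sphere. There are no mixed terms because \<open>Y\<close> is
  orthogonal to \<open>y\<close> and the rotation direction is orthogonal to the profile.\<close>

lemma dphi_inner:
  assumes "norm y = 1" "Y \<bullet> y = 0" "Y' \<bullet> y = 0"
  shows "dphi (y, u, v) (Y, a, b) \<bullet> dphi (y, u, v) (Y', a', b') =
    (f u)\<^sup>2 * (Y \<bullet> Y') + w2 u * (a * a') + (f2 u)\<^sup>2 * (b * b')"
proof -
  have y: "y \<bullet> y = 1" "y \<bullet> Y = 0" "y \<bullet> Y' = 0"
    using assms by (auto simp: dot_square_norm inner_commute)
  have "(f1' u * a) * (f1' u * a')
     + (f2' u * a * cos v - f2 u * b * sin v) * (f2' u * a' * cos v - f2 u * b' * sin v)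
     + (f2' u * a * sin v + f2 u * b * cos v) * (f2' u * a' * sin v + f2 u * b' * cos v)
     = (f1' u)\<^sup>2 * (a * a') + (f2' u)\<^sup>2 * (a * a') * ((cos v)\<^sup>2 + (sin v)\<^sup>2)
       + (f2 u)\<^sup>2 * (b * b') * ((cos v)\<^sup>2 + (sin v)\<^sup>2)"
    by algebra
  also have "\<dots> = ((f1' u)\<^sup>2 + (f2' u)\<^sup>2) * (a * a') + (f2 u)\<^sup>2 * (b * b')"
    by (simp add: distrib_right)
  finally have "(f1' u * a) * (f1' u * a')
     + ((f2' u * a * cos v - f2 u * b * sin v) * (f2' u * a' * cos v - f2 u * b' * sin v)
     + (f2' u * a * sin v + f2 u * b * cos v) * (f2' u * a' * sin v + f2 u * b' * cos v))
     = a * a' + (f2 u)\<^sup>2 * (b * b')"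
    by (simp add: unit_speed)
  moreover have "(f u *\<^sub>R Y + (f' u * a) *\<^sub>R y) \<bullet> (f u *\<^sub>R Y' + (f' u * a') *\<^sub>R y)
      = (f u)\<^sup>2 * (Y \<bullet> Y') + (f' u)\<^sup>2 * (a * a')"
    using assms(2,3) y by (simp add: inner_add_left inner_add_right power2_eq_square mult_ac)
  ultimately show ?thesis
    unfolding dphi_def w2_def by (simp add: distrib_right)
qed

lemma dphi_inj:
  assumes "norm y = 1" "Y \<bullet> y = 0" "dphi (y, u, v) (Y, a, b) = 0"
  shows "Y = 0 \<and> a = 0 \<and> b = 0"
proof -
  have "(f u)\<^sup>2 * (Y \<bullet> Y) + w2 u * (a * a) + (f2 u)\<^sup>2 * (b * b) = 0"
    using dphi_inner[OF assms(1,2,2), of u v a b a b] assms(3) by simp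
  moreover have "(f u)\<^sup>2 * (Y \<bullet> Y) \<ge> 0" "w2 u * (a * a) \<ge> 0" "(f2 u)\<^sup>2 * (b * b) \<ge> 0"
    using w2_pos[of u] by auto
  ultimately have "(f u)\<^sup>2 * (Y \<bullet> Y) = 0" "w2 u * (a * a) = 0" "(f2 u)\<^sup>2 * (b * b) = 0"
    by linarith+
  then show ?thesis using f_pos[of u] w2_pos[of u] f2_pos[of u] by auto
qed

text \<open>Tangent to the sphere only at points with \<open>|y| = 1\<close>; elsewhere it is just a smooth extension.\<close>

definition gradM :: "('a::euclidean_space coords \<Rightarrow> real) \<Rightarrow> 'a coords \<Rightarrow> 'a coords" where
  "gradM G q = (let u = fst (snd q) in
     ((gradv G q - (gradv G q \<bullet> fst q) *\<^sub>R fst q) /\<^sub>R (f u)\<^sup>2, Du G q / w2 u, Dv G q / (f2 u)\<^sup>2))"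

lemma gradient_eq:
  fixes G :: "'a::euclidean_space coords \<Rightarrow> real"
  assumes W: "open W" "smooth_on_open W G" "\<And>q. q \<in> M_dom \<inter> W \<Longrightarrow> G q = \<zeta> q" and q: "q \<in> M_dom \<inter> W"
  shows "gradient M_dom \<phi> \<zeta> q = gradM G q" "gradM G q \<in> tangent_space M_dom q"
proof -
  obtain y u v where yuv: "q = (y, u, v)" by (metis prod_cases3)
  have y: "norm y = 1" using q yuv by (auto simp: M_dom_def)
  then have yy: "y \<bullet> y = 1" by (simp add: dot_square_norm)
  note T = tangent_space_M_dom[OF y, of u v, folded yuv]
  have G: "(G has_derivative frechet_derivative G (at q)) (at q)"
    using smooth_on_openD(1)[OF W(2,1)] q by auto
  have d\<zeta>: "differential M_dom \<zeta> q X = frechet_derivative G (at q) X" if "X \<in> tangent_space M_dom q" for X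
    by (rule differential_eqI[OF has_derivative_within_extension[OF G W(1) q W(3)] that])
  show tang: "gradM G q \<in> tangent_space M_dom q"
    unfolding T by (simp add: gradM_def Let_def yuv inner_diff_left yy)
  have key: "induced_metric M_dom \<phi> q (gradM G q) X = differential M_dom \<zeta> q X" if X: "X \<in> tangent_space M_dom q" for X
  proof -
    obtain Y a b where XY: "X = (Y, a, b)" by (metis prod_cases3)
    have Yy: "Y \<bullet> y = 0" using X T XY by auto
    have "induced_metric M_dom \<phi> q (gradM G q) X = dphi q (gradM G q) \<bullet> dphi q X"
      unfolding induced_metric_def using differential_phi tang X by metis
    also have "\<dots> = gradv G q \<bullet> Y + a * Du G q + b * Dv G q"
      unfolding yuv XY gradM_def Let_def
      by (subst dphi_inner[OF y _ Yy])
         (use f_pos[of u] f2_pos[of u] w2_pos[of u] Yy in \<open>auto simp: inner_diff_left yy inner_commute[of y Y]\<close>)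
    also have "\<dots> = frechet_derivative G (at q) X"
      unfolding XY by (rule frechet_split[OF G, symmetric])
    finally show ?thesis using d\<zeta>[OF X] by simp
  qed
  show "gradient M_dom \<phi> \<zeta> q = gradM G q"
    unfolding gradient_def
  proof (rule the_equality)
    show "gradM G q \<in> tangent_space M_dom q \<and> (\<forall>X\<in>tangent_space M_dom q. induced_metric M_dom \<phi> q (gradM G q) X = differential M_dom \<zeta> q X)"
      using tang key by blast
    fix H assume H: "H \<in> tangent_space M_dom q \<and> (\<forall>X\<in>tangent_space M_dom q. induced_metric M_dom \<phi> q H X = differential M_dom \<zeta> q X)"
    \<comment> \<open>Uniqueness: both candidates have the same product with their difference
      \<open>D\<close>, so \<open>dphi q D\<close> has norm 0 and injectivity of \<open>dphi\<close>
      applies.\<close>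
    define D where "D = H - gradM G q"
    have DT: "D \<in> tangent_space M_dom q" using H tang unfolding T D_def by (auto simp: inner_diff_left)
    have "differential M_dom \<phi> q H \<bullet> differential M_dom \<phi> q D = differential M_dom \<phi> q (gradM G q) \<bullet> differential M_dom \<phi> q D"
      using H key[OF DT] DT unfolding induced_metric_def by simp
    then have "dphi q H \<bullet> dphi q D = dphi q (gradM G q) \<bullet> dphi q D"
      using differential_phi H DT tang by metis
    then have "dphi q D \<bullet> dphi q D = 0"
      using linear_diff[OF linear_dphi, of q H "gradM G q"] by (simp add: D_def inner_diff_left)
    then have "dphi q D = 0" by simp
    moreover obtain Y a b where "D = (Y, a, b)" by (metis prod_cases3)
    ultimately have "D = 0" using dphi_inj[OF y, of Y u v a b] DT T yuv by (auto simp: zero_prod_def)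
    then show "H = gradM G q" by (simp add: D_def)
  qed
qed

text \<open>The ambient field d\<phi>(grad G) whose derivative is traced in
  \<open>divergence\<close>, written on the whole coordinate space so that it can be differentiated
  in the usual sense.\<close>

definition Wf :: "('a::euclidean_space coords \<Rightarrow> real) \<Rightarrow> 'a coords \<Rightarrow> 'a \<times> real \<times> real \<times> real" where
  "Wf G q = dphi q (gradM G q)"

lemma Wf_alt:
  "Wf G q = (inverse (f (fst (snd q))) *\<^sub>R (gradv G q - (gradv G q \<bullet> fst q) *\<^sub>R fst q)
               + (f' (fst (snd q)) * (Du G q / w2 (fst (snd q)))) *\<^sub>R fst q,
     f1' (fst (snd q)) * (Du G q / w2 (fst (snd q))),
     f2' (fst (snd q)) * (Du G q / w2 (fst (snd q))) * cos (snd (snd q)) - (Dv G q / f2 (fst (snd q))) * sin (snd (snd q)),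
     f2' (fst (snd q)) * (Du G q / w2 (fst (snd q))) * sin (snd (snd q)) + (Dv G q / f2 (fst (snd q))) * cos (snd (snd q)))"
  using f_pos[of "fst (snd q)"] f2_pos[of "fst (snd q)"]
  by (cases q) (auto simp: Wf_def gradM_def dphi_def power2_eq_square)

lemma smooth_Wf:
  assumes "open W" "smooth_on_open W G"
  shows "smooth_on_open W (Wf G)"
  unfolding Wf_alt
  by (intro smooth_on_open_intros smooth_comp_u[OF assms(1) smooth_f] smooth_comp_u[OF assms(1) smooth_f2]
      smooth_comp_u[OF assms(1) smooth_deriv(1)] smooth_comp_u[OF assms(1) smooth_deriv(2)]
      smooth_comp_u[OF assms(1) smooth_deriv(3)] smooth_comp_u[OF assms(1) smooth_w2]
      smooth_gradv smooth_on_openD(2)[OF assms(2)] assms)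
     (use f_pos f2_pos w2_pos in \<open>simp_all add: less_imp_neq[THEN not_sym]\<close>)

section \<open>The Laplacian in coordinates\<close>

text \<open>The function \<open>G\<close> is an arbitrary extension to a neighbourhood of \<open>S\<^sup>k \<times> \<real>\<^sup>2\<close>; the terms with derivatives
  along \<open>y\<close> correct for its radial part.\<close>

definition lap_formula :: "('a::euclidean_space coords \<Rightarrow> real) \<Rightarrow> 'a coords \<Rightarrow> real" where
  "lap_formula G p = (let u = fst (snd p); y = fst p in
     (lap_y G p - Dy y (Dy y G) p
        - (real DIM('a) - 1) * Dy y G p) / (f u)\<^sup>2
     + 1 / w2 u * (Du (Du G) p + ((real DIM('a) - 1) * (f' u / f u) + f2' u / f2 u
         - f' u * f'' u / w2 u) * Du G p)
     + Dv (Dv G) p / (f2 u)\<^sup>2)"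

text \<open>Adding \<open>y\<close> to \<open>E\<close> gives an orthonormal basis of the whole
  space, and the trace of the bilinear form of second y-derivatives does not depend on the basis. In
  \<open>Dy y (Dy y G)\<close> the direction \<open>y\<close> is held fixed under both
  differentiations.\<close>

lemma frame_sum_y:
  fixes G :: "'a::euclidean_space coords \<Rightarrow> real"
  assumes W: "open W" "smooth_on_open W G" "p \<in> W"
    and E: "\<forall>X\<in>E. \<forall>Y\<in>E. X \<bullet> Y = (if X = Y then 1 else 0)" "span E = {Y. Y \<bullet> y = 0}"
    and y: "norm (y::'a) = 1"
  shows "(\<Sum>e\<in>E. Dy e (Dy e G) p)
     = lap_y G p - Dy y (Dy y G) p"
    and "card E + 1 = DIM('a)"
proof -
  define \<beta> where "\<beta> X Y = Dy Y (Dy X G) p" for X Y :: 'a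
  have D: "((\<lambda>q. frechet_derivative G (at q) X) has_derivative frechet_derivative (\<lambda>q. frechet_derivative G (at q) X) (at p)) (at p)" for X
    using smooth_on_openD(1)[OF smooth_on_openD(2)[OF W(2,1)] W(1,3)] .
  have L: "linear (frechet_derivative G (at q))" if "q \<in> W" for q
    using has_derivative_linear[OF smooth_on_openD(1)[OF W(2,1) that]] .
  have lin: "linear (\<lambda>X. (X, 0::real, 0::real) :: 'a coords)"
    by (rule linearI) auto
  have \<beta>: "bilinear \<beta>"
    unfolding bilinear_def
  proof (intro conjI allI)
    show "linear (\<beta> X)" for X
      unfolding \<beta>_def using linear_compose[OF lin has_derivative_linear[OF D[of "(X,0,0)"]]] by (simp add: o_def)
    show "linear (\<lambda>X. \<beta> X Y)" for Y
    proof (rule linearI)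
      fix X X' :: 'a and c :: real
      have "((\<lambda>q. frechet_derivative G (at q) (X + X', 0, 0)) has_derivative
            (\<lambda>Z. frechet_derivative (Dy X G) (at p) Z
               + frechet_derivative (\<lambda>q. frechet_derivative G (at q) (X', 0, 0)) (at p) Z)) (at p)"
        by (rule has_derivative_transform_within_open[OF has_derivative_add[OF D[of "(X,0,0)"] D[of "(X',0,0)"]] W(1,3)])
           (use linear_add[OF L, of _ "(X,0,0)" "(X',0,0)"] in auto)
      from fun_cong[OF frechet_derivative_at[OF this], of "(Y, 0, 0)"] show "\<beta> (X + X') Y = \<beta> X Y + \<beta> X' Y"
        unfolding \<beta>_def by (rule sym)
      have "((\<lambda>q. frechet_derivative G (at q) (c *\<^sub>R X, 0, 0)) has_derivative
            (\<lambda>Z. c *\<^sub>R frechet_derivative (Dy X G) (at p) Z)) (at p)"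
        by (rule has_derivative_transform_within_open[OF has_derivative_scaleR_right[OF D[of "(X,0,0)"]] W(1,3)])
           (use linear_cmul[OF L, of _ c "(X,0,0)"] in auto)
      from fun_cong[OF frechet_derivative_at[OF this], of "(Y, 0, 0)"] show "\<beta> (c *\<^sub>R X) Y = c *\<^sub>R \<beta> X Y"
        unfolding \<beta>_def by (rule sym)
    qed
  qed
  have finE: "finite E" using orthonormal_finite[of E "\<lambda>x. x"] E(1) by auto
  have EY: "e \<bullet> y = 0" if "e \<in> E" for e using E(2) span_superset[of E] that by blast
  have yE: "y \<notin> E" using EY y by fastforce
  have ON: "\<forall>X\<in>insert y E. \<forall>Y\<in>insert y E. X \<bullet> Y = (if X = Y then 1 else 0)"
    using E(1) EY y yE by (auto simp: dot_square_norm inner_commute)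
  have sp: "span (insert y E) = UNIV"
  proof -
    have "z \<in> span (insert y E)" for z
    proof -
      have "z - (z \<bullet> y) *\<^sub>R y \<in> span E"
        unfolding E(2) using y by (simp add: inner_diff_left dot_square_norm)
      then show ?thesis using span_breakdown_eq by blast
    qed
    then show ?thesis by auto
  qed
  have "(\<Sum>X\<in>Basis. \<beta> X X) = (\<Sum>X\<in>insert y E. \<beta> X X)"
    by (rule orthonormal_trace_unique[OF linear_id \<beta>]) (use ON sp in \<open>auto simp: inner_Basis\<close>)
  then show "(\<Sum>e\<in>E. Dy e (Dy e G) p)
     = lap_y G p - Dy y (Dy y G) p"
    using finE yE by (simp add: lap_y_def \<beta>_def)
  have nz: "0 \<notin> insert y E" using ON by force
  have "pairwise orthogonal (insert y E)"
    unfolding pairwise_def orthogonal_def using ON by simp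
  then have "independent (insert y E)"
    using nz by (rule pairwise_orthogonal_independent)
  then have "card (insert y E) = DIM('a)"
    using dim_eq_card[of "insert y E" UNIV] sp by (simp add: basis_card_eq_dim)
  then show "card E + 1 = DIM('a)" using finE yE by simp
qed

text \<open>In the coordinate directions \<open>u\<close> and \<open>v\<close>, the inner product of \<open>Wf G\<close> with the coordinate field is
  the partial derivative of \<open>G\<close>, so the product rule leaves only the second derivatives of \<open>\<phi>\<close> to compute.\<close>

lemma Wf_in_y_direction:
  fixes G :: "'a::euclidean_space coords \<Rightarrow> real"
  assumes W: "open W" "smooth_on_open W G" "(y, u, v) \<in> W"
    and e: "e \<bullet> y = 0" "e \<bullet> e = 1"
  shows "frechet_derivative (Wf G) (at (y, u, v)) (e, 0, 0) \<bullet> dphi (y, u, v) (e, 0, 0)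
     = Dy e (Dy e G) (y, u, v)
       - Dy y G (y, u, v) + f u * f' u * (Du G (y, u, v) / w2 u)"
proof -
  let ?p = "(y, u, v)" and ?l = "\<lambda>t::real. (y, u, v) + t *\<^sub>R (e, 0, 0)"
  have D: "(G has_derivative frechet_derivative G (at q)) (at q)" if "q \<in> W" for q
    using smooth_on_openD(1)[OF W(2,1) that] .
  have DX: "((\<lambda>q. frechet_derivative G (at q) X) has_derivative frechet_derivative (\<lambda>q. frechet_derivative G (at q) X) (at ?p)) (at ?p)" for X
    using smooth_on_openD(1)[OF smooth_on_openD(2)[OF W(2,1)] W(1,3)] .
  have line: "\<forall>\<^sub>F t in at (0::real). ?l t \<in> W"
  proof -
    have "continuous (at 0) ?l" by (intro continuous_intros)
    then have "(?l \<longlongrightarrow> ?l 0) (at 0)" by (simp add: continuous_at)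
    then show ?thesis
      by (rule topological_tendstoD) (use W in auto)
  qed
  have "((\<lambda>t. Wf G (?l t)) has_vector_derivative frechet_derivative (Wf G) (at ?p) (e, 0, 0)) (at 0)"
    by (rule has_vector_derivative_along_line, rule smooth_on_openD(1)[OF smooth_Wf[OF W(1,2)] W(1,3)])
  from bounded_linear.has_vector_derivative[OF bounded_linear_inner_left this, of "dphi ?p (e, 0, 0)"]
  have 1: "((\<lambda>t. Wf G (?l t) \<bullet> dphi ?p (e, 0, 0)) has_vector_derivative
      frechet_derivative (Wf G) (at ?p) (e, 0, 0) \<bullet> dphi ?p (e, 0, 0)) (at 0)" .
  define g where "g t = gradv G (?l t)" for t
  define g' where "g' = frechet_derivative (gradv G) (at ?p) (e, 0, 0)"
  have g': "(g has_vector_derivative g') (at 0)"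
    unfolding g_def g'_def
    by (rule has_vector_derivative_along_line[OF smooth_on_openD(1)[OF smooth_gradv[OF W(1,2)] W(1,3)]])
  define h' where "h' = frechet_derivative (Du G) (at ?p) (e, 0, 0)"
  have h': "((\<lambda>t. Du G (?l t)) has_vector_derivative h') (at 0)"
    unfolding h'_def by (rule has_vector_derivative_along_line[OF DX])
  have ge: "((\<lambda>t. g t \<bullet> e) has_vector_derivative Dy e (Dy e G) ?p) (at 0)"
  proof -
    have "((\<lambda>t. Dy e G (?l t)) has_vector_derivative Dy e (Dy e G) ?p) (at 0)"
      by (rule has_vector_derivative_along_line[OF DX])
    moreover have "\<forall>\<^sub>F t in nhds 0. Dy e G (?l t) = g t \<bullet> e"
      unfolding eventually_nhds_conv_at
    proof
      show "\<forall>\<^sub>F t in at 0. Dy e G (?l t) = g t \<bullet> e"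
        using line
      proof eventually_elim
        case (elim t)
        from frechet_split[OF D[OF elim], of e 0 0] show ?case by (simp add: g_def)
      qed
      show "Dy e G (?l 0) = g 0 \<bullet> e"
        using frechet_split[OF D[OF W(3)], of e 0 0] by (simp add: g_def)
    qed
    ultimately show ?thesis
      using has_vector_derivative_cong_ev[where g="\<lambda>t. g t \<bullet> e" and f="\<lambda>t. Dy e G (?l t)" and S=UNIV and x=0]
        frechet_split[OF D[OF W(3)], of e 0 0] by (simp add: g_def)
  qed
  have gy: "Dy y G ?p = g 0 \<bullet> y"
    using frechet_split[OF D[OF W(3)], of y 0 0] by (simp add: g_def)
  define K where "K = f u * f' u / w2 u"
  \<comment> \<open>The base point moves along a line that leaves the sphere, while the second
    factor stays at \<open>?p\<close>. In the two terms with a factor \<open>t\<close> only the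
    value of the other factor at t = 0 contributes to the derivative; they become the
    \<open>Dy y G\<close> and \<open>Du G\<close> terms.\<close>
  have 2: "Wf G (?l t) \<bullet> dphi ?p (e, 0, 0) = g t \<bullet> e - (g t \<bullet> (y + t *\<^sub>R e)) * t + K * Du G (?l t) * t" for t
    using f_pos[of u] e unfolding Wf_alt g_def dphi_def K_def
    by (simp add: inner_add_left inner_diff_left inner_add_right inner_commute[of y e] field_simps)
  have l: "((\<lambda>t. y + t *\<^sub>R e) has_vector_derivative e) (at 0)" by (auto intro!: derivative_eq_intros)
  have id: "((\<lambda>t. t) has_vector_derivative 1) (at (0::real))" by (auto intro!: derivative_eq_intros)
  have h: "((\<lambda>t. K * Du G (?l t)) has_vector_derivative K * h') (at 0)"
    by (rule bounded_linear.has_vector_derivative[OF bounded_linear_mult_right h'])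
  note A = bounded_bilinear.has_vector_derivative[OF bounded_bilinear_mult
      bounded_bilinear.has_vector_derivative[OF bounded_bilinear_inner g' l] id]
  note B = bounded_bilinear.has_vector_derivative[OF bounded_bilinear_mult h id]
  note this = has_vector_derivative_add[OF has_vector_derivative_diff[OF ge A] B]
  from vector_derivative_unique_at[OF 1[unfolded 2] this]
  show ?thesis
    by (simp add: gy K_def)
qed

lemma Wf_in_u_direction:
  fixes G :: "'a::euclidean_space coords \<Rightarrow> real"
  assumes W: "open W" "smooth_on_open W G" "(y, u, v) \<in> W" and y: "norm y = 1"
  shows "frechet_derivative (Wf G) (at (y, u, v)) (0, 1, 0) \<bullet> dphi (y, u, v) (0, 1, 0)
     = Du (Du G) (y, u, v) - f' u * f'' u / w2 u * Du G (y, u, v)"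
proof -
  let ?p = "(y, u, v)" and ?l = "\<lambda>t::real. (y, u, v) + t *\<^sub>R (0, 1, 0)"
  have yy: "y \<bullet> y = 1" using y by (simp add: dot_square_norm)
  have W': "((\<lambda>t. Wf G (?l t)) has_vector_derivative frechet_derivative (Wf G) (at ?p) (0, 1, 0)) (at 0)"
    by (rule has_vector_derivative_along_line, rule smooth_on_openD(1)[OF smooth_Wf[OF W(1,2)] W(1,3)])
  have sh: "((\<lambda>t. F (u + t)) has_vector_derivative F') (at 0)" if "(F has_field_derivative F') (at u)" for F :: "real \<Rightarrow> real" and F'
    using that DERIV_shift[of F F' 0 u]
    by (simp add: add.commute[of u] has_real_derivative_iff_has_vector_derivative)
  have dphi_l: "dphi (?l t) (0, 1, 0) = (f' (u + t) *\<^sub>R y, f1' (u + t), f2' (u + t) * cos v, f2' (u + t) * sin v)" for t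
    by (simp add: dphi_def)
  have P': "((\<lambda>t. dphi (?l t) (0, 1, 0)) has_vector_derivative
      (f'' u *\<^sub>R y, f1'' u, f2'' u * cos v, f2'' u * sin v)) (at 0)"
    unfolding dphi_l
    by (intro has_vector_derivative_Pair bounded_linear.has_vector_derivative[OF bounded_linear_scaleR_left sh[OF has_deriv(4)]]
        sh[OF has_deriv(5)] bounded_linear.has_vector_derivative[OF bounded_linear_mult_left sh[OF has_deriv(6)]])
  have 2: "Wf G (?l t) \<bullet> dphi (?l t) (0, 1, 0) = Du G (?l t)" for t
  proof -
    have "Wf G (?l t) \<bullet> dphi (?l t) (0, 1, 0) = w2 (u + t) * (Du G (?l t) / w2 (u + t))"
      using dphi_inner[OF y, of "(gradv G (?l t) - (gradv G (?l t) \<bullet> y) *\<^sub>R y) /\<^sub>R (f (u + t))\<^sup>2" 0 "u + t" v _ _ 1 0]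
      by (simp add: Wf_def gradM_def Let_def inner_diff_left yy)
    then show ?thesis using w2_pos[of "u + t"] by simp
  qed
  \<comment> \<open>The unit vector (f1', f2') is orthogonal to its derivative, so only the
    component along \<open>y\<close> of the second derivative of \<phi> contributes, which gives f'
    f''.\<close>
  have 3: "Wf G ?p \<bullet> (f'' u *\<^sub>R y, f1'' u, f2'' u * cos v, f2'' u * sin v)
     = f' u * f'' u / w2 u * Du G ?p"
  proof -
    define a where "a = Du G ?p / w2 u"
    have "f1' u * a * f1'' u +
          ((f2' u * a * cos v - Dv G ?p / f2 u * sin v) * (f2'' u * cos v)
       + (f2' u * a * sin v + Dv G ?p / f2 u * cos v) * (f2'' u * sin v))
       = a * (f1' u * f1'' u + f2' u * f2'' u * ((cos v)\<^sup>2 + (sin v)\<^sup>2))"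
      by algebra
    also have "\<dots> = 0" by (simp add: speed_orth)
    finally show ?thesis
      unfolding Wf_alt by (simp add: a_def inner_add_left inner_diff_left yy mult_ac)
  qed
  have "((\<lambda>t. Du G (?l t)) has_vector_derivative Du (Du G) ?p) (at 0)"
    by (rule has_vector_derivative_along_line, rule smooth_on_openD(1)[OF smooth_on_openD(2)[OF W(2,1)] W(1,3)])
  moreover have "((\<lambda>t. Du G (?l t)) has_vector_derivative
     (Wf G (?l 0) \<bullet> (f'' u *\<^sub>R y, f1'' u, f2'' u * cos v, f2'' u * sin v)
      + frechet_derivative (Wf G) (at ?p) (0, 1, 0) \<bullet> dphi (?l 0) (0, 1, 0))) (at 0)"
    using bounded_bilinear.has_vector_derivative[OF bounded_bilinear_inner W' P'] unfolding 2 .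
  ultimately have "Du (Du G) ?p = Wf G (?l 0) \<bullet> (f'' u *\<^sub>R y, f1'' u, f2'' u * cos v, f2'' u * sin v)
      + frechet_derivative (Wf G) (at ?p) (0, 1, 0) \<bullet> dphi (?l 0) (0, 1, 0)"
    by (rule vector_derivative_unique_at)
  then show ?thesis using 3 by simp
qed

lemma Wf_in_v_direction:
  fixes G :: "'a::euclidean_space coords \<Rightarrow> real"
  assumes W: "open W" "smooth_on_open W G" "(y, u, v) \<in> W" and y: "norm y = 1"
  shows "frechet_derivative (Wf G) (at (y, u, v)) (0, 0, 1) \<bullet> dphi (y, u, v) (0, 0, 1)
     = Dv (Dv G) (y, u, v) + f2 u * f2' u / w2 u * Du G (y, u, v)"
proof -
  let ?p = "(y, u, v)" and ?l = "\<lambda>t::real. (y, u, v) + t *\<^sub>R (0, 0, 1)"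
  have yy: "y \<bullet> y = 1" using y by (simp add: dot_square_norm)
  have W': "((\<lambda>t. Wf G (?l t)) has_vector_derivative frechet_derivative (Wf G) (at ?p) (0, 0, 1)) (at 0)"
    by (rule has_vector_derivative_along_line, rule smooth_on_openD(1)[OF smooth_Wf[OF W(1,2)] W(1,3)])
  have dphi_l: "dphi (?l t) (0, 0, 1) = (0, 0, - (f2 u * sin (v + t)), f2 u * cos (v + t))" for t
    by (simp add: dphi_def)
  have P': "((\<lambda>t. dphi (?l t) (0, 0, 1)) has_vector_derivative (0, 0, - (f2 u * cos v), - (f2 u * sin v))) (at 0)"
  proof -
    have "((\<lambda>t. - (f2 u * sin (v + t))) has_real_derivative - (f2 u * cos v)) (at 0)"
      "((\<lambda>t. f2 u * cos (v + t)) has_real_derivative - (f2 u * sin v)) (at 0)"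
      by (auto intro!: derivative_eq_intros)
    then show ?thesis
      unfolding dphi_l by (intro has_vector_derivative_Pair has_vector_derivative_const)
        (simp_all add: has_real_derivative_iff_has_vector_derivative)
  qed
  have 2: "Wf G (?l t) \<bullet> dphi (?l t) (0, 0, 1) = Dv G (?l t)" for t
  proof -
    have "Wf G (?l t) \<bullet> dphi (?l t) (0, 0, 1) = (f2 u)\<^sup>2 * (Dv G (?l t) / (f2 u)\<^sup>2)"
      using dphi_inner[OF y, of "(gradv G (?l t) - (gradv G (?l t) \<bullet> y) *\<^sub>R y) /\<^sub>R (f u)\<^sup>2" 0 u "v + t" _ _ 0 1]
      by (simp add: Wf_def gradM_def inner_diff_left yy)
    then show ?thesis using f2_pos[of u] by simp
  qed
  have 3: "Wf G ?p \<bullet> (0, 0, - (f2 u * cos v), - (f2 u * sin v)) = - (f2 u * f2' u / w2 u * Du G ?p)"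
  proof -
    define a b where "a = Du G ?p / w2 u" and "b = Dv G ?p / f2 u"
    have "(f2' u * a * cos v - b * sin v) * (- (f2 u * cos v))
       + (f2' u * a * sin v + b * cos v) * (- (f2 u * sin v))
       = - (f2 u * f2' u * a * ((cos v)\<^sup>2 + (sin v)\<^sup>2))"
      by algebra
    then show ?thesis
      unfolding Wf_alt by (simp add: a_def b_def)
  qed
  have "((\<lambda>t. Dv G (?l t)) has_vector_derivative Dv (Dv G) ?p) (at 0)"
    by (rule has_vector_derivative_along_line, rule smooth_on_openD(1)[OF smooth_on_openD(2)[OF W(2,1)] W(1,3)])
  moreover have "((\<lambda>t. Dv G (?l t)) has_vector_derivative
     (Wf G (?l 0) \<bullet> (0, 0, - (f2 u * cos v), - (f2 u * sin v))
      + frechet_derivative (Wf G) (at ?p) (0, 0, 1) \<bullet> dphi (?l 0) (0, 0, 1))) (at 0)"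
    using bounded_bilinear.has_vector_derivative[OF bounded_bilinear_inner W' P'] unfolding 2 .
  ultimately have "Dv (Dv G) ?p = Wf G (?l 0) \<bullet> (0, 0, - (f2 u * cos v), - (f2 u * sin v))
      + frechet_derivative (Wf G) (at ?p) (0, 0, 1) \<bullet> dphi (?l 0) (0, 0, 1)"
    by (rule vector_derivative_unique_at)
  then show ?thesis using 3 by simp
qed

text \<open>The trace is evaluated in the frame \<open>B0\<close>: an orthonormal basis of the
  tangent space of the sphere divided by \<open>f u\<close>, and the two normalized coordinate
  fields. The terms with f'/f and f2'/f2 come from the y- and v-directions, the one with f' f'' from
  the u-direction.\<close>

lemma laplacian_eq:
  fixes G \<zeta> :: "'a::euclidean_space coords \<Rightarrow> real"
  assumes W: "open W" "smooth_on_open W G" "\<And>q. q \<in> M_dom \<inter> W \<Longrightarrow> G q = \<zeta> q" and p: "p \<in> M_dom \<inter> W"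
  shows "laplacian M_dom \<phi> \<zeta> p = lap_formula G p"
proof -
  obtain y u v where yuv: "p = (y, u, v)" by (metis prod_cases3)
  have y: "norm y = 1" using p yuv by (auto simp: M_dom_def)
  then have yy: "y \<bullet> y = 1" by (simp add: dot_square_norm)
  have pW: "(y, u, v) \<in> W" using p yuv by auto
  note T = tangent_space_M_dom[OF y, of u v, folded yuv]
  define \<beta> where "\<beta> X Y = frechet_derivative (Wf G) (at p) X \<bullet> dphi p Y" for X Y
  have DW: "(Wf G has_derivative frechet_derivative (Wf G) (at p)) (at p)"
    using smooth_on_openD(1)[OF smooth_Wf[OF W(1,2)] W(1)] p by auto
  have \<beta>: "bilinear \<beta>"
    unfolding bilinear_def \<beta>_def
    using linear_dphi[of p] has_derivative_linear[OF DW]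
    by (intro conjI allI linearI) (simp_all add: linear_add linear_cmul inner_add_left inner_add_right)
  have dW: "differential M_dom (\<lambda>q. differential M_dom \<phi> q (gradient M_dom \<phi> \<zeta> q)) p X = frechet_derivative (Wf G) (at p) X"
    if "X \<in> tangent_space M_dom p" for X
  proof (rule differential_eqI[OF has_derivative_within_extension[OF DW W(1) p] that])
    fix q assume q: "q \<in> M_dom \<inter> W"
    show "Wf G q = differential M_dom \<phi> q (gradient M_dom \<phi> \<zeta> q)"
      using gradient_eq[OF W q] by (simp add: Wf_def differential_phi)
  qed
  have frame_eq: "orthonormal_frame M_dom \<phi> p B \<longleftrightarrow>
      B \<subseteq> tangent_space M_dom p \<and> span B = tangent_space M_dom p \<and>
      (\<forall>X\<in>B. \<forall>Y\<in>B. dphi p X \<bullet> dphi p Y = (if X = Y then 1 else 0))" for B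
  proof (cases "B \<subseteq> tangent_space M_dom p")
    case True
    then have "\<forall>X\<in>B. differential M_dom \<phi> p X = dphi p X"
      by (intro ballI differential_phi) (rule subsetD)
    then show ?thesis
      unfolding orthonormal_frame_def induced_metric_def
      by (intro conj_cong refl ball_cong) simp
  qed (simp add: orthonormal_frame_def)

  have sub: "subspace {Y. Y \<bullet> y = 0}"
    by (auto simp: subspace_def inner_add_left)
  obtain E where E: "E \<subseteq> {Y. Y \<bullet> y = 0}" "pairwise orthogonal E" "\<And>x. x \<in> E \<Longrightarrow> norm x = 1" "span E = {Y. Y \<bullet> y = 0}"
    using orthonormal_basis_subspace[OF sub] by metis
  have EON: "\<forall>X\<in>E. \<forall>Y\<in>E. X \<bullet> Y = (if X = Y then 1 else 0)"
    using E(2,3) by (auto simp: pairwise_def orthogonal_def dot_square_norm)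
  have finE: "finite E" using orthonormal_finite[of E "\<lambda>x. x"] EON by auto
  note frame_sum = frame_sum_y[OF W(1,2) _ EON E(4) y, of p]
  define i where "i e = (inverse (f u) *\<^sub>R e, 0::real, 0::real)" for e :: 'a
  define Xu Xv where "Xu = (0::'a, inverse (sqrt (w2 u)), 0::real)" and "Xv = (0::'a, 0::real, inverse (f2 u))"
  define B0 where "B0 = insert Xu (insert Xv (i ` E))"
  have lin_i: "linear i" by (rule linearI) (auto simp: i_def scaleR_add_right)
  have span_i: "span (i ` E) = i ` {Y. Y \<bullet> y = 0}"
    using span_linear_image[OF lin_i, of E] E(4) by simp
  have nz: "f u \<noteq> 0" "w2 u \<noteq> 0" "f2 u \<noteq> 0" "w2 u > 0" using f_pos[of u] w2_pos[of u] f2_pos[of u] by auto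
  have sq: "sqrt (w2 u) * sqrt (w2 u) = w2 u" using nz by simp
  have Ey: "e \<bullet> y = 0" if "e \<in> E" for e using E(1) that by blast
  have ip: "dphi p (i e) \<bullet> dphi p (i e') = e \<bullet> e'" "dphi p (i e) \<bullet> dphi p Xu = 0" "dphi p (i e) \<bullet> dphi p Xv = 0"
      "dphi p Xu \<bullet> dphi p (i e) = 0" "dphi p Xv \<bullet> dphi p (i e) = 0"
    if "e \<in> E" "e' \<in> E" for e e'
    using Ey[OF that(1)] Ey[OF that(2)] nz unfolding yuv i_def Xu_def Xv_def
    by (simp_all add: dphi_inner[OF y] power2_eq_square field_simps)
  have ip2: "dphi p Xu \<bullet> dphi p Xv = 0" "dphi p Xv \<bullet> dphi p Xu = 0" "dphi p Xu \<bullet> dphi p Xu = 1" "dphi p Xv \<bullet> dphi p Xv = 1"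
    using nz sq unfolding yuv Xu_def Xv_def
    by (simp_all add: dphi_inner[OF y] power2_eq_square flip: inverse_mult_distrib)
  have inj: "inj_on i E"
    using nz by (auto simp: inj_on_def i_def)
  have Xuv: "Xu \<noteq> Xv" "Xu \<notin> i ` E" "Xv \<notin> i ` E"
    using nz by (auto simp: Xu_def Xv_def i_def)
  have "orthonormal_frame M_dom \<phi> p B0"
    unfolding frame_eq
  proof (intro conjI)
    show B0T: "B0 \<subseteq> tangent_space M_dom p"
      unfolding T B0_def using Ey by (auto simp: i_def Xu_def Xv_def)
    show "span B0 = tangent_space M_dom p"
    proof
      have "subspace {X :: 'a coords. fst X \<bullet> y = 0}"
        by (auto simp: subspace_def inner_add_left)
      then show "span B0 \<subseteq> tangent_space M_dom p"
        using span_minimal[OF B0T] unfolding T by blast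
      show "tangent_space M_dom p \<subseteq> span B0"
      proof
        fix X assume X: "X \<in> tangent_space M_dom p"
        obtain Y a b where XY: "X = (Y, a, b)" by (metis prod_cases3)
        have "f u *\<^sub>R Y \<in> {Y. Y \<bullet> y = 0}" using X T XY by auto
        then have "i (f u *\<^sub>R Y) \<in> span (i ` E)" unfolding span_i by blast
        then have "i (f u *\<^sub>R Y) \<in> span B0" using span_mono[of "i ` E" B0] by (auto simp: B0_def)
        moreover have "(sqrt (w2 u) * a) *\<^sub>R Xu \<in> span B0" "(f2 u * b) *\<^sub>R Xv \<in> span B0"
          by (rule span_scale, rule span_base, simp add: B0_def)+
        ultimately have "i (f u *\<^sub>R Y) + (sqrt (w2 u) * a) *\<^sub>R Xu + (f2 u * b) *\<^sub>R Xv \<in> span B0"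
          by (intro span_add)
        moreover have "i (f u *\<^sub>R Y) + (sqrt (w2 u) * a) *\<^sub>R Xu + (f2 u * b) *\<^sub>R Xv = X"
          using nz by (simp add: XY i_def Xu_def Xv_def field_simps)
        ultimately show "X \<in> span B0" by simp
      qed
    qed
    show "\<forall>X\<in>B0. \<forall>Y\<in>B0. dphi p X \<bullet> dphi p Y = (if X = Y then 1 else 0)"
      using ip ip2 Xuv EON inj unfolding B0_def by (auto simp: inj_on_def)
  qed
  note B0 = this[unfolded frame_eq]
  define B1 where "B1 = (SOME B. orthonormal_frame M_dom \<phi> p B)"
  have "orthonormal_frame M_dom \<phi> p B1"
    unfolding B1_def using \<open>orthonormal_frame M_dom \<phi> p B0\<close> by (rule someI)
  note B1 = this[unfolded frame_eq]
  have "laplacian M_dom \<phi> \<zeta> p = (\<Sum>X\<in>B1. \<beta> X X)"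
    unfolding laplacian_def divergence_def B1_def[symmetric]
  proof (rule sum.cong[OF refl])
    fix X assume "X \<in> B1"
    then have X: "X \<in> tangent_space M_dom p" by (rule subsetD[OF B1[THEN conjunct1]])
    show "differential M_dom (\<lambda>q. differential M_dom \<phi> q (gradient M_dom \<phi> \<zeta> q)) p X \<bullet> differential M_dom \<phi> p X = \<beta> X X"
      unfolding \<beta>_def dW[OF X] differential_phi[OF X] ..
  qed
  also have "(\<Sum>X\<in>B1. \<beta> X X) = (\<Sum>X\<in>B0. \<beta> X X)"
    by (rule orthonormal_trace_unique[OF linear_dphi[of p] \<beta> B1[THEN conjunct2, THEN conjunct2]
          B0[THEN conjunct2, THEN conjunct2]
          trans[OF B1[THEN conjunct2, THEN conjunct1] B0[THEN conjunct2, THEN conjunct1, symmetric]]])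
  also have "(\<Sum>X\<in>B0. \<beta> X X) = \<beta> Xu Xu + \<beta> Xv Xv + (\<Sum>e\<in>E. \<beta> (i e) (i e))"
    using Xuv finE inj by (simp add: B0_def sum.reindex)
  also have "(\<Sum>e\<in>E. \<beta> (i e) (i e)) = (\<Sum>e\<in>E. (Dy e (Dy e G) p
       - Dy y G p + f u * f' u * (Du G p / w2 u)) / (f u)\<^sup>2)"
  proof (rule sum.cong[OF refl])
    fix e assume e: "e \<in> E"
    have "i e = inverse (f u) *\<^sub>R (e, 0, 0)" by (simp add: i_def)
    then have "\<beta> (i e) (i e) = \<beta> (e, 0, 0) (e, 0, 0) / (f u)\<^sup>2"
      by (simp only: bilinear_lmul[OF \<beta>] bilinear_rmul[OF \<beta>]) (simp add: power2_eq_square field_simps)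
    then show "\<beta> (i e) (i e) = (Dy e (Dy e G) p
       - Dy y G p + f u * f' u * (Du G p / w2 u)) / (f u)\<^sup>2"
      using Wf_in_y_direction[OF W(1,2) pW Ey[OF e]] EON e by (simp add: \<beta>_def yuv)
  qed
  also have "\<dots> = ((\<Sum>e\<in>E. Dy e (Dy e G) p)
       + real (card E) * (f u * f' u * (Du G p / w2 u) - Dy y G p)) / (f u)\<^sup>2"
    by (simp add: sum_divide_distrib[symmetric] sum.distrib sum_subtractf right_diff_distrib)
  also have "\<beta> Xu Xu = (Du (Du G) p - f' u * f'' u / w2 u * Du G p) / w2 u"
  proof -
    have "Xu = inverse (sqrt (w2 u)) *\<^sub>R (0, 1, 0)" by (simp add: Xu_def)
    then have "\<beta> Xu Xu = \<beta> (0, 1, 0) (0, 1, 0) / (sqrt (w2 u) * sqrt (w2 u))"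
      by (simp only: bilinear_lmul[OF \<beta>] bilinear_rmul[OF \<beta>]) (simp add: field_simps)
    then show ?thesis
      using Wf_in_u_direction[OF W(1,2) pW y] by (simp only: sq) (simp add: \<beta>_def yuv)
  qed
  also have "\<beta> Xv Xv = (Dv (Dv G) p + f2 u * f2' u / w2 u * Du G p) / (f2 u)\<^sup>2"
  proof -
    have "Xv = inverse (f2 u) *\<^sub>R (0, 0, 1)" by (simp add: Xv_def)
    then have "\<beta> Xv Xv = \<beta> (0, 0, 1) (0, 0, 1) / (f2 u)\<^sup>2"
      by (simp only: bilinear_lmul[OF \<beta>] bilinear_rmul[OF \<beta>]) (simp add: power2_eq_square field_simps)
    then show ?thesis
      using Wf_in_v_direction[OF W(1,2) pW y] by (simp add: \<beta>_def yuv)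
  qed
  also have "(\<Sum>e\<in>E. Dy e (Dy e G) p) =
      lap_y G p - Dy y (Dy y G) p"
    by (rule frame_sum(1)) (use p in simp)
  also have "real (card E) = real DIM('a) - 1"
  proof -
    have "card E + 1 = DIM('a)" by (rule frame_sum(2)) (use p in simp)
    then show ?thesis by linarith
  qed
  finally have *: "laplacian M_dom \<phi> \<zeta> p = (Du (Du G) p - f' u * f'' u / w2 u * Du G p) / w2 u
     + (Dv (Dv G) p + f2 u * f2' u / w2 u * Du G p) / (f2 u)\<^sup>2
     + (lap_y G p - Dy y (Dy y G) p
        + (real DIM('a) - 1) * (f u * f' u * (Du G p / w2 u) - Dy y G p)) / (f u)\<^sup>2" .
  have 1: "(A + r * (f u * f' u * (d / w2 u) - c)) / (f u)\<^sup>2 = (A - r * c) / (f u)\<^sup>2 + r * (f' u / f u) * (d / w2 u)" for A r d c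
    using nz by (simp add: power2_eq_square field_simps)
  have 2: "(A + f2 u * f2' u / w2 u * d) / (f2 u)\<^sup>2 = A / (f2 u)\<^sup>2 + f2' u / f2 u * (d / w2 u)" for A d
    using nz by (simp add: power2_eq_square field_simps)
  have 3: "(A - B / w2 u * d) / w2 u = A / w2 u - B / w2 u * (d / w2 u)" for A B d
    by (simp add: diff_divide_distrib)
  show ?thesis
    unfolding * 1 2 3 unfolding lap_formula_def Let_def yuv fst_conv snd_conv
    by (simp add: add_divide_distrib diff_divide_distrib distrib_right left_diff_distrib)
qed

end

section \<open>The principal curvatures\<close>

text \<open>Here w is the cross product of a and b. Scalar components keep the identities within
  reach of \<open>algebra\<close>.\<close>

lemma orthogonal_to_both_imp_parallel_cross:
  fixes a0 a1 a2 b0 b1 b2 x0 x1 x2 :: real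
  assumes "x0 * a0 + x1 * a1 + x2 * a2 = 0" "x0 * b0 + x1 * b1 + x2 * b2 = 0"
  defines "w0 \<equiv> a1 * b2 - a2 * b1" and "w1 \<equiv> a2 * b0 - a0 * b2" and "w2 \<equiv> a0 * b1 - a1 * b0"
  shows "x0 * (w0\<^sup>2 + w1\<^sup>2 + w2\<^sup>2) = (x0 * w0 + x1 * w1 + x2 * w2) * w0"
    and "x1 * (w0\<^sup>2 + w1\<^sup>2 + w2\<^sup>2) = (x0 * w0 + x1 * w1 + x2 * w2) * w1"
    and "x2 * (w0\<^sup>2 + w1\<^sup>2 + w2\<^sup>2) = (x0 * w0 + x1 * w1 + x2 * w2) * w2"
proof -
  have "x0 * w1 = x1 * w0" "x1 * w2 = x2 * w1" "x2 * w0 = x0 * w2"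
    using assms(1,2) unfolding w0_def w1_def w2_def by algebra+
  then show "x0 * (w0\<^sup>2 + w1\<^sup>2 + w2\<^sup>2) = (x0 * w0 + x1 * w1 + x2 * w2) * w0"
    and "x1 * (w0\<^sup>2 + w1\<^sup>2 + w2\<^sup>2) = (x0 * w0 + x1 * w1 + x2 * w2) * w1"
    and "x2 * (w0\<^sup>2 + w1\<^sup>2 + w2\<^sup>2) = (x0 * w0 + x1 * w1 + x2 * w2) * w2"
    by algebra+
qed

context profile_curve
begin

section \<open>The unit normal of the profile curve and its derivative\<close>

text \<open>The unit normal of the profile curve \<open>c = (f, f\<^sub>1, f\<^sub>2)\<close> in \<open>S\<^sup>2\<close>: the cross product of \<open>c\<close> and \<open>c'\<close>,
  normalized.\<close>

definition n0 where "n0 u = (f1 u * f2' u - f2 u * f1' u) / sqrt (w2 u)"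
definition n1 where "n1 u = (f2 u * f' u - f u * f2' u) / sqrt (w2 u)"
definition n2 where "n2 u = (f u * f1' u - f1 u * f' u) / sqrt (w2 u)"

lemma smooth_n: "smooth_on_open UNIV n0" "smooth_on_open UNIV n1" "smooth_on_open UNIV n2"
  unfolding n0_def n1_def n2_def
  by (intro smooth_on_open_intros smooth_f smooth_f1 smooth_f2 smooth_deriv(1,2,3) smooth_w2 open_UNIV w2_pos;
      use w2_pos in \<open>simp add: less_imp_neq[THEN not_sym]\<close>)+

lemmas has_deriv_n = smooth_real_deriv(1)[OF smooth_n(1)] smooth_real_deriv(1)[OF smooth_n(2)] smooth_real_deriv(1)[OF smooth_n(3)]

lemma curve_unit: "(f u)\<^sup>2 + (f1 u)\<^sup>2 + (f2 u)\<^sup>2 = 1"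
  using f_sq[of u] by simp

lemma curve_orth: "f u * f' u + f1 u * f1' u + f2 u * f2' u = 0"
  using f_deriv[of u] by simp

lemma curve_speed: "(f' u)\<^sup>2 + (f1' u)\<^sup>2 + (f2' u)\<^sup>2 = w2 u"
  using unit_speed[of u] by (simp add: w2_def)

lemma curve_second: "f u * f'' u + f1 u * f1'' u + f2 u * f2'' u + w2 u = 0"
proof -
  have "((\<lambda>u. f u * f' u + f1 u * f1' u + f2 u * f2' u) has_field_derivative
     (f u * f'' u + f1 u * f1'' u + f2 u * f2'' u + ((f' u)\<^sup>2 + (f1' u)\<^sup>2 + (f2' u)\<^sup>2))) (at u)"
    by (auto intro!: derivative_eq_intros has_deriv simp: power2_eq_square)
  moreover have "((\<lambda>u. f u * f' u + f1 u * f1' u + f2 u * f2' u) has_field_derivative 0) (at u)"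
    by (simp add: curve_orth)
  ultimately have "f u * f'' u + f1 u * f1'' u + f2 u * f2'' u + ((f' u)\<^sup>2 + (f1' u)\<^sup>2 + (f2' u)\<^sup>2) = 0"
    by (rule DERIV_unique)
  then show ?thesis by (simp only: curve_speed)
qed

text \<open>Lagrange's identity for c = (f, f1, f2) and c', with |c| = 1, c . c' = 0 and |c'|^2 =
  \<open>w2\<close>.\<close>

lemma cross_norm:
  "(f1 u * f2' u - f2 u * f1' u)\<^sup>2 + (f2 u * f' u - f u * f2' u)\<^sup>2
     + (f u * f1' u - f1 u * f' u)\<^sup>2 = w2 u"
proof -
  have "(f1 u * f2' u - f2 u * f1' u)\<^sup>2 + (f2 u * f' u - f u * f2' u)\<^sup>2
     + (f u * f1' u - f1 u * f' u)\<^sup>2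
     = ((f u)\<^sup>2 + (f1 u)\<^sup>2 + (f2 u)\<^sup>2) * ((f' u)\<^sup>2 + (f1' u)\<^sup>2 + (f2' u)\<^sup>2)
       - (f u * f' u + f1 u * f1' u + f2 u * f2' u)\<^sup>2"
    by algebra
  then show ?thesis by (simp add: curve_unit curve_orth curve_speed)
qed

lemma n_eqs:
  shows "n0 u * f u + n1 u * f1 u + n2 u * f2 u = 0"
    and "n0 u * f' u + n1 u * f1' u + n2 u * f2' u = 0"
    and "(n0 u)\<^sup>2 + (n1 u)\<^sup>2 + (n2 u)\<^sup>2 = 1"
proof -
  have s: "sqrt (w2 u) \<noteq> 0" "(sqrt (w2 u))\<^sup>2 = w2 u" "w2 u \<noteq> 0" using w2_pos[of u] by auto
  show "n0 u * f u + n1 u * f1 u + n2 u * f2 u = 0"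
    "n0 u * f' u + n1 u * f1' u + n2 u * f2' u = 0"
    unfolding n0_def n1_def n2_def using s(1) by (simp_all add: field_simps)
  show "(n0 u)\<^sup>2 + (n1 u)\<^sup>2 + (n2 u)\<^sup>2 = 1"
    unfolding n0_def n1_def n2_def power_divide s(2) add_divide_distrib[symmetric] cross_norm using s(3) by simp
qed

lemma perp_imp_multiple_n:
  assumes "x0 * f u + x1 * f1 u + x2 * f2 u = 0" "x0 * f' u + x1 * f1' u + x2 * f2' u = 0"
  shows "x0 = (x0 * n0 u + x1 * n1 u + x2 * n2 u) * n0 u"
    and "x1 = (x0 * n0 u + x1 * n1 u + x2 * n2 u) * n1 u"
    and "x2 = (x0 * n0 u + x1 * n1 u + x2 * n2 u) * n2 u"
proof -
  define s where "s = sqrt (w2 u)"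
  have s: "s \<noteq> 0" "s\<^sup>2 = w2 u" using w2_pos[of u] by (auto simp: s_def)
  have n: "f1 u * f2' u - f2 u * f1' u = s * n0 u" "f2 u * f' u - f u * f2' u = s * n1 u"
    "f u * f1' u - f1 u * f' u = s * n2 u"
    using s(1) by (auto simp: n0_def n1_def n2_def s_def[symmetric])
  note X = orthogonal_to_both_imp_parallel_cross[OF assms]
  have "(s * n0 u)\<^sup>2 + (s * n1 u)\<^sup>2 + (s * n2 u)\<^sup>2 = s\<^sup>2"
    using n_eqs(3)[of u] by (simp add: power_mult_distrib flip: distrib_left)
  note X = X[unfolded n this]
  have Y: "x0 * (s * n0 u) + x1 * (s * n1 u) + x2 * (s * n2 u) = s * (x0 * n0 u + x1 * n1 u + x2 * n2 u)"
    by (simp add: algebra_simps)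
  show "x0 = (x0 * n0 u + x1 * n1 u + x2 * n2 u) * n0 u"
    "x1 = (x0 * n0 u + x1 * n1 u + x2 * n2 u) * n1 u"
    "x2 = (x0 * n0 u + x1 * n1 u + x2 * n2 u) * n2 u"
    using X s(1) unfolding Y by (simp_all add: power2_eq_square)
qed

text \<open>Up to sign, g is the determinant and f f' the inner product of (f1, f2) and the unit
  vector (f1', f2'). Hence g^2 + (f f')^2 = f1^2 + f2^2 = 1 - f^2.\<close>

lemma h_eq: "prof_h f1 f2 u = f u * sqrt (w2 u)"
proof -
  have "1 - (prof_g f1 f2 u)\<^sup>2 = (f u)\<^sup>2 * w2 u"
    unfolding prof_g_def w2_def using curve_unit[of u] curve_orth[of u] unit_speed[of u] by algebra
  then show ?thesis
    unfolding prof_h_def using f_pos[of u] by (simp add: real_sqrt_mult)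
qed

text \<open>Along the sphere directions the immersion is scaled by \<open>f\<close> and the normal
  by \<open>n0\<close>, so -n0/f is a principal curvature. The next lemma is the analogue for the
  rotation in v, with \<open>f2\<close> and \<open>n2\<close>.\<close>

lemma n0_eq: "n0 u = - lam0 f1 f2 u * f u"
  using f_pos[of u] w2_pos[of u] by (simp add: n0_def lam0_def h_eq prof_g_def field_simps)

lemma n2_eq: "n2 u = - lam2 f1 f2 u * f2 u"
proof -
  have "f u * (f u * f1' u - f1 u * f' u) = - (prof_g f1 f2 u * f2 u - f1' u)"
    using curve_unit[of u] curve_orth[of u] unfolding prof_g_def by algebra
  then have *: "f u * f1' u - f1 u * f' u = - (prof_g f1 f2 u * f2 u - f1' u) / f u"
    using f_pos[of u] by (simp add: field_simps)
  show ?thesis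
    unfolding n2_def lam2_def h_eq * \<kappa>2_def
    using f_pos[of u] w2_pos[of u] f2_pos[of u] by (simp add: field_simps)
qed

lemma n_deriv_perp:
  "deriv n0 u * f u + deriv n1 u * f1 u + deriv n2 u * f2 u = 0"
  "deriv n0 u * n0 u + deriv n1 u * n1 u + deriv n2 u * n2 u = 0"
  "deriv n0 u * f' u + deriv n1 u * f1' u + deriv n2 u * f2' u
    = - (n0 u * f'' u + n1 u * f1'' u + n2 u * f2'' u)"
proof -
  have "((\<lambda>u. n0 u * f u + n1 u * f1 u + n2 u * f2 u) has_field_derivative
     (deriv n0 u * f u + deriv n1 u * f1 u + deriv n2 u * f2 u + (n0 u * f' u + n1 u * f1' u + n2 u * f2' u))) (at u)"
    by (auto intro!: derivative_eq_intros has_deriv has_deriv_n)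
  moreover have "((\<lambda>u. n0 u * f u + n1 u * f1 u + n2 u * f2 u) has_field_derivative 0) (at u)"
    by (simp add: n_eqs)
  ultimately show "deriv n0 u * f u + deriv n1 u * f1 u + deriv n2 u * f2 u = 0"
    using DERIV_unique n_eqs(2)[of u] by fastforce
  have "((\<lambda>u. (n0 u)\<^sup>2 + (n1 u)\<^sup>2 + (n2 u)\<^sup>2) has_field_derivative
     2 * (deriv n0 u * n0 u + deriv n1 u * n1 u + deriv n2 u * n2 u)) (at u)"
    by (auto intro!: derivative_eq_intros has_deriv has_deriv_n)
  moreover have "((\<lambda>u. (n0 u)\<^sup>2 + (n1 u)\<^sup>2 + (n2 u)\<^sup>2) has_field_derivative 0) (at u)"
    by (simp add: n_eqs)
  ultimately show "deriv n0 u * n0 u + deriv n1 u * n1 u + deriv n2 u * n2 u = 0"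
    using DERIV_unique by fastforce
  have "((\<lambda>u. n0 u * f' u + n1 u * f1' u + n2 u * f2' u) has_field_derivative
     (deriv n0 u * f' u + deriv n1 u * f1' u + deriv n2 u * f2' u
       + (n0 u * f'' u + n1 u * f1'' u + n2 u * f2'' u))) (at u)"
    by (auto intro!: derivative_eq_intros has_deriv has_deriv_n)
  moreover have "((\<lambda>u. n0 u * f' u + n1 u * f1' u + n2 u * f2' u) has_field_derivative 0) (at u)"
    by (simp add: n_eqs)
  ultimately have "deriv n0 u * f' u + deriv n1 u * f1' u + deriv n2 u * f2' u
       + (n0 u * f'' u + n1 u * f1'' u + n2 u * f2'' u) = 0"
    by (rule DERIV_unique)
  then show "deriv n0 u * f' u + deriv n1 u * f1' u + deriv n2 u * f2' u
    = - (n0 u * f'' u + n1 u * f1'' u + n2 u * f2'' u)"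
    by simp
qed

text \<open>The right-hand side is the second fundamental form n . c'' of the profile curve;
  dividing it by |c'|^2 = \<open>w2\<close> gives the curvature in the u-direction.\<close>

lemma lam1_eq:
  "lam1 f1 f2 u * w2 u = n0 u * f'' u + n1 u * f1'' u + n2 u * f2'' u"
proof -
  define s where "s = sqrt (w2 u)"
  have s: "s \<noteq> 0" "s\<^sup>2 = w2 u" using w2_pos[of u] by (auto simp: s_def)
  define d where "d = (f1 u * f2' u - f2 u * f1' u) * f'' u
     + (f2 u * f' u - f u * f2' u) * f1'' u + (f u * f1' u - f1 u * f' u) * f2'' u"
  have fp: "f u \<noteq> 0" using f_pos[of u] by simp
  \<comment> \<open>\<open>d\<close> is the determinant of c, c', c''. After multiplication by f,
    the products f^2, f f' and f f'' can be eliminated by |c|^2 = 1 and its derivatives.\<close>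
  have det: "f u * d = \<kappa>1 f1 f2 u + prof_g f1 f2 u * w2 u"
  proof -
    have "f u * f' u * (f2 u * f1'' u - f1 u * f2'' u)
       = - (f1 u * f1' u + f2 u * f2' u) * (f2 u * f1'' u - f1 u * f2'' u)"
      using f_deriv[of u] by simp
    moreover have "f u * d = prof_g f1 f2 u * (- (f u * f'' u))
      + f u * f' u * (f2 u * f1'' u - f1 u * f2'' u) + (f u)\<^sup>2 * \<kappa>1 f1 f2 u"
      unfolding d_def prof_g_def \<kappa>1_def by algebra
    moreover have "- (f u * f'' u) = f1 u * f1'' u + f2 u * f2'' u + w2 u"
      using curve_second[of u] by simp
    ultimately show ?thesis
      unfolding f_sq prof_g_def \<kappa>1_def by algebra
  qed
  have "n0 u * f'' u + n1 u * f1'' u + n2 u * f2'' u = d / s"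
    unfolding n0_def n1_def n2_def d_def s_def[symmetric] by (simp add: add_divide_distrib)
  also have "\<dots> = (\<kappa>1 f1 f2 u + prof_g f1 f2 u * s\<^sup>2) / (f u * s)"
    using det fp s by (simp add: field_simps)
  also have "\<dots> = lam1 f1 f2 u * s\<^sup>2"
  proof -
    \<comment> \<open>Since h = f s, this replaces (f f')^2 by h^2 - f^2 in
      \<open>lam1\<close>.\<close>
    have "(f u)\<^sup>2 * s\<^sup>2 - (f u * f' u)\<^sup>2 = (f u)\<^sup>2"
      unfolding s(2) w2_def by algebra
    then have "\<kappa>1 f1 f2 u * (f u * f' u)\<^sup>2 = \<kappa>1 f1 f2 u * ((f u)\<^sup>2 * s\<^sup>2 - (f u)\<^sup>2)" by simp
    then have l: "lam1 f1 f2 u = (prof_g f1 f2 u + \<kappa>1 f1 f2 u) / (f u * s) - \<kappa>1 f1 f2 u * ((f u)\<^sup>2 * s\<^sup>2 - (f u)\<^sup>2) / (f u * s) ^ 3"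
      unfolding lam1_def h_eq s_def[symmetric] by simp
    show ?thesis
      unfolding l using fp s(1) by (simp add: field_simps power2_eq_square power3_eq_cube)
  qed
  finally show ?thesis using s(2) by simp
qed

text \<open>The vectors c, c', n form an orthogonal basis of R^3, and n' + \<open>lam1\<close> c' is
  orthogonal to all three.\<close>

lemma n_deriv:
  "deriv n0 u = - lam1 f1 f2 u * f' u" "deriv n1 u = - lam1 f1 f2 u * f1' u" "deriv n2 u = - lam1 f1 f2 u * f2' u"
proof -
  define l where "l = lam1 f1 f2 u"
  define x0 x1 x2 where "x0 = deriv n0 u + l * f' u" and "x1 = deriv n1 u + l * f1' u" and "x2 = deriv n2 u + l * f2' u"
  have 1: "x0 * f u + x1 * f1 u + x2 * f2 u = 0"
    unfolding x0_def x1_def x2_def using n_deriv_perp(1)[of u] curve_orth[of u] by algebra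
  have 2: "x0 * f' u + x1 * f1' u + x2 * f2' u = 0"
    unfolding x0_def x1_def x2_def using n_deriv_perp(3)[of u] curve_speed[of u] lam1_eq[of u, folded l_def] by algebra
  have 3: "x0 * n0 u + x1 * n1 u + x2 * n2 u = 0"
    unfolding x0_def x1_def x2_def using n_deriv_perp(2)[of u] n_eqs(2)[of u] by algebra
  from perp_imp_multiple_n[OF 1 2, unfolded 3]
  show "deriv n0 u = - lam1 f1 f2 u * f' u" "deriv n1 u = - lam1 f1 f2 u * f1' u" "deriv n2 u = - lam1 f1 f2 u * f2' u"
    by (simp_all add: x0_def x1_def x2_def l_def)
qed

section \<open>The unit normal field and the shape operator of the hypersurface\<close>

definition \<nu>0 :: "'a::euclidean_space coords \<Rightarrow> 'a \<times> real \<times> real \<times> real" where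
  "\<nu>0 q = (n0 (fst (snd q)) *\<^sub>R fst q, n1 (fst (snd q)), n2 (fst (snd q)) * cos (snd (snd q)), n2 (fst (snd q)) * sin (snd (snd q)))"

lemma smooth_\<nu>0: "smooth_on_open UNIV \<nu>0"
  unfolding \<nu>0_def
  by (intro smooth_on_open_intros smooth_comp_u[OF open_UNIV smooth_n(1)] smooth_comp_u[OF open_UNIV smooth_n(2)]
      smooth_comp_u[OF open_UNIV smooth_n(3)] open_UNIV)

lemma \<nu>0_has_derivative:
  fixes y :: "'a::euclidean_space"
  shows "(\<nu>0 has_derivative (\<lambda>(Y, a, b). - dphi (y, u, v) (lam0 f1 f2 u *\<^sub>R Y, lam1 f1 f2 u * a, lam2 f1 f2 u * b))) (at (y, u, v))"
proof -
  note D = has_derivative_snd_comp(1)[OF has_deriv_n(1)] has_derivative_snd_comp(1)[OF has_deriv_n(2)]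
    has_derivative_snd_comp(1)[OF has_deriv_n(3)] has_derivative_snd_comp(2)[OF DERIV_cos] has_derivative_snd_comp(2)[OF DERIV_sin]
  show ?thesis
    unfolding \<nu>0_def
    by (rule has_derivative_eq_rhs, (rule has_derivative_Pair has_derivative_scaleR has_derivative_mult D has_derivative_fst has_derivative_ident)+)
       (auto simp: fun_eq_iff algebra_simps dphi_def n_deriv n0_eq n2_eq split: prod.splits)
qed

lemma unit_normal_field_\<nu>0: "unit_normal_field M_dom \<phi> (\<nu>0 :: 'a::euclidean_space coords \<Rightarrow> _)"
  unfolding unit_normal_field_def
proof (intro conjI ballI)
  show "smooth_map_on M_dom (\<nu>0 :: 'a coords \<Rightarrow> _)"
    unfolding smooth_map_on_def using smooth_\<nu>0 by blast
  fix p :: "'a coords" assume "p \<in> M_dom"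
  then obtain y u v where yuv: "p = (y, u, v)" and y: "norm y = 1" by (auto simp: M_dom_def)
  then have yy: "y \<bullet> y = 1" by (simp add: dot_square_norm)
  have trig: "a * cos v * (b * cos v) + a * sin v * (b * sin v) = a * b" for a b
  proof -
    have "a * cos v * (b * cos v) + a * sin v * (b * sin v) = a * b * ((cos v)\<^sup>2 + (sin v)\<^sup>2)" by algebra
    then show ?thesis by simp
  qed
  have "\<nu>0 p \<bullet> \<nu>0 p = 1"
    using n_eqs(3)[of u] unfolding \<nu>0_def yuv by (simp add: yy trig power2_eq_square)
  then show "norm (\<nu>0 p) = 1" by (simp add: norm_eq_1)
  have [simp]: "sqrt (1 - (f1 u)\<^sup>2 - (f2 u)\<^sup>2) = f u" by (simp add: prof_f_def)
  show "\<nu>0 p \<bullet> \<phi> p = 0"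
    using n_eqs(1)[of u] unfolding \<nu>0_def yuv by (simp add: immersion_\<phi>_def yy trig mult.commute[of "f u"])
  fix X assume X: "X \<in> tangent_space M_dom p"
  obtain Y a b where XY: "X = (Y, a, b)" by (metis prod_cases3)
  have "y \<bullet> Y = 0" using X tangent_space_M_dom[OF y, of u v] by (auto simp: yuv XY inner_commute)
  have "n2 u * cos v * (f2' u * a * cos v - f2 u * b * sin v) + n2 u * sin v * (f2' u * a * sin v + f2 u * b * cos v)
     = n2 u * (f2' u * a) * ((cos v)\<^sup>2 + (sin v)\<^sup>2)"
    by algebra
  moreover have "n0 u * (f' u * a) + (n1 u * (f1' u * a) + n2 u * (f2' u * a)) = 0"
    using n_eqs(2)[of u] by algebra
  ultimately show "\<nu>0 p \<bullet> differential M_dom \<phi> p X = 0"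
    using \<open>y \<bullet> Y = 0\<close> unfolding differential_phi[OF X]
    by (simp add: \<nu>0_def yuv XY dphi_def yy inner_add_right mult.commute[of "f' u * a"])
qed

text \<open>Orthogonality to the sphere directions makes the first component a multiple of
  \<open>y\<close>, and orthogonality to the rotation makes the last two a multiple of (cos v, sin
  v). What remains is a vector of R^3 orthogonal to c and c', hence a multiple of (n0, n1,
  n2).\<close>

lemma normal_multiple:
  fixes y :: "'a::euclidean_space"
  assumes y: "norm y = 1" and n: "norm n = 1" "n \<bullet> \<phi> (y, u, v) = 0" "\<And>X. X \<in> tangent_space M_dom (y, u, v) \<Longrightarrow> n \<bullet> dphi (y, u, v) X = 0"
  shows "n = (n \<bullet> \<nu>0 (y, u, v)) *\<^sub>R \<nu>0 (y, u, v)" "(n \<bullet> \<nu>0 (y, u, v))\<^sup>2 = 1"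
proof -
  obtain N a b c where N: "n = (N, a, b, c)" by (metis prod_cases4)
  have yy: "y \<bullet> y = 1" using y by (simp add: dot_square_norm)
  note T = tangent_space_M_dom[OF y, of u v]
  have perp: "n \<bullet> dphi (y, u, v) (Y, s, t) = 0" if "Y \<bullet> y = 0" for Y s t
    using n(3)[of "(Y, s, t)"] that T by auto
  define x0 where "x0 = N \<bullet> y"
  define x2 where "x2 = b * cos v + c * sin v"
  have Ny: "N = x0 *\<^sub>R y"
  proof -
    have "(N - x0 *\<^sub>R y) \<bullet> y = 0" by (simp add: x0_def inner_diff_left yy)
    from perp[OF this, of 0 0] have "f u * (N \<bullet> (N - x0 *\<^sub>R y)) = 0" by (simp add: N dphi_def)
    then have "N \<bullet> (N - x0 *\<^sub>R y) = 0" using f_pos[of u] by simp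
    with \<open>(N - x0 *\<^sub>R y) \<bullet> y = 0\<close> have "(N - x0 *\<^sub>R y) \<bullet> (N - x0 *\<^sub>R y) = 0"
      by (simp add: inner_diff_left inner_commute)
    then show ?thesis by simp
  qed
  have cs: "c * cos v = b * sin v"
  proof -
    have "f2 u * (c * cos v - b * sin v) = 0"
      using perp[of 0 0 1] by (simp add: N dphi_def algebra_simps)
    then show ?thesis using f2_pos[of u] by simp
  qed
  have sc: "(sin v)\<^sup>2 + (cos v)\<^sup>2 = 1" by simp
  have bc: "b = x2 * cos v" "c = x2 * sin v"
    unfolding x2_def using cs sc by algebra+
  have [simp]: "sqrt (1 - (f1 u)\<^sup>2 - (f2 u)\<^sup>2) = f u" by (simp add: prof_f_def)
  have 1: "x0 * f u + a * f1 u + x2 * f2 u = 0"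
  proof -
    have "x0 * f u + a * f1 u + b * (f2 u * cos v) + c * (f2 u * sin v) = 0"
      using n(2) by (simp add: N Ny immersion_\<phi>_def yy mult_ac add_ac)
    then show ?thesis unfolding x2_def by (simp add: algebra_simps)
  qed
  have 2: "x0 * f' u + a * f1' u + x2 * f2' u = 0"
  proof -
    have "x0 * f' u + a * f1' u + b * (f2' u * cos v) + c * (f2' u * sin v) = 0"
      using perp[of 0 1 0] by (simp add: N Ny dphi_def yy algebra_simps)
    then show ?thesis unfolding x2_def by (simp add: algebra_simps)
  qed
  have \<sigma>: "n \<bullet> \<nu>0 (y, u, v) = x0 * n0 u + a * n1 u + x2 * n2 u"
    unfolding x2_def by (simp add: N Ny \<nu>0_def yy algebra_simps)
  show eq: "n = (n \<bullet> \<nu>0 (y, u, v)) *\<^sub>R \<nu>0 (y, u, v)"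
    unfolding \<sigma> unfolding N Ny bc \<nu>0_def
    using perp_imp_multiple_n[OF 1 2] by (simp add: mult.assoc[symmetric])
  have "(y, u, v) \<in> M_dom" using y by (simp add: M_dom_def)
  then have "norm (\<nu>0 (y, u, v)) = 1"
    using unit_normal_field_\<nu>0 unfolding unit_normal_field_def by blast
  then show "(n \<bullet> \<nu>0 (y, u, v))\<^sup>2 = 1"
    using arg_cong[OF eq, of norm] n(1) by (simp add: power2_eq_1_iff abs_if split: if_splits)
qed

text \<open>An arbitrary unit normal field is \<open>\<sigma> \<nu>0\<close> with \<open>\<sigma>\<^sup>2 = 1\<close>; differentiating this identity kills \<open>d\<sigma>\<close>, so no
  connectedness argument is needed.\<close>

lemma differential_normal:
  fixes \<nu> :: "'a::euclidean_space coords \<Rightarrow> 'a \<times> real \<times> real \<times> real"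
  assumes \<nu>: "unit_normal_field M_dom \<phi> \<nu>" and y: "norm y = 1"
  obtains \<sigma> where "\<sigma>\<^sup>2 = 1"
    "\<And>Y a b. Y \<bullet> y = 0 \<Longrightarrow> - differential M_dom \<nu> (y, u, v) (Y, a, b)
       = dphi (y, u, v) ((\<sigma> * lam0 f1 f2 u) *\<^sub>R Y, \<sigma> * lam1 f1 f2 u * a, \<sigma> * lam2 f1 f2 u * b)"
proof -
  let ?p = "(y, u, v)"
  have p: "?p \<in> M_dom" using y by (simp add: M_dom_def)
  obtain W G where W: "open W" "?p \<in> W" "smooth_on_open W G" "\<And>q. q \<in> M_dom \<inter> W \<Longrightarrow> G q = \<nu> q"
    using \<nu> p unfolding unit_normal_field_def smooth_map_on_def by meson
  have mult: "\<nu> q = (\<nu> q \<bullet> \<nu>0 q) *\<^sub>R \<nu>0 q \<and> (\<nu> q \<bullet> \<nu>0 q)\<^sup>2 = 1" if "q \<in> M_dom" for q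
  proof -
    obtain y' u' v' where q: "q = (y', u', v')" by (metis prod_cases3)
    then have y': "norm y' = 1" using that by (simp add: M_dom_def)
    have "norm (\<nu> q) = 1" "\<nu> q \<bullet> \<phi> q = 0" "\<And>X. X \<in> tangent_space M_dom q \<Longrightarrow> \<nu> q \<bullet> dphi q X = 0"
      using \<nu> that unfolding unit_normal_field_def by (auto simp: differential_phi)
    then show ?thesis using normal_multiple[OF y', of "\<nu> q" u' v'] unfolding q by simp
  qed
  define S where "S q = G q \<bullet> \<nu>0 q" for q
  have S\<nu>: "S q = \<nu> q \<bullet> \<nu>0 q" if "q \<in> M_dom \<inter> W" for q
    using W(4)[OF that] by (simp add: S_def)
  define S' where "S' = frechet_derivative S (at ?p)"
  have S': "(S has_derivative S') (at ?p)"
  proof -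
    have "smooth_on_open W S"
      unfolding S_def by (intro smooth_on_open_inner W smooth_on_open_subset[OF smooth_\<nu>0]) simp
    from smooth_on_openD(1)[OF this W(1,2)] show ?thesis by (simp add: S'_def)
  qed
  have pW: "?p \<in> M_dom \<inter> W" using p W(2) by simp
  have S1: "(S ?p)\<^sup>2 = 1" using mult[OF p] S\<nu>[OF pW] by simp
  have S'0: "S' X = 0" if X: "X \<in> tangent_space M_dom ?p" for X
  proof -
    have "((\<lambda>q. S q * S q) has_derivative (\<lambda>X. S ?p * S' X + S' X * S ?p)) (at ?p)"
      by (rule has_derivative_mult[OF S' S'])
    then have "((\<lambda>q. 1) has_derivative (\<lambda>X. S ?p * S' X + S' X * S ?p)) (at ?p within M_dom)"
      by (rule has_derivative_within_extension[OF _ W(1) pW])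
         (use mult S\<nu> in \<open>simp add: power2_eq_square\<close>)
    from differential_eqI[OF this X] differential_eqI[OF has_derivative_const[of "1::real"] X]
    have "S ?p * S' X + S' X * S ?p = 0" by simp
    then show ?thesis using S1 by auto
  qed
  show thesis
  proof (rule that[of "S ?p"])
    show "(S ?p)\<^sup>2 = 1" by (rule S1)
    fix Y a b assume Y: "Y \<bullet> y = 0"
    then have X: "(Y, a, b) \<in> tangent_space M_dom ?p" using tangent_space_M_dom[OF y] by auto
    have "(\<nu> has_derivative (\<lambda>X. S ?p *\<^sub>R (\<lambda>(Y, a, b). - dphi ?p (lam0 f1 f2 u *\<^sub>R Y, lam1 f1 f2 u * a, lam2 f1 f2 u * b)) X
         + S' X *\<^sub>R \<nu>0 ?p)) (at ?p within M_dom)"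
    proof (rule has_derivative_within_extension[OF has_derivative_scaleR[OF S' \<nu>0_has_derivative] W(1) pW])
      fix q assume q: "q \<in> M_dom \<inter> W"
      then have "q \<in> M_dom" by simp
      from mult[OF this] S\<nu>[OF q] show "S q *\<^sub>R \<nu>0 q = \<nu> q" by simp
    qed
    from differential_eqI[OF this X]
    have "differential M_dom \<nu> ?p (Y, a, b) = - (S ?p *\<^sub>R dphi ?p (lam0 f1 f2 u *\<^sub>R Y, lam1 f1 f2 u * a, lam2 f1 f2 u * b))"
      by (simp add: S'0[OF X])
    then show "- differential M_dom \<nu> ?p (Y, a, b)
       = dphi ?p ((S ?p * lam0 f1 f2 u) *\<^sub>R Y, S ?p * lam1 f1 f2 u * a, S ?p * lam2 f1 f2 u * b)"
      using linear_cmul[OF linear_dphi, of ?p "S ?p" "(lam0 f1 f2 u *\<^sub>R Y, lam1 f1 f2 u * a, lam2 f1 f2 u * b)"]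
      by (simp add: mult.assoc)
  qed
qed

text \<open>The three curvatures may coincide, so multiplicities are counted without distinguishing
  cases: every curvature space is a product of three factors, each of them zero unless \<kappa> is
  its own curvature, and dimensions add. The sign \<sigma> of the Gauss map disappears in the
  squares.\<close>

lemma norm_A_squared_eq:
  fixes p :: "'a::euclidean_space coords"
  assumes p: "p \<in> M_dom" and dim: "DIM('a) = k + 1" and k: "k \<ge> 1"
  shows "norm_A_squared M_dom \<phi> p = real k * (lam0 f1 f2 (fst (snd p)))\<^sup>2
    + (lam1 f1 f2 (fst (snd p)))\<^sup>2 + (lam2 f1 f2 (fst (snd p)))\<^sup>2"
proof -
  obtain y u v where yuv: "p = (y, u, v)" and y: "norm y = 1" using p by (auto simp: M_dom_def)
  have "unit_normal_field M_dom \<phi> (gauss_map M_dom (\<phi> :: 'a coords \<Rightarrow> _))"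
    unfolding gauss_map_def by (rule someI[of "unit_normal_field M_dom \<phi>", OF unit_normal_field_\<nu>0])
  then obtain \<sigma> where \<sigma>: "\<sigma>\<^sup>2 = 1"
    and D: "\<And>Y a b. Y \<bullet> y = 0 \<Longrightarrow> - differential M_dom (gauss_map M_dom \<phi>) (y, u, v) (Y, a, b)
       = dphi (y, u, v) ((\<sigma> * lam0 f1 f2 u) *\<^sub>R Y, \<sigma> * lam1 f1 f2 u * a, \<sigma> * lam2 f1 f2 u * b)"
    using differential_normal[OF _ y] by metis
  define m0 m1 m2 where "m0 = \<sigma> * lam0 f1 f2 u" and "m1 = \<sigma> * lam1 f1 f2 u" and "m2 = \<sigma> * lam2 f1 f2 u"
  define A0 where "A0 \<kappa> = (if \<kappa> = m0 then {Y. y \<bullet> Y = 0} else {0})" for \<kappa>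
  define A where "A m \<kappa> = (if \<kappa> = m then UNIV else {0::real})" for m \<kappa> :: real
  have cs: "curvature_space M_dom \<phi> p \<kappa> = A0 \<kappa> \<times> A m1 \<kappa> \<times> A m2 \<kappa>" for \<kappa>
  proof (rule set_eqI)
    fix X :: "'a coords"
    obtain Y a b where X: "X = (Y, a, b)" by (metis prod_cases3)
    show "X \<in> curvature_space M_dom \<phi> p \<kappa> \<longleftrightarrow> X \<in> A0 \<kappa> \<times> A m1 \<kappa> \<times> A m2 \<kappa>"
    proof (cases "Y \<bullet> y = 0")
      case True
      then have T: "X \<in> tangent_space M_dom p" using tangent_space_M_dom[OF y] by (auto simp: X yuv)
      have "X \<in> curvature_space M_dom \<phi> p \<kappa> \<longleftrightarrow> dphi p (m0 *\<^sub>R Y, m1 * a, m2 * b) = \<kappa> *\<^sub>R dphi p X"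
        using T D[OF True, of a b] differential_phi[OF T] by (simp add: curvature_space_def X yuv m0_def m1_def m2_def)
      also have "\<dots> \<longleftrightarrow> dphi p ((m0 - \<kappa>) *\<^sub>R Y, (m1 - \<kappa>) * a, (m2 - \<kappa>) * b) = 0"
      proof -
        have "((m0 - \<kappa>) *\<^sub>R Y, (m1 - \<kappa>) * a, (m2 - \<kappa>) * b) = (m0 *\<^sub>R Y, m1 * a, m2 * b) - \<kappa> *\<^sub>R X"
          by (simp add: X algebra_simps)
        then show ?thesis
          by (simp only: linear_diff[OF linear_dphi] linear_cmul[OF linear_dphi]) simp
      qed
      also have "\<dots> \<longleftrightarrow> (m0 - \<kappa>) *\<^sub>R Y = 0 \<and> (m1 - \<kappa>) * a = 0 \<and> (m2 - \<kappa>) * b = 0"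
      proof
        assume "dphi p ((m0 - \<kappa>) *\<^sub>R Y, (m1 - \<kappa>) * a, (m2 - \<kappa>) * b) = 0"
        then show "(m0 - \<kappa>) *\<^sub>R Y = 0 \<and> (m1 - \<kappa>) * a = 0 \<and> (m2 - \<kappa>) * b = 0"
          using True unfolding yuv by (intro dphi_inj[OF y, of _ u v]) simp_all
      next
        assume "(m0 - \<kappa>) *\<^sub>R Y = 0 \<and> (m1 - \<kappa>) * a = 0 \<and> (m2 - \<kappa>) * b = 0"
        then have z: "((m0 - \<kappa>) *\<^sub>R Y, (m1 - \<kappa>) * a, (m2 - \<kappa>) * b) = 0"
          unfolding zero_prod_def by simp
        show "dphi p ((m0 - \<kappa>) *\<^sub>R Y, (m1 - \<kappa>) * a, (m2 - \<kappa>) * b) = 0"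
          unfolding z by (rule linear_0[OF linear_dphi])
      qed
      also have "\<dots> \<longleftrightarrow> X \<in> A0 \<kappa> \<times> A m1 \<kappa> \<times> A m2 \<kappa>"
        using True by (auto simp: X A0_def A_def inner_commute)
      finally show ?thesis .
    next
      case False
      then have "Y \<noteq> 0" by auto
      then show ?thesis using False tangent_space_M_dom[OF y, of u v]
        by (auto simp: X curvature_space_def yuv A0_def inner_commute)
    qed
  qed
  have "y \<noteq> 0" using y by auto
  have dA0: "dim (A0 \<kappa>) = (if \<kappa> = m0 then k else 0)" and sA0: "subspace (A0 \<kappa>)" for \<kappa>
    using dim_hyperplane[OF \<open>y \<noteq> 0\<close>] dim by (auto simp: A0_def subspace_hyperplane)
  have dA: "dim (A m \<kappa>) = (if \<kappa> = m then 1 else 0)" and sA: "subspace (A m \<kappa>)" for m \<kappa>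
    by (auto simp: A_def)
  have dcs: "dim (curvature_space M_dom \<phi> p \<kappa>) = (if \<kappa> = m0 then k else 0) + ((if \<kappa> = m1 then 1 else 0) + (if \<kappa> = m2 then 1 else 0))" for \<kappa>
    unfolding cs by (simp add: dim_Times subspace_Times sA0 sA dA0 dA)
  \<comment> \<open>For k \<ge> 1 the sphere has nonzero tangent vectors, so \<open>m0\<close> does
    occur as a principal curvature.\<close>
  have nz: "\<exists>Y. Y \<noteq> 0 \<and> y \<bullet> Y = 0"
  proof (rule ccontr)
    assume "\<not> ?thesis"
    then have "{Y. y \<bullet> Y = 0} = {0}" by auto
    then show False using dim_hyperplane[OF \<open>y \<noteq> 0\<close>] dim k by simp
  qed
  have pc: "principal_curvatures M_dom \<phi> p = {m0, m1, m2}"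
  proof (rule set_eqI)
    fix \<kappa>
    have "(\<exists>X\<in>A0 \<kappa> \<times> A m1 \<kappa> \<times> A m2 \<kappa>. X \<noteq> 0) \<longleftrightarrow> (\<exists>Y\<in>A0 \<kappa>. Y \<noteq> 0) \<or> (\<exists>a\<in>A m1 \<kappa>. a \<noteq> 0) \<or> (\<exists>b\<in>A m2 \<kappa>. b \<noteq> 0)"
    proof
      have z: "0 \<in> A0 \<kappa>" "0 \<in> A m1 \<kappa>" "0 \<in> A m2 \<kappa>" by (auto simp: A0_def A_def)
      assume "(\<exists>Y\<in>A0 \<kappa>. Y \<noteq> 0) \<or> (\<exists>a\<in>A m1 \<kappa>. a \<noteq> 0) \<or> (\<exists>b\<in>A m2 \<kappa>. b \<noteq> 0)"
      then obtain Y a b where "(Y, a, b) \<in> A0 \<kappa> \<times> A m1 \<kappa> \<times> A m2 \<kappa>" "Y \<noteq> 0 \<or> a \<noteq> 0 \<or> b \<noteq> 0"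
        using z by blast
      then show "\<exists>X\<in>A0 \<kappa> \<times> A m1 \<kappa> \<times> A m2 \<kappa>. X \<noteq> 0" by (intro bexI[of _ "(Y, a, b)"]) (auto simp: zero_prod_def)
    qed (auto simp: zero_prod_def)
    also have "\<dots> \<longleftrightarrow> \<kappa> \<in> {m0, m1, m2}"
      using nz by (auto simp: A0_def A_def intro: exI[of _ 1])
    finally show "\<kappa> \<in> principal_curvatures M_dom \<phi> p \<longleftrightarrow> \<kappa> \<in> {m0, m1, m2}"
      by (simp add: principal_curvatures_def cs)
  qed
  have "norm_A_squared M_dom \<phi> p = (\<Sum>\<kappa>\<in>{m0, m1, m2}. (if \<kappa> = m0 then real k * \<kappa>\<^sup>2 else 0)
      + ((if \<kappa> = m1 then \<kappa>\<^sup>2 else 0) + (if \<kappa> = m2 then \<kappa>\<^sup>2 else 0)))"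
    unfolding norm_A_squared_def pc dcs by (intro sum.cong refl) (simp add: distrib_right)
  also have "\<dots> = real k * m0\<^sup>2 + (m1\<^sup>2 + m2\<^sup>2)"
    unfolding sum.distrib by (simp add: sum.delta')
  finally show ?thesis
    unfolding m0_def m1_def m2_def power_mult_distrib \<sigma> by (simp add: yuv)
qed

end

section \<open>Integration by parts on the sphere\<close>

text \<open>A \<open>C\<^sup>1\<close> cutoff in the variable \<open>s = |x|\<^sup>2\<close>, positive for \<open>1 < |x| < 2\<close> only.\<close>

definition bump :: "real \<Rightarrow> real" where
  "bump s = (max 0 (s - 1))\<^sup>2 * (max 0 (4 - s))\<^sup>2"

definition bump' :: "real \<Rightarrow> real" where
  "bump' s = 2 * max 0 (s - 1) * (max 0 (4 - s))\<^sup>2 - (max 0 (s - 1))\<^sup>2 * (2 * max 0 (4 - s))"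

lemma max0_sq_deriv: "((\<lambda>t. (max 0 t)\<^sup>2) has_field_derivative 2 * max 0 t) (at (t::real))"
proof (cases t "0::real" rule: linorder_cases)
  case less
  have "((\<lambda>t. 0) has_field_derivative 2 * max 0 t) (at t)" using less by simp
  then show ?thesis
    by (rule has_field_derivative_transform_within_open[where S="{..<0}"]) (use less in auto)
next
  case equal
  \<comment> \<open>Caratheodory's criterion at 0, with the continuous slope
    \<open>max 0 z\<close>.\<close>
  have "isCont (\<lambda>z::real. max 0 z) 0" by (intro continuous_intros)
  moreover have "(max 0 z)\<^sup>2 = max 0 z * z" for z :: real
    by (simp add: max_def power2_eq_square)
  ultimately show ?thesis
    unfolding equal CARAT_DERIV by (intro exI[of _ "\<lambda>z. max 0 z"]) simp
next
  case greater
  have "((\<lambda>t. t\<^sup>2) has_field_derivative 2 * max 0 t) (at t)" using greater by (auto intro!: derivative_eq_intros)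
  then show ?thesis
    by (rule has_field_derivative_transform_within_open[where S="{0<..}"]) (use greater in auto)
qed

lemma bump_deriv: "(bump has_field_derivative bump' s) (at s)"
proof -
  have "((\<lambda>s. s - 1) has_field_derivative 1) (at s)" "((\<lambda>s. 4 - s) has_field_derivative - 1) (at s)"
    by (auto intro!: derivative_eq_intros)
  note * = this[THEN DERIV_chain2[OF max0_sq_deriv]]
  have 1: "((\<lambda>s. (max 0 (s - 1))\<^sup>2) has_field_derivative 2 * max 0 (s - 1)) (at s)"
    using *(1) by simp
  have 2: "((\<lambda>s. (max 0 (4 - s))\<^sup>2) has_field_derivative - (2 * max 0 (4 - s))) (at s)"
    using *(2) by simp
  show ?thesis
    unfolding bump_def bump'_def by (rule DERIV_cong[OF DERIV_mult[OF 1 2]]) simp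
qed

lemma continuous_on_bump [continuous_intros]: "continuous_on S g \<Longrightarrow> continuous_on S (\<lambda>x. bump (g x))"
  and continuous_on_bump' [continuous_intros]: "continuous_on S g \<Longrightarrow> continuous_on S (\<lambda>x. bump' (g x))"
  unfolding bump_def bump'_def by (intro continuous_intros; assumption)+

lemma bump_nonneg: "bump s \<ge> 0" by (simp add: bump_def)

lemma bump_eq_0: "s \<le> 1 \<or> s \<ge> 4 \<Longrightarrow> bump s = 0"
  and bump'_eq_0: "s \<le> 1 \<or> s \<ge> 4 \<Longrightarrow> bump' s = 0"
  by (auto simp: bump_def bump'_def)

text \<open>\<open>Q\<close> need not be continuous where \<open>g\<close> vanishes, but the cutoff
  \<open>B\<close> is zero on a whole neighbourhood of that set. The open sets |g| < 1 and g
  \<noteq> 0 cover the space, and the product is continuous on each.\<close>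

lemma continuous_on_vanishing_extension:
  fixes g :: "'b::topological_space \<Rightarrow> 'a::real_inner" and Q B :: "'b \<Rightarrow> real"
  assumes g: "continuous_on UNIV g" and Q: "continuous_on {p. g p \<noteq> 0} Q"
    and B: "continuous_on UNIV B" "\<And>p. g p \<bullet> g p < 1 \<Longrightarrow> B p = 0"
  shows "continuous_on UNIV (\<lambda>p. B p * Q p)"
proof -
  have o1: "open {p. g p \<noteq> 0}"
    by (rule open_Collect_neq[OF g continuous_on_const])
  have "continuous_on UNIV (\<lambda>p. g p \<bullet> g p)" by (intro continuous_intros g)
  then have o2: "open {p. g p \<bullet> g p < 1}"
    using open_Collect_less[of "\<lambda>p. g p \<bullet> g p" "\<lambda>_. 1"] by simp
  have "continuous_on {p. g p \<bullet> g p < 1} (\<lambda>p. B p * Q p)"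
    by (rule continuous_on_eq[where f="\<lambda>_. 0"]) (auto simp: B(2))
  moreover have "continuous_on {p. g p \<noteq> 0} (\<lambda>p. B p * Q p)"
    by (intro continuous_intros Q continuous_on_subset[OF B(1)]) simp
  ultimately have "continuous_on ({p. g p \<bullet> g p < 1} \<union> {p. g p \<noteq> 0}) (\<lambda>p. B p * Q p)"
    using o1 o2 by (intro continuous_on_open_Un)
  moreover have "{p. g p \<bullet> g p < 1} \<union> {p. g p \<noteq> 0} = UNIV" by auto
  ultimately show ?thesis by simp
qed

text \<open>Half the side is 3 because the cube has to contain the ball of radius 2 even after
  translations of length at most 1.\<close>

abbreviation corner :: "'a::euclidean_space" where "corner \<equiv> 3 *\<^sub>R One"

abbreviation cube :: "'a::euclidean_space set" where "cube \<equiv> cbox (- corner) corner"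

lemma in_corner_box:
  fixes x :: "'a::euclidean_space"
  assumes "norm x \<le> 3"
  shows "x \<in> cube"
proof -
  have "\<bar>x \<bullet> b\<bar> \<le> 3" if "b \<in> Basis" for b
    using Basis_le_norm[OF that, of x] assms by linarith
  then show ?thesis by (force simp: mem_box abs_le_iff)
qed

section \<open>The divergence theorem with a radial weight\<close>

text \<open>By translation invariance the integral of \<open>H (x + t e)\<close> does not depend on small \<open>t\<close>.\<close>

lemma integral_derivative_compact_support:
  fixes H :: "'a::euclidean_space \<Rightarrow> real"
  assumes H: "\<And>x. (H has_derivative H' x) (at x)" and c: "continuous_on UNIV (\<lambda>x. H' x e)"
    and z: "\<And>x. norm x \<ge> 2 \<Longrightarrow> H x = 0" and e: "norm e \<le> 1"
  shows "integral cube (\<lambda>x. H' x e) = 0"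
proof -
  let ?C = "cube :: 'a set"
  have cH: "continuous_on S H" for S
    by (intro continuous_at_imp_continuous_on ballI has_derivative_continuous[OF H])
  have const: "integral ?C (\<lambda>x. H (x + t *\<^sub>R e)) = integral ?C H" if t: "t \<in> {-1<..<1}" for t
  proof -
    have te: "norm (t *\<^sub>R e) \<le> 1" using t e by (auto simp: mult_le_one abs_le_iff)
    have out: "H x = 0" if "x \<notin> cbox (- corner + t *\<^sub>R e) (corner + t *\<^sub>R e)" for x
    proof (rule z, rule ccontr)
      assume "\<not> 2 \<le> norm x"
      then have "norm (x - t *\<^sub>R e) \<le> 3" using te norm_triangle_ineq4[of x "t *\<^sub>R e"] by linarith
      then have "x - t *\<^sub>R e \<in> ?C" by (rule in_corner_box)
      then have "x \<in> cbox (- corner + t *\<^sub>R e) (corner + t *\<^sub>R e)"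
        by (simp add: mem_box inner_diff_left inner_add_left algebra_simps)
      with that show False by simp
    qed
    have "(H has_integral integral ?C H) ?C"
      by (intro integrable_integral integrable_continuous cH)
    then have "(H has_integral integral ?C H) UNIV"
    proof (rule has_integral_on_superset)
      show "H x = 0" if "x \<notin> ?C" for x
      proof (rule z, rule ccontr)
        assume "\<not> 2 \<le> norm x"
        then show False using in_corner_box[of x] that by simp
      qed
    qed simp
    moreover have "(H has_integral integral (cbox (- corner + t *\<^sub>R e) (corner + t *\<^sub>R e)) H) (cbox (- corner + t *\<^sub>R e) (corner + t *\<^sub>R e))"
      by (intro integrable_integral integrable_continuous cH)
    then have "(H has_integral integral (cbox (- corner + t *\<^sub>R e) (corner + t *\<^sub>R e)) H) UNIV"
      by (rule has_integral_on_superset) (use out in auto)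
    ultimately have "integral ?C H = integral (cbox (- corner + t *\<^sub>R e) (corner + t *\<^sub>R e)) H"
      by (rule has_integral_unique)
    also have "\<dots> = integral ?C (H \<circ> ((+) (t *\<^sub>R e)))"
      by (rule integral_shift_cbox_plus[symmetric])
    finally show ?thesis by (simp add: o_def add.commute)
  qed
  have cH': "continuous_on UNIV (\<lambda>(t, x). H' (x + t *\<^sub>R e) e)"
    unfolding case_prod_unfold
    by (rule continuous_on_compose2[OF c]) (auto intro!: continuous_intros)
  have d1: "((\<lambda>t. integral ?C (\<lambda>x. H (x + t *\<^sub>R e))) has_field_derivative integral ?C (\<lambda>x. H' (x + 0 *\<^sub>R e) e)) (at 0 within {-1<..<1})"
  proof (rule leibniz_rule_field_derivative)
    fix t x
    have "((\<lambda>t. x + t *\<^sub>R e) has_derivative (\<lambda>h. h *\<^sub>R e)) (at t)" by (auto intro!: derivative_eq_intros)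
    from has_derivative_compose[OF this H]
    have "((\<lambda>t. H (x + t *\<^sub>R e)) has_derivative (\<lambda>h. H' (x + t *\<^sub>R e) (h *\<^sub>R e))) (at t)" .
    moreover have "H' (x + t *\<^sub>R e) (h *\<^sub>R e) = H' (x + t *\<^sub>R e) e * h" for h
      using linear_cmul[OF has_derivative_linear[OF H]] by simp
    ultimately show "((\<lambda>t. H (x + t *\<^sub>R e)) has_field_derivative H' (x + t *\<^sub>R e) e) (at t within {-1<..<1})"
      by (simp add: has_field_derivative_def has_derivative_at_withinI)
  next
    show "(\<lambda>x. H (x + t *\<^sub>R e)) integrable_on ?C" for t
      by (intro integrable_continuous continuous_on_compose2[OF cH[of UNIV]] continuous_intros) auto
    show "continuous_on ({-1<..<1} \<times> ?C) (\<lambda>(t, x). H' (x + t *\<^sub>R e) e)"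
      by (rule continuous_on_subset[OF cH']) simp
  qed auto
  have d2: "((\<lambda>t. integral ?C (\<lambda>x. H (x + t *\<^sub>R e))) has_field_derivative 0) (at 0 within {-1<..<1})"
    by (rule has_field_derivative_transform_within[where d=1 and f="\<lambda>_. integral ?C H"]) (use const in auto)
  have aw: "at 0 within {-1<..<1} = at (0::real)" by (rule at_within_open) auto
  from DERIV_unique[OF d1[unfolded aw] d2[unfolded aw]] show ?thesis by simp
qed

text \<open>In the divergence of B(|x|^2) Q the derivative of the weight appears only in 2 B' (x .
  Q), which vanishes for a tangential field. The weight thus behaves like a constant, and its
  compact support makes the integral of the divergence zero.\<close>

lemma integral_divergence_annulus:
  fixes Q :: "'a::euclidean_space \<Rightarrow> 'a \<Rightarrow> real" and Q' :: "'a \<Rightarrow> 'a \<Rightarrow> 'a \<Rightarrow> real"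
  assumes Q: "\<And>e x. e \<in> Basis \<Longrightarrow> x \<noteq> 0 \<Longrightarrow> (Q e has_derivative Q' e x) (at x)"
    and c: "\<And>e. e \<in> Basis \<Longrightarrow> continuous_on (- {0}) (\<lambda>x. Q' e x e)"
    and B: "\<And>s. (B has_field_derivative B' s) (at s)" "continuous_on UNIV B'"
    and z: "\<And>s. s \<le> 1 \<or> s \<ge> 4 \<Longrightarrow> B s = 0" "\<And>s. s \<le> 1 \<or> s \<ge> 4 \<Longrightarrow> B' s = 0"
    and rad: "\<And>x. x \<noteq> 0 \<Longrightarrow> (\<Sum>e\<in>Basis. (x \<bullet> e) * Q e x) = 0"
  shows "integral cube (\<lambda>x. B (x \<bullet> x) * (\<Sum>e\<in>Basis. Q' e x e)) = 0"
proof -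
  let ?C = "cube :: 'a set"
  define H where "H e x = B (x \<bullet> x) * Q e x" for e x
  \<comment> \<open>\<open>Q\<close> is controlled only off the origin. As \<open>B\<close> vanishes
    near it, \<open>H\<close> is zero on the unit ball, and 0 is the correct derivative
    there.\<close>
  define H' where "H' e x h = (if x = 0 then 0 else B (x \<bullet> x) * Q' e x h + (2 * (x \<bullet> h) * B' (x \<bullet> x)) * Q e x)" for e x h
  have HD: "(H e has_derivative H' e x) (at x)" if e: "e \<in> Basis" for e x
  proof (cases "x = 0")
    case True
    have H0: "H e y = 0" if "y \<in> ball 0 1" for y
    proof -
      have "y \<bullet> y \<le> 1" using that by (simp add: dot_square_norm power_le_one)
      then show ?thesis by (simp add: H_def z)
    qed
    have "(H e has_derivative (\<lambda>_. 0)) (at x)"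
      by (rule has_derivative_transform_within_open[OF has_derivative_const[of 0] open_ball[of 0 1]]) (use True H0 in auto)
    then show ?thesis using True by (simp add: H'_def[abs_def])
  next
    case False
    have "((\<lambda>x. x \<bullet> x) has_derivative (\<lambda>h. 2 * (x \<bullet> h))) (at x)"
      by (auto intro!: derivative_eq_intros simp: inner_commute)
    moreover have "(B has_derivative (\<lambda>h. B' (x \<bullet> x) * h)) (at (x \<bullet> x))"
      using B(1) by (simp add: has_field_derivative_def)
    ultimately have "((\<lambda>x. B (x \<bullet> x)) has_derivative (\<lambda>h. B' (x \<bullet> x) * (2 * (x \<bullet> h)))) (at x)"
      by (rule has_derivative_compose)
    from has_derivative_mult[OF this Q[OF e False]]
    show ?thesis unfolding H_def H'_def[abs_def] using False by (simp add: mult_ac)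
  qed
  have HC: "continuous_on UNIV (\<lambda>x. H' e x e)" if e: "e \<in> Basis" for e
  proof -
    have nz: "{p::'a. p \<noteq> 0} = - {0}" by auto
    have cQ: "continuous_on {p. p \<noteq> 0} (Q e)"
      by (intro continuous_at_imp_continuous_on ballI has_derivative_continuous[OF Q[OF e]]) simp
    have B0: "continuous_on UNIV B" using DERIV_isCont[OF B(1)] by (simp add: continuous_at_imp_continuous_on)
    have cB: "continuous_on UNIV (\<lambda>x::'a. B (x \<bullet> x))" "continuous_on UNIV (\<lambda>x::'a. B' (x \<bullet> x))"
      by (intro continuous_on_compose2[OF B0] continuous_on_compose2[OF B(2)] continuous_intros; simp)+
    have "continuous_on UNIV (\<lambda>x. B (x \<bullet> x) * Q' e x e)"
      by (rule continuous_on_vanishing_extension[where g="\<lambda>x. x"])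
         (use c[OF e] cB z in \<open>auto simp: nz\<close>)
    moreover have "continuous_on UNIV (\<lambda>x. (2 * (x \<bullet> e) * B' (x \<bullet> x)) * Q e x)"
      by (rule continuous_on_vanishing_extension[where g="\<lambda>x. x"])
         (use cQ cB z in \<open>auto intro!: continuous_intros\<close>)
    ultimately have "continuous_on UNIV (\<lambda>x. B (x \<bullet> x) * Q' e x e + (2 * (x \<bullet> e) * B' (x \<bullet> x)) * Q e x)"
      by (rule continuous_on_add)
    moreover have "B (x \<bullet> x) * Q' e x e + (2 * (x \<bullet> e) * B' (x \<bullet> x)) * Q e x = H' e x e" for x
      by (simp add: H'_def z)
    ultimately show ?thesis by simp
  qed
  have "integral ?C (\<lambda>x. \<Sum>e\<in>Basis. H' e x e) = (\<Sum>e\<in>Basis. integral ?C (\<lambda>x. H' e x e))"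
    by (intro integral_sum integrable_continuous continuous_on_subset[OF HC]) auto
  also have "\<dots> = 0"
  proof (rule sum.neutral, rule ballI)
    fix e :: 'a assume e: "e \<in> Basis"
    have "H e x = 0" if "norm x \<ge> 2" for x
    proof -
      have "2\<^sup>2 \<le> (norm x)\<^sup>2" using that by (intro power_mono) auto
      then show ?thesis by (simp add: H_def z dot_square_norm)
    qed
    from integral_derivative_compact_support[OF HD[OF e] HC[OF e] this]
    show "integral ?C (\<lambda>x. H' e x e) = 0" using e by simp
  qed
  also have "(\<lambda>x. \<Sum>e\<in>Basis. H' e x e) = (\<lambda>x. B (x \<bullet> x) * (\<Sum>e\<in>Basis. Q' e x e))"
  proof
    fix x :: 'a
    show "(\<Sum>e\<in>Basis. H' e x e) = B (x \<bullet> x) * (\<Sum>e\<in>Basis. Q' e x e)"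
    proof (cases "x = 0")
      case False
      have "(\<Sum>e\<in>Basis. H' e x e) = B (x \<bullet> x) * (\<Sum>e\<in>Basis. Q' e x e) + 2 * B' (x \<bullet> x) * (\<Sum>e\<in>Basis. (x \<bullet> e) * Q e x)"
        using False by (simp add: H'_def sum.distrib sum_distrib_left mult_ac)
      then show ?thesis by (simp add: rad[OF False])
    qed (simp add: H'_def z)
  qed
  finally show ?thesis .
qed

section \<open>Powers of linear functions on the sphere\<close>

text \<open>Linear functions on the unit sphere, extended to be constant along rays, with the junk value \<open>0\<close> at
  \<open>x = 0\<close>.\<close>

definition sph :: "'a::euclidean_space \<Rightarrow> 'a \<Rightarrow> real" where
  "sph w x = (x \<bullet> w) * inverse (norm x)"

definition sph' :: "'a::euclidean_space \<Rightarrow> 'a \<Rightarrow> 'a \<Rightarrow> real" where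
  "sph' w x h = (h \<bullet> w) * inverse (norm x) - (x \<bullet> w) * (x \<bullet> h) * inverse (norm x) ^ 3"

definition sph'' :: "'a::euclidean_space \<Rightarrow> 'a \<Rightarrow> 'a \<Rightarrow> 'a \<Rightarrow> real" where
  "sph'' w x e h = - ((e \<bullet> w) * (x \<bullet> h) + (h \<bullet> w) * (x \<bullet> e) + (x \<bullet> w) * (h \<bullet> e)) * inverse (norm x) ^ 3
     + 3 * (x \<bullet> w) * (x \<bullet> e) * (x \<bullet> h) * inverse (norm x) ^ 5"

lemma inverse_norm_deriv:
  fixes x :: "'a::euclidean_space"
  assumes "x \<noteq> 0"
  shows "((\<lambda>x. inverse (norm x)) has_derivative (\<lambda>h. - (x \<bullet> h) * inverse (norm x) ^ 3)) (at x)"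
proof -
  have "((\<lambda>x. inverse (norm x)) has_derivative (\<lambda>h. - (inverse (norm x) * (h \<bullet> sgn x) * inverse (norm x)))) (at x)"
    by (rule Deriv.has_derivative_inverse[OF _ has_derivative_eq_rhs[OF has_derivative_norm]])
       (use assms in \<open>auto simp: inner_commute\<close>)
  then show ?thesis
    by (rule has_derivative_eq_rhs) (auto simp: sgn_div_norm power3_eq_cube inner_commute fun_eq_iff)
qed

lemma sph_deriv: "x \<noteq> 0 \<Longrightarrow> (sph w has_derivative sph' w x) (at x)"
  unfolding sph_def[abs_def] sph'_def[abs_def]
  by (rule has_derivative_eq_rhs[OF has_derivative_mult[OF has_derivative_inner_left[OF has_derivative_ident] inverse_norm_deriv]])
     (auto simp: fun_eq_iff algebra_simps)

lemma sph'_deriv: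
  fixes x :: "'a::euclidean_space"
  assumes "x \<noteq> 0"
  shows "((\<lambda>x. sph' w x e) has_derivative sph'' w x e) (at x)"
proof -
  note I = inverse_norm_deriv[OF assms]
  have 1: "((\<lambda>x. (e \<bullet> w) * inverse (norm x)) has_derivative (\<lambda>h. (e \<bullet> w) * (- (x \<bullet> h) * inverse (norm x) ^ 3))) (at x)"
    by (rule has_derivative_mult_right[OF I])
  have 2: "((\<lambda>x. inverse (norm x) ^ 3) has_derivative (\<lambda>h. 3 * (- (x \<bullet> h) * inverse (norm x) ^ 3) * inverse (norm x) ^ 2)) (at x)"
    by (rule has_derivative_eq_rhs[OF has_derivative_power[OF I]]) (simp add: mult_ac)
  have 3: "((\<lambda>x. (x \<bullet> w) * (x \<bullet> e)) has_derivative (\<lambda>h. (x \<bullet> w) * (h \<bullet> e) + (h \<bullet> w) * (x \<bullet> e))) (at x)"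
    by (intro has_derivative_mult has_derivative_inner_left has_derivative_ident)
  have p: "a ^ 3 * a ^ 2 = a ^ 5" for a :: real by (simp flip: power_add)
  show ?thesis
    unfolding sph'_def sph''_def[abs_def]
  proof (rule has_derivative_eq_rhs[OF has_derivative_diff[OF 1 has_derivative_mult[OF 3 2]]], rule ext)
    fix h
    show "(e \<bullet> w) * (- (x \<bullet> h) * inverse (norm x) ^ 3)
      - ((x \<bullet> w) * (x \<bullet> e) * (3 * (- (x \<bullet> h) * inverse (norm x) ^ 3) * inverse (norm x) ^ 2)
        + ((x \<bullet> w) * (h \<bullet> e) + (h \<bullet> w) * (x \<bullet> e)) * inverse (norm x) ^ 3)
      = - ((e \<bullet> w) * (x \<bullet> h) + (h \<bullet> w) * (x \<bullet> e) + (x \<bullet> w) * (h \<bullet> e)) * inverse (norm x) ^ 3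
     + 3 * (x \<bullet> w) * (x \<bullet> e) * (x \<bullet> h) * inverse (norm x) ^ 5"
      unfolding p[symmetric] by (simp add: algebra_simps)
  qed
qed

lemma sum_Basis_inner: "(\<Sum>e\<in>Basis. (x \<bullet> e) * (y \<bullet> e)) = x \<bullet> (y::'a::euclidean_space)"
  by (rule euclidean_inner[symmetric])

text \<open>For a linear function s on the unit sphere these are the classical facts that its
  gradient has squared length |w|^2 - s^2 and that it is an eigenfunction with eigenvalue k, where k
  + 1 is the dimension. The factor x . x compensates the degree -2 of the flat expressions.\<close>

lemma sph_sums:
  fixes x w :: "'a::euclidean_space"
  assumes "x \<noteq> 0"
  shows "(\<Sum>e\<in>Basis. (x \<bullet> e) * sph' w x e) = 0"
    and "(x \<bullet> x) * (\<Sum>e\<in>Basis. sph' w x e * sph' w x e) = w \<bullet> w - (sph w x)\<^sup>2"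
    and "(x \<bullet> x) * (\<Sum>e\<in>Basis. sph'' w x e e) = - (real DIM('a) - 1) * sph w x"
proof -
  define r where "r = inverse (norm x)"
  \<comment> \<open>This relation eliminates the norm, so that \<open>algebra\<close> can close the
    three identities.\<close>
  have r: "(x \<bullet> x) * r\<^sup>2 = 1" using assms by (simp add: r_def power_inverse dot_square_norm)
  have "(\<Sum>e\<in>Basis. (x \<bullet> e) * sph' w x e) = r * (\<Sum>e\<in>Basis. (x \<bullet> e) * (w \<bullet> e)) - (x \<bullet> w) * r ^ 3 * (\<Sum>e\<in>Basis. (x \<bullet> e) * (x \<bullet> e))"
    by (simp add: sph'_def r_def sum_distrib_left sum_subtractf[symmetric] algebra_simps inner_commute[of w])
  then show "(\<Sum>e\<in>Basis. (x \<bullet> e) * sph' w x e) = 0"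
    unfolding sum_Basis_inner using r by algebra
  have "(\<Sum>e\<in>Basis. sph' w x e * sph' w x e) = (\<Sum>e\<in>Basis. r\<^sup>2 * ((w \<bullet> e) * (w \<bullet> e)) - 2 * (x \<bullet> w) * r ^ 4 * ((x \<bullet> e) * (w \<bullet> e)) + (x \<bullet> w)\<^sup>2 * r ^ 6 * ((x \<bullet> e) * (x \<bullet> e)))"
    unfolding sph'_def r_def[symmetric] inner_commute[of _ w] by (intro sum.cong refl) algebra
  also have "\<dots> = r\<^sup>2 * (w \<bullet> w) - 2 * (x \<bullet> w) * r ^ 4 * (x \<bullet> w) + (x \<bullet> w)\<^sup>2 * r ^ 6 * (x \<bullet> x)"
    by (simp only: sum.distrib sum_subtractf sum_distrib_left[symmetric] sum_Basis_inner)
  finally show "(x \<bullet> x) * (\<Sum>e\<in>Basis. sph' w x e * sph' w x e) = w \<bullet> w - (sph w x)\<^sup>2"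
    unfolding sph_def r_def[symmetric] using r by algebra
  have "(\<Sum>e\<in>Basis. sph'' w x e e) = (\<Sum>e\<in>Basis. - 2 * r ^ 3 * ((x \<bullet> e) * (w \<bullet> e)) - (x \<bullet> w) * r ^ 3 + 3 * (x \<bullet> w) * r ^ 5 * ((x \<bullet> e) * (x \<bullet> e)))"
    unfolding sph''_def r_def[symmetric] by (intro sum.cong refl) (simp add: algebra_simps inner_commute[of w])
  also have "\<dots> = - 2 * r ^ 3 * (x \<bullet> w) - real DIM('a) * ((x \<bullet> w) * r ^ 3) + 3 * (x \<bullet> w) * r ^ 5 * (x \<bullet> x)"
    by (simp only: sum.distrib sum_subtractf sum_distrib_left[symmetric] sum_Basis_inner sum_constant) (simp add: mult_ac)
  finally show "(x \<bullet> x) * (\<Sum>e\<in>Basis. sph'' w x e e) = - (real DIM('a) - 1) * sph w x"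
    unfolding sph_def r_def[symmetric] using r by algebra
qed

lemma continuous_on_sph [continuous_intros]:
  assumes "continuous_on S g" "\<And>x. x \<in> S \<Longrightarrow> g x \<noteq> 0"
  shows "continuous_on S (\<lambda>x. sph w (g x))"
  unfolding sph_def using assms by (intro continuous_intros) auto

abbreviation off_axis :: "('a::euclidean_space coords) set" where
  "off_axis \<equiv> (- {0}) \<times> UNIV \<times> UNIV"

lemma open_off_axis: "open off_axis"
  by (intro open_Times) auto

lemma slice_deriv:
  fixes G :: "'a::euclidean_space coords \<Rightarrow> real"
  assumes G: "smooth_on_open off_axis G" and x: "x \<noteq> 0"
  shows "((\<lambda>x. G (x, u, v)) has_derivative (\<lambda>h. Dy h G (x, u, v))) (at x)"
    and "((\<lambda>u. G (x, u, v)) has_field_derivative Du G (x, u, v)) (at u)"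
    and "((\<lambda>v. G (x, u, v)) has_field_derivative Dv G (x, u, v)) (at v)"
proof -
  have D: "(G has_derivative frechet_derivative G (at (x, u, v))) (at (x, u, v))"
    by (rule smooth_on_openD(1)[OF G open_off_axis]) (use x in simp)
  note lin = linear_cmul[OF has_derivative_linear[OF D]]
  have "((\<lambda>x. (x, u, v)) has_derivative (\<lambda>h. (h, 0, 0))) (at x)"
    by (intro has_derivative_Pair has_derivative_ident has_derivative_const)
  from has_derivative_compose[OF this D]
  show "((\<lambda>x. G (x, u, v)) has_derivative (\<lambda>h. Dy h G (x, u, v))) (at x)" .
  have "((\<lambda>u. (x, u, v)) has_derivative (\<lambda>h. (0, h, 0))) (at u)"
    by (intro has_derivative_Pair has_derivative_ident has_derivative_const)
  note C = has_derivative_compose[OF this D]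
  show "((\<lambda>u. G (x, u, v)) has_field_derivative Du G (x, u, v)) (at u)"
    unfolding has_field_derivative_def
  proof (rule has_derivative_eq_rhs[OF C], rule ext)
    fix h show "frechet_derivative G (at (x, u, v)) (0, h, 0) = Du G (x, u, v) * h"
      using lin[of h "(0, 1, 0)"] by (simp add: mult.commute)
  qed
  have "((\<lambda>v. (x, u, v)) has_derivative (\<lambda>h. (0, 0, h))) (at v)"
    by (intro has_derivative_Pair has_derivative_ident has_derivative_const)
  note C = has_derivative_compose[OF this D]
  show "((\<lambda>v. G (x, u, v)) has_field_derivative Dv G (x, u, v)) (at v)"
    unfolding has_field_derivative_def
  proof (rule has_derivative_eq_rhs[OF C], rule ext)
    fix h show "frechet_derivative G (at (x, u, v)) (0, 0, h) = Dv G (x, u, v) * h"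
      using lin[of h "(0, 0, 1)"] by (simp add: mult.commute)
  qed
qed

lemma continuous_on_slice:
  fixes G :: "'a::euclidean_space coords \<Rightarrow> real"
  assumes G: "smooth_on_open off_axis G" and "continuous_on S a" "continuous_on S b" "continuous_on S c"
    and "\<And>p. p \<in> S \<Longrightarrow> a p \<noteq> 0"
  shows "continuous_on S (\<lambda>p. G (a p, b p, c p))"
  by (rule continuous_on_compose2[OF smooth_on_openD(3)[OF G open_off_axis]])
     (use assms in \<open>auto intro!: continuous_intros\<close>)

text \<open>Green's identity for F and s^m: the field s^m grad F - F grad s^m is tangential because
  neither function has a radial derivative. The Laplacian of s^m consists of m (m - 1) s^(m-2) |grad
  s|^2 and of m s^(m-1) times the Laplacian of s.\<close>

lemma spherical_integration_by_parts:
  fixes F :: "'a::euclidean_space coords \<Rightarrow> real"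
  assumes F: "smooth_on_open off_axis F"
    and hom: "\<And>x. x \<noteq> 0 \<Longrightarrow> Dy x F (x, u, v) = 0"
  shows "integral cube (\<lambda>x. bump (x \<bullet> x) * ((x \<bullet> x) * lap_y F (x, u, v) * sph w x ^ m))
     = integral cube (\<lambda>x. bump (x \<bullet> x) * (F (x, u, v) *
         (real m * (real m - 1) * (w \<bullet> w) * sph w x ^ (m - 2) - real m * (real m + real DIM('a) - 2) * sph w x ^ m)))"
proof -
  let ?C = "cube :: 'a set"
  \<comment> \<open>The extra factor \<open>s\<close> supplies the x . x in front of the flat
    Laplacian, which has degree -2 on functions constant along rays.\<close>
  define B where "B s = s * bump s" for s
  define B' where "B' s = bump s + s * bump' s" for s
  define F1 where "F1 e = (Dy e F)" for e
  define F2 where "F2 e h x = frechet_derivative (F1 e) (at (x, u, v)) (h, 0, 0)" for e h x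
  have F1: "smooth_on_open off_axis (F1 e)" for e
    unfolding F1_def by (rule smooth_on_openD(2)[OF F open_off_axis])
  define P' where "P' e x = real m * sph w x ^ (m - 1) * sph' w x e" for e x
  define P'' where "P'' e h x = real m * (real (m - 1) * sph w x ^ (m - 2) * sph' w x h) * sph' w x e
      + real m * sph w x ^ (m - 1) * sph'' w x e h" for e h x
  define Q where "Q e x = sph w x ^ m * F1 e (x, u, v) - F (x, u, v) * P' e x" for e x
  define Q' where "Q' e x h = (sph w x ^ m * F2 e h x + P' h x * F1 e (x, u, v))
      - (F (x, u, v) * P'' e h x + Dy h F (x, u, v) * P' e x)" for e x h
  have QD: "(Q e has_derivative Q' e x) (at x)" if "x \<noteq> 0" for e x
  proof -
    have 1: "((\<lambda>x. sph w x ^ m) has_derivative (\<lambda>h. P' h x)) (at x)"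
      by (rule has_derivative_eq_rhs[OF has_derivative_power[OF sph_deriv[OF that]]]) (simp add: P'_def mult_ac fun_eq_iff)
    have 2: "((\<lambda>x. sph w x ^ (m - 1)) has_derivative (\<lambda>h. real (m - 1) * sph w x ^ (m - 2) * sph' w x h)) (at x)"
      by (rule has_derivative_eq_rhs[OF has_derivative_power[OF sph_deriv[OF that]]]) (simp add: mult_ac fun_eq_iff numeral_2_eq_2)
    have 3: "((\<lambda>x. P' e x) has_derivative (\<lambda>h. P'' e h x)) (at x)"
      unfolding P'_def P''_def
      by (rule has_derivative_eq_rhs[OF has_derivative_mult[OF has_derivative_mult_right[OF 2] sph'_deriv[OF that]]])
         (simp add: fun_eq_iff algebra_simps)
    show ?thesis
      unfolding Q_def Q'_def[abs_def] F2_def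
      by (rule has_derivative_diff[OF has_derivative_mult[OF 1 slice_deriv(1)[OF F1 that]] has_derivative_mult[OF slice_deriv(1)[OF F that] 3]])
  qed
  \<comment> \<open>In the diagonal direction the two products of first derivatives cancel.\<close>
  have Qe: "Q' e x e = sph w x ^ m * F2 e e x - F (x, u, v) * P'' e e x" for e x
    by (simp add: Q'_def F1_def mult.commute)
  have c0: "continuous_on (- {0}) (\<lambda>x. sph w x)" by (intro continuous_intros) auto
  have cQ: "continuous_on (- {0}) (\<lambda>x. Q' e x e)" for e
  proof -
    have "continuous_on (- {0}) (\<lambda>x. F2 e e x)" "continuous_on (- {0}) (\<lambda>x. F (x, u, v))"
      unfolding F2_def
      by (rule continuous_on_slice[OF smooth_on_openD(2)[OF F1 open_off_axis]] continuous_on_slice[OF F]; auto intro!: continuous_intros)+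
    moreover have "continuous_on (- {0}) (\<lambda>x. sph' w x e)" "continuous_on (- {0}) (\<lambda>x. sph'' w x e e)"
      unfolding sph'_def sph''_def by (auto intro!: continuous_intros)
    ultimately show ?thesis
      unfolding Qe P''_def using c0 by (intro continuous_intros) auto
  qed
  have rad: "(\<Sum>e\<in>Basis. (x \<bullet> e) * Q e x) = 0" if x: "x \<noteq> 0" for x
  proof -
    have "Dy x F (x, u, v) = gradv F (x, u, v) \<bullet> x"
      using frechet_split[OF smooth_on_openD(1)[OF F open_off_axis], of "(x, u, v)" x 0 0] x by simp
    then have g: "(\<Sum>e\<in>Basis. (x \<bullet> e) * F1 e (x, u, v)) = 0"
      using hom[OF x] by (simp add: gradv_def inner_sum_left F1_def inner_commute[of x] mult.commute)
    have "(\<Sum>e\<in>Basis. (x \<bullet> e) * Q e x) = sph w x ^ m * (\<Sum>e\<in>Basis. (x \<bullet> e) * F1 e (x, u, v))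
       - F (x, u, v) * real m * sph w x ^ (m - 1) * (\<Sum>e\<in>Basis. (x \<bullet> e) * sph' w x e)"
      by (simp add: Q_def P'_def sum_distrib_left sum_subtractf[symmetric] algebra_simps)
    then show ?thesis using g sph_sums(1)[OF x] by simp
  qed
  have I0: "integral ?C (\<lambda>x. B (x \<bullet> x) * (\<Sum>e\<in>Basis. Q' e x e)) = 0"
  proof (rule integral_divergence_annulus[where B=B and B'=B' and Q=Q and Q'=Q'])
    show "(B has_field_derivative B' s) (at s)" for s
      unfolding B_def B'_def using DERIV_mult[OF DERIV_ident bump_deriv] by (simp add: add.commute mult.commute)
    show "continuous_on UNIV B'" unfolding B'_def by (intro continuous_intros)
    show "B s = 0" "B' s = 0" if "s \<le> 1 \<or> 4 \<le> s" for s
      using that by (auto simp: B_def B'_def bump_eq_0 bump'_eq_0)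
  qed (use QD cQ rad in auto)
  define R where "R x = real m * (real m - 1) * (w \<bullet> w) * sph w x ^ (m - 2) - real m * (real m + real DIM('a) - 2) * sph w x ^ m" for x
  have eq: "B (x \<bullet> x) * (\<Sum>e\<in>Basis. Q' e x e) = bump (x \<bullet> x) * ((x \<bullet> x) * lap_y F (x, u, v) * sph w x ^ m) - bump (x \<bullet> x) * (F (x, u, v) * R x)" for x
  proof (cases "x = 0")
    case True
    then show ?thesis by (simp add: B_def bump_eq_0)
  next
    case False
    have "(\<Sum>e\<in>Basis. P'' e e x) = real m * real (m - 1) * sph w x ^ (m - 2) * (\<Sum>e\<in>Basis. sph' w x e * sph' w x e)
       + real m * sph w x ^ (m - 1) * (\<Sum>e\<in>Basis. sph'' w x e e)"
      by (simp add: P''_def sum.distrib sum_distrib_left sum_distrib_right mult_ac)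
    then have "(x \<bullet> x) * (\<Sum>e\<in>Basis. P'' e e x) = real m * real (m - 1) * sph w x ^ (m - 2) * ((x \<bullet> x) * (\<Sum>e\<in>Basis. sph' w x e * sph' w x e))
       + real m * sph w x ^ (m - 1) * ((x \<bullet> x) * (\<Sum>e\<in>Basis. sph'' w x e e))"
      by (simp add: algebra_simps)
    also have "\<dots> = real m * real (m - 1) * sph w x ^ (m - 2) * (w \<bullet> w - (sph w x)\<^sup>2) - real m * sph w x ^ (m - 1) * ((real DIM('a) - 1) * sph w x)"
      unfolding sph_sums(2,3)[OF False] by (simp add: algebra_simps)
    also have "\<dots> = R x"
    proof -
      \<comment> \<open>Natural subtraction: wherever an exponent m - 1 or m - 2 is truncated, its
        coefficient is zero.\<close>
      consider "m = 0" | "m = 1" | i where "m = Suc (Suc i)" by (metis One_nat_def not0_implies_Suc)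
      then show ?thesis
        by cases (simp_all add: R_def algebra_simps power2_eq_square)
    qed
    finally have PR: "(x \<bullet> x) * (\<Sum>e\<in>Basis. P'' e e x) = R x" .
    have QS: "(\<Sum>e\<in>Basis. Q' e x e) = sph w x ^ m * lap_y F (x, u, v) - F (x, u, v) * (\<Sum>e\<in>Basis. P'' e e x)"
      unfolding Qe sum_subtractf lap_y_def F2_def F1_def sum_distrib_left ..
    have "B (x \<bullet> x) * (\<Sum>e\<in>Basis. Q' e x e) = bump (x \<bullet> x) * ((x \<bullet> x) * lap_y F (x, u, v) * sph w x ^ m) - bump (x \<bullet> x) * (F (x, u, v) * ((x \<bullet> x) * (\<Sum>e\<in>Basis. P'' e e x)))"
      unfolding QS by (simp add: B_def algebra_simps)
    then show ?thesis unfolding PR .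
  qed
  have nz: "{p::'a. p \<noteq> 0} = - {0}" by auto
  have ic: "(\<lambda>x. bump (x \<bullet> x) * Q x) integrable_on ?C" if "continuous_on (- {0}) Q" for Q
    by (intro integrable_continuous continuous_on_subset[OF continuous_on_vanishing_extension[where g="\<lambda>x. x"]])
       (use that in \<open>auto simp: nz bump_eq_0 intro!: continuous_intros\<close>)
  have cl: "continuous_on (- {0}) (\<lambda>x. lap_y F (x, u, v))"
    unfolding lap_y_def F1_def[symmetric]
    by (intro continuous_on_sum continuous_on_slice[OF smooth_on_openD(2)[OF F1 open_off_axis]] continuous_intros) auto
  have "integral ?C (\<lambda>x. bump (x \<bullet> x) * ((x \<bullet> x) * lap_y F (x, u, v) * sph w x ^ m)) - integral ?C (\<lambda>x. bump (x \<bullet> x) * (F (x, u, v) * R x)) = 0"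
    using I0 unfolding eq
    by (subst (asm) integral_diff)
       (auto intro!: ic continuous_intros cl continuous_on_slice[OF F] simp: R_def)
  then show ?thesis unfolding R_def by simp
qed

abbreviation cyl :: "('a::euclidean_space \<times> real) set" where "cyl \<equiv> cbox (- corner, 0) (corner, 2 * pi)"

section \<open>Moments\<close>

text \<open>In polar coordinates, an integrand constant along rays yields a positive constant times
  its integral over the sphere and one period in v.\<close>

definition weighted_integral :: "('a::euclidean_space \<times> real \<Rightarrow> real) \<Rightarrow> real" where
  "weighted_integral Q = integral cyl (\<lambda>p. bump (fst p \<bullet> fst p) * Q p)"

lemma continuous_on_weighted:
  fixes Q :: "'a::euclidean_space \<times> real \<Rightarrow> real"
  assumes "continuous_on {p. fst p \<noteq> 0} Q"
  shows "continuous_on S (\<lambda>p. bump (fst p \<bullet> fst p) * Q p)"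
  by (rule continuous_on_subset[OF continuous_on_vanishing_extension[where g=fst]])
     (use assms in \<open>auto intro!: continuous_intros simp: bump_eq_0\<close>)

lemma weighted_integral_add:
  assumes "continuous_on {p. fst p \<noteq> 0} Q" "continuous_on {p. fst p \<noteq> 0} R"
  shows "weighted_integral (\<lambda>p. Q p + R p) = weighted_integral Q + weighted_integral R"
  unfolding weighted_integral_def distrib_left
  by (intro integral_add integrable_continuous continuous_on_weighted assms)

lemma weighted_integral_cmult:
  "weighted_integral (\<lambda>p. c * Q p) = c * weighted_integral Q"
proof -
  have "(\<lambda>p. bump (fst p \<bullet> fst p) * (c * Q p)) = (\<lambda>p. c * (bump (fst p \<bullet> fst p) * Q p))"
    by (simp add: fun_eq_iff mult_ac)
  then show ?thesis unfolding weighted_integral_def by simp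
qed

lemma weighted_integral_cong:
  assumes "\<And>x v. x \<noteq> 0 \<Longrightarrow> Q (x, v) = R (x, v)"
  shows "weighted_integral Q = weighted_integral R"
  unfolding weighted_integral_def
proof (rule integral_cong)
  fix p :: "'a \<times> real"
  show "bump (fst p \<bullet> fst p) * Q p = bump (fst p \<bullet> fst p) * R p"
    by (cases p, cases "fst p = 0") (auto simp: bump_eq_0 assms)
qed

lemma weighted_integral_sum:
  assumes "\<And>i. i \<in> I \<Longrightarrow> continuous_on {p. fst p \<noteq> 0} (Q i)"
  shows "weighted_integral (\<lambda>p. \<Sum>i\<in>I. Q i p) = (\<Sum>i\<in>I. weighted_integral (Q i))"
  using assms
proof (induction I rule: infinite_finite_induct)
  case (insert i I)
  have "weighted_integral (\<lambda>p. Q i p + (\<Sum>i\<in>I. Q i p)) = weighted_integral (Q i) + weighted_integral (\<lambda>p. \<Sum>i\<in>I. Q i p)"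
    by (intro weighted_integral_add continuous_on_sum insert.prems) auto
  then show ?case using insert by simp
qed (simp_all add: weighted_integral_def)

text \<open>The two orders serve the two integrations by parts: the first has the integral over v
  inside, the second the integral over x.\<close>

lemma weighted_integral_iterated:
  fixes Q :: "'a::euclidean_space \<times> real \<Rightarrow> real"
  assumes "continuous_on {p. fst p \<noteq> 0} Q"
  shows "weighted_integral Q = integral cube (\<lambda>x. bump (x \<bullet> x) * integral {0..2 * pi} (\<lambda>v. Q (x, v)))"
    and "weighted_integral Q = integral {0..2 * pi} (\<lambda>v. integral cube (\<lambda>x. bump (x \<bullet> x) * Q (x, v)))"
proof -
  note c = continuous_on_weighted[OF assms, of "cyl"]
  show 1: "weighted_integral Q = integral cube (\<lambda>x. bump (x \<bullet> x) * integral {0..2 * pi} (\<lambda>v. Q (x, v)))"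
    unfolding weighted_integral_def by (subst integral_prod_continuous[OF c]) simp
  have "continuous_on cyl (\<lambda>(x, v). bump (x \<bullet> x) * Q (x, v))"
    using c by (simp add: case_prod_unfold)
  from integral_swap_continuous[OF this]
  show "weighted_integral Q = integral {0..2 * pi} (\<lambda>v. integral cube (\<lambda>x. bump (x \<bullet> x) * Q (x, v)))"
    unfolding 1 by simp
qed

definition tst :: "nat \<Rightarrow> nat \<Rightarrow> 'a::euclidean_space \<Rightarrow> complex \<Rightarrow> 'a \<times> real \<Rightarrow> real" where
  "tst m j w z p = sph w (fst p) ^ m * (cis (snd p) \<bullet> z) ^ j"

definition moment :: "('a::euclidean_space coords \<Rightarrow> real) \<Rightarrow> nat \<Rightarrow> nat \<Rightarrow> 'a \<Rightarrow> complex \<Rightarrow> real \<Rightarrow> real" where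
  "moment F m j w z u = weighted_integral (\<lambda>p. F (fst p, u, snd p) * tst m j w z p)"

lemma cis_inner: "cis v \<bullet> z = cos v * Re z + sin v * Im z"
  by (simp add: inner_complex_def)

lemma continuous_on_tst:
  fixes a :: "'b::t2_space \<Rightarrow> 'a::euclidean_space"
  assumes "continuous_on S a" "continuous_on S b" "\<And>p. p \<in> S \<Longrightarrow> a p \<noteq> 0"
  shows "continuous_on S (\<lambda>p. tst m j w z (a p, b p))"
  unfolding tst_def cis_inner using assms by (auto intro!: continuous_intros)

lemma continuous_on_moment_integrand:
  fixes F :: "'a::euclidean_space coords \<Rightarrow> real"
  assumes "smooth_on_open off_axis F"
  shows "continuous_on {p. fst p \<noteq> 0} (\<lambda>p. F (fst p, u, snd p) * tst m j w z p)"
proof -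
  have "continuous_on {p. fst p \<noteq> 0} (\<lambda>p. F (fst p, u, snd p) * tst m j w z (fst p, snd p))"
    by (intro continuous_on_mult continuous_on_slice[OF assms] continuous_on_tst continuous_intros) auto
  then show ?thesis by simp
qed

lemma moment_deriv:
  fixes F :: "'a::euclidean_space coords \<Rightarrow> real"
  assumes F: "smooth_on_open off_axis F"
  shows "(moment F m j w z has_field_derivative moment (Du F) m j w z u) (at u)"
proof -
  note F' = smooth_on_openD(2)[OF F open_off_axis, of "(0, 1, 0)"]
  have "((\<lambda>u. integral cyl (\<lambda>p. bump (fst p \<bullet> fst p) * (F (fst p, u, snd p) * tst m j w z p)))
      has_field_derivative integral cyl (\<lambda>p. bump (fst p \<bullet> fst p) * (Du F (fst p, u, snd p) * tst m j w z p))) (at u within UNIV)"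
  proof (rule leibniz_rule_field_derivative)
    fix u :: real and p :: "'a \<times> real"
    show "((\<lambda>u. bump (fst p \<bullet> fst p) * (F (fst p, u, snd p) * tst m j w z p)) has_field_derivative
        bump (fst p \<bullet> fst p) * (Du F (fst p, u, snd p) * tst m j w z p)) (at u within UNIV)"
    proof (cases "fst p = 0")
      case False
      show ?thesis by (rule DERIV_cmult DERIV_cmult_right slice_deriv(2)[OF F False])+
    qed (simp add: bump_eq_0)
  next
    fix u :: real
    show "(\<lambda>p. bump (fst p \<bullet> fst p) * (F (fst p, u, snd p) * tst m j w z p)) integrable_on cyl"
      by (intro integrable_continuous continuous_on_weighted continuous_on_moment_integrand F)
  next
    have "continuous_on UNIV (\<lambda>q::real \<times> 'a \<times> real. bump (fst (snd q) \<bullet> fst (snd q)) * (Du F (fst (snd q), fst q, snd (snd q)) * tst m j w z (fst (snd q), snd (snd q))))"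
    proof (rule continuous_on_vanishing_extension[where g="\<lambda>q. fst (snd q)"])
      show "continuous_on {q::real \<times> 'a \<times> real. fst (snd q) \<noteq> 0} (\<lambda>q. Du F (fst (snd q), fst q, snd (snd q)) * tst m j w z (fst (snd q), snd (snd q)))"
        by (intro continuous_on_mult continuous_on_slice[OF F'] continuous_on_tst continuous_intros) auto
    qed (auto intro!: continuous_intros simp: bump_eq_0)
    then show "continuous_on (UNIV \<times> cyl) (\<lambda>(u, p). bump (fst p \<bullet> fst p) * (Du F (fst p, u, snd p) * tst m j w z p))"
      using continuous_on_subset[OF _ subset_UNIV] by (simp add: case_prod_unfold)
  qed auto
  then show ?thesis
    unfolding moment_def[abs_def] weighted_integral_def by simp
qed

text \<open>The derivative of a moment is the moment of \<open>Du F\<close>, which is again smooth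
  off the axis. Scalar multiples belong to the family in order to absorb the direction of
  differentiation.\<close>

lemma smooth_moment:
  fixes F :: "'a::euclidean_space coords \<Rightarrow> real"
  assumes F: "smooth_on_open off_axis F"
  shows "smooth_on_open UNIV (moment F m j w z)"
proof (rule smooth_on_open_field_derivI[where P="\<lambda>\<eta>. \<exists>c (G :: 'a coords \<Rightarrow> real). smooth_on_open off_axis G \<and> \<eta> = (\<lambda>u. c * moment G m j w z u)"])
  have "moment F m j w z = (\<lambda>u. 1 * moment F m j w z u)" by simp
  with F show "\<exists>c (G :: 'a coords \<Rightarrow> real). smooth_on_open off_axis G \<and> moment F m j w z = (\<lambda>u. c * moment G m j w z u)" by blast
next
  fix \<eta> assume "\<exists>c (G :: 'a coords \<Rightarrow> real). smooth_on_open off_axis G \<and> \<eta> = (\<lambda>u. c * moment G m j w z u)"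
  then obtain c and G :: "'a coords \<Rightarrow> real" where G: "smooth_on_open off_axis G" and \<eta>: "\<eta> = (\<lambda>u. c * moment G m j w z u)" by blast
  show "\<exists>\<eta>'. (\<forall>u\<in>UNIV. (\<eta> has_field_derivative \<eta>' u) (at u)) \<and>
      (\<forall>X. \<exists>c (G :: 'a coords \<Rightarrow> real). smooth_on_open off_axis G \<and> (\<lambda>u. \<eta>' u * X) = (\<lambda>u. c * moment G m j w z u))"
  proof (intro exI[of _ "\<lambda>u. c * moment (Du G) m j w z u"] conjI ballI allI)
    show "(\<eta> has_field_derivative c * moment (Du G) m j w z u) (at u)" for u
      unfolding \<eta> by (rule DERIV_cmult[OF moment_deriv[OF G]])
    fix X
    show "\<exists>c' (G' :: 'a coords \<Rightarrow> real). smooth_on_open off_axis G' \<and> (\<lambda>u. c * moment (Du G) m j w z u * X) = (\<lambda>u. c' * moment G' m j w z u)"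
      by (rule exI[of _ "c * X"], rule exI[of _ "Du G"])
         (use smooth_on_openD(2)[OF G open_off_axis] in \<open>auto simp: mult_ac\<close>)
  qed
qed simp

text \<open>In dimension k + 1 the second coefficient is \<open>\<alpha> k m\<close>. The truncated
  index m - 2 does no harm, since its coefficient vanishes for m < 2.\<close>

lemma moment_lap_y:
  fixes F :: "'a::euclidean_space coords \<Rightarrow> real"
  assumes F: "smooth_on_open off_axis F"
    and hom: "\<And>x v. x \<noteq> 0 \<Longrightarrow> Dy x F (x, u, v) = 0"
  shows "weighted_integral (\<lambda>p. ((fst p \<bullet> fst p) * lap_y F (fst p, u, snd p)) * tst m j w z p)
     = real m * (real m - 1) * (w \<bullet> w) * moment F (m - 2) j w z u - real m * (real m + real DIM('a) - 2) * moment F m j w z u"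
proof -
  have cl: "continuous_on {p :: 'a \<times> real. fst p \<noteq> 0} (\<lambda>p. lap_y F (fst p, u, snd p))"
    unfolding lap_y_def
  proof (rule continuous_on_sum)
    fix e :: 'a
    note S = smooth_on_openD(2)[OF smooth_on_openD(2)[OF F open_off_axis, of "(e, 0, 0)"] open_off_axis, of "(e, 0, 0)"]
    show "continuous_on {p :: 'a \<times> real. fst p \<noteq> 0} (\<lambda>p. Dy e (Dy e F) (fst p, u, snd p))"
      by (rule continuous_on_slice[OF S]) (auto intro!: continuous_intros)
  qed
  have ct: "continuous_on {p :: 'a \<times> real. fst p \<noteq> 0} (tst m j w z)" for m
    using continuous_on_tst[of "{p. fst p \<noteq> 0}" fst snd m j w z, OF continuous_on_fst[OF continuous_on_id] continuous_on_snd[OF continuous_on_id]]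
    by simp
  have c1: "continuous_on {p :: 'a \<times> real. fst p \<noteq> 0} (\<lambda>p. ((fst p \<bullet> fst p) * lap_y F (fst p, u, snd p)) * tst m j w z p)"
    by (intro continuous_on_mult cl ct continuous_intros)
  let ?R = "\<lambda>p. real m * (real m - 1) * (w \<bullet> w) * (F (fst p, u, snd p) * tst (m - 2) j w z p) + - (real m * (real m + real DIM('a) - 2)) * (F (fst p, u, snd p) * tst m j w z p)"
  have c2: "continuous_on {p :: 'a \<times> real. fst p \<noteq> 0} ?R"
    by (intro continuous_on_add continuous_on_mult_left continuous_on_moment_integrand F)
  have "integral cube (\<lambda>x. bump (x \<bullet> x) * (((x \<bullet> x) * lap_y F (x, u, v)) * tst m j w z (x, v)))
     = integral cube (\<lambda>x. bump (x \<bullet> x) * ?R (x, v))" for v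
  proof -
    have "integral cube (\<lambda>x. bump (x \<bullet> x) * (((x \<bullet> x) * lap_y F (x, u, v)) * tst m j w z (x, v)))
        = integral cube (\<lambda>x. (cis v \<bullet> z) ^ j * (bump (x \<bullet> x) * ((x \<bullet> x) * lap_y F (x, u, v) * sph w x ^ m)))"
      by (intro arg_cong2[where f=integral] refl ext) (simp add: tst_def mult_ac)
    also have "\<dots> = (cis v \<bullet> z) ^ j * integral cube (\<lambda>x. bump (x \<bullet> x) * (F (x, u, v) *
         (real m * (real m - 1) * (w \<bullet> w) * sph w x ^ (m - 2) - real m * (real m + real DIM('a) - 2) * sph w x ^ m)))"
      unfolding integral_mult_right
      by (rule arg_cong[OF spherical_integration_by_parts[OF F]]) (rule hom)
    also have "\<dots> = integral cube (\<lambda>x. bump (x \<bullet> x) * ?R (x, v))"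
      unfolding integral_mult_right[symmetric]
      by (intro arg_cong2[where f=integral] refl ext) (simp add: tst_def algebra_simps)
    finally show ?thesis .
  qed
  then have "weighted_integral (\<lambda>p. ((fst p \<bullet> fst p) * lap_y F (fst p, u, snd p)) * tst m j w z p) = weighted_integral ?R"
    unfolding weighted_integral_iterated(2)[OF c1] weighted_integral_iterated(2)[OF c2]
    by (simp only: fst_conv snd_conv)
  also have "\<dots> = real m * (real m - 1) * (w \<bullet> w) * moment F (m - 2) j w z u + - (real m * (real m + real DIM('a) - 2)) * moment F m j w z u"
    unfolding moment_def weighted_integral_cmult[symmetric]
    by (intro weighted_integral_add continuous_on_mult_left continuous_on_moment_integrand F)
  finally show ?thesis by simp
qed

text \<open>The circle is the case k = 1 of the identity on the sphere. It follows from the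
  fundamental theorem of calculus for g' t^j - g (t^j)', whose boundary terms cancel by
  periodicity.\<close>

lemma circle_integration_by_parts:
  fixes g :: "real \<Rightarrow> real"
  assumes g: "\<And>v. (g has_field_derivative g' v) (at v)" "\<And>v. (g' has_field_derivative g'' v) (at v)"
    and per: "g (2 * pi) = g 0" "g' (2 * pi) = g' 0" and c: "continuous_on UNIV g''"
  shows "integral {0..2 * pi} (\<lambda>v. g'' v * (cis v \<bullet> z) ^ j)
     = integral {0..2 * pi} (\<lambda>v. g v * (real j * (real j - 1) * (z \<bullet> z) * (cis v \<bullet> z) ^ (j - 2) - (real j)\<^sup>2 * (cis v \<bullet> z) ^ j))"
proof -
  define t t' where "t v = cos v * Re z + sin v * Im z" and "t' v = - sin v * Re z + cos v * Im z" for v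
  have t: "(t has_field_derivative t' v) (at v)" "(t' has_field_derivative - t v) (at v)" for v
    unfolding t_def t'_def by (auto intro!: derivative_eq_intros)
  define P' where "P' v = real j * t v ^ (j - 1) * t' v" for v
  define P'' where "P'' v = real j * (real j - 1) * (z \<bullet> z) * t v ^ (j - 2) - (real j)\<^sup>2 * t v ^ j" for v
  have tt: "(t' v)\<^sup>2 = z \<bullet> z - (t v)\<^sup>2" for v
  proof -
    have "(t v)\<^sup>2 + (t' v)\<^sup>2 = ((cos v)\<^sup>2 + (sin v)\<^sup>2) * ((Re z)\<^sup>2 + (Im z)\<^sup>2)"
      unfolding t_def t'_def by algebra
    then show ?thesis by (simp add: inner_complex_def power2_eq_square)
  qed
  have P: "((\<lambda>v. t v ^ j) has_field_derivative P' v) (at v)" for v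
    unfolding P'_def using DERIV_power[OF t(1)] by (simp add: mult_ac)
  have P2: "(P' has_field_derivative P'' v) (at v)" for v
  proof -
    have 1: "((\<lambda>v. t v ^ (j - 1)) has_field_derivative real (j - 1) * t v ^ (j - 2) * t' v) (at v)"
      using DERIV_power[OF t(1), of "j - 1"] by (simp add: mult_ac numeral_2_eq_2)
    have eq: "real j * t v ^ (j - 1) * (- t v) + real j * (real (j - 1) * t v ^ (j - 2) * t' v) * t' v = P'' v"
    proof -
      have "real j * (real (j - 1) * t v ^ (j - 2) * t' v) * t' v = real j * real (j - 1) * t v ^ (j - 2) * (t' v)\<^sup>2"
        by (simp add: power2_eq_square)
      then have e: "real j * (real (j - 1) * t v ^ (j - 2) * t' v) * t' v = real j * real (j - 1) * t v ^ (j - 2) * (z \<bullet> z - (t v)\<^sup>2)"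
        by (simp only: tt)
      consider "j = 0" | "j = 1" | i where "j = Suc (Suc i)" by (metis One_nat_def not0_implies_Suc)
      then show ?thesis
        unfolding e P''_def by cases (simp_all add: algebra_simps power2_eq_square)
    qed
    from DERIV_mult'[OF DERIV_cmult[OF 1, of "real j"] t(2)] show ?thesis
      unfolding P'_def eq .
  qed
  have ct: "continuous_on S t" "continuous_on S g" for S
    by (intro continuous_at_imp_continuous_on ballI DERIV_isCont[OF t(1)] DERIV_isCont[OF g(1)])+
  have "((\<lambda>v. g'' v * t v ^ j - g v * P'' v) has_integral ((g' (2 * pi) * t (2 * pi) ^ j - g (2 * pi) * P' (2 * pi)) - (g' 0 * t 0 ^ j - g 0 * P' 0))) {0..2 * pi}"
  proof (rule fundamental_theorem_of_calculus)
    fix v :: real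
    have "((\<lambda>v. g' v * t v ^ j - g v * P' v) has_field_derivative (g'' v * t v ^ j + P' v * g' v - (g' v * P' v + P'' v * g v))) (at v)"
      by (rule DERIV_diff[OF DERIV_mult[OF g(2) P] DERIV_mult[OF g(1) P2]])
    then have "((\<lambda>v. g' v * t v ^ j - g v * P' v) has_field_derivative (g'' v * t v ^ j - g v * P'' v)) (at v)"
      by (simp add: mult_ac)
    then show "((\<lambda>v. g' v * t v ^ j - g v * P' v) has_vector_derivative (g'' v * t v ^ j - g v * P'' v)) (at v within {0..2 * pi})"
      by (simp add: has_real_derivative_iff_has_vector_derivative has_vector_derivative_at_within)
  qed simp
  moreover have "P' (2 * pi) = P' 0" "t (2 * pi) = t 0" by (simp_all add: P'_def t_def t'_def)
  ultimately have "integral {0..2 * pi} (\<lambda>v. g'' v * t v ^ j - g v * P'' v) = 0"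
    using per by (simp add: integral_unique)
  moreover have "integral {0..2 * pi} (\<lambda>v. g'' v * t v ^ j - g v * P'' v) = integral {0..2 * pi} (\<lambda>v. g'' v * t v ^ j) - integral {0..2 * pi} (\<lambda>v. g v * P'' v)"
    unfolding P''_def
    by (intro integral_diff integrable_continuous_real continuous_intros ct continuous_on_subset[OF c]) auto
  ultimately show ?thesis
    unfolding P''_def t_def cis_inner by simp
qed

lemma moment_Dv_Dv:
  fixes F :: "'a::euclidean_space coords \<Rightarrow> real"
  assumes F: "smooth_on_open off_axis F"
    and per: "\<And>x u v. x \<noteq> 0 \<Longrightarrow> F (x, u, v + 2 * pi) = F (x, u, v)"
  shows "weighted_integral (\<lambda>p. Dv (Dv F) (fst p, u, snd p) * tst m j w z p)
     = real j * (real j - 1) * (z \<bullet> z) * moment F m (j - 2) w z u - (real j)\<^sup>2 * moment F m j w z u"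
proof -
  note F1 = smooth_on_openD(2)[OF F open_off_axis, of "(0, 0, 1)"]
  note F2 = smooth_on_openD(2)[OF F1 open_off_axis, of "(0, 0, 1)"]
  have per': "Dv F (x, u, v + 2 * pi) = Dv F (x, u, v)" if "x \<noteq> 0" for x v
  proof -
    have "((\<lambda>v. F (x, u, v)) has_field_derivative Dv F (x, u, v + 2 * pi)) (at (v + 2 * pi))"
      by (rule slice_deriv(3)[OF F that])
    then have "((\<lambda>v. F (x, u, v + 2 * pi)) has_field_derivative Dv F (x, u, v + 2 * pi)) (at v)"
      by (simp add: DERIV_shift)
    then have "((\<lambda>v. F (x, u, v)) has_field_derivative Dv F (x, u, v + 2 * pi)) (at v)"
      by (simp add: per[OF that])
    then show ?thesis using slice_deriv(3)[OF F that] by (rule DERIV_unique)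
  qed
  note c1 = continuous_on_moment_integrand[OF F2, of u m j w z]
  let ?R = "\<lambda>p. real j * (real j - 1) * (z \<bullet> z) * (F (fst p, u, snd p) * tst m (j - 2) w z p) + - (real j)\<^sup>2 * (F (fst p, u, snd p) * tst m j w z p)"
  have c2: "continuous_on {p :: 'a \<times> real. fst p \<noteq> 0} ?R"
    by (intro continuous_on_add continuous_on_mult_left continuous_on_moment_integrand F)
  have "bump (x \<bullet> x) * integral {0..2 * pi} (\<lambda>v. Dv (Dv F) (x, u, v) * tst m j w z (x, v)) = bump (x \<bullet> x) * integral {0..2 * pi} (\<lambda>v. ?R (x, v))" for x
  proof (cases "x = 0")
    case True
    then show ?thesis by (simp add: bump_eq_0)
  next
    case False
    have "integral {0..2 * pi} (\<lambda>v. Dv (Dv F) (x, u, v) * tst m j w z (x, v)) = integral {0..2 * pi} (\<lambda>v. sph w x ^ m * (Dv (Dv F) (x, u, v) * (cis v \<bullet> z) ^ j))"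
      by (intro arg_cong2[where f=integral] refl ext) (simp add: tst_def mult_ac)
    also have "\<dots> = sph w x ^ m * integral {0..2 * pi} (\<lambda>v. F (x, u, v) * (real j * (real j - 1) * (z \<bullet> z) * (cis v \<bullet> z) ^ (j - 2) - (real j)\<^sup>2 * (cis v \<bullet> z) ^ j))"
      unfolding integral_mult_right
      by (subst circle_integration_by_parts[OF slice_deriv(3)[OF F False] slice_deriv(3)[OF F1 False]])
         (use per[OF False, of u 0] per'[OF False, of 0] False in \<open>auto intro!: continuous_on_slice[OF F2] continuous_intros\<close>)
    also have "\<dots> = integral {0..2 * pi} (\<lambda>v. ?R (x, v))"
      unfolding integral_mult_right[symmetric]
      by (intro arg_cong2[where f=integral] refl ext) (simp add: tst_def algebra_simps)
    finally show ?thesis by simp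
  qed
  then have "weighted_integral (\<lambda>p. Dv (Dv F) (fst p, u, snd p) * tst m j w z p) = weighted_integral ?R"
    unfolding weighted_integral_iterated(1)[OF c1] weighted_integral_iterated(1)[OF c2]
    by (simp only: fst_conv snd_conv)
  also have "\<dots> = real j * (real j - 1) * (z \<bullet> z) * moment F m (j - 2) w z u + - (real j)\<^sup>2 * moment F m j w z u"
    unfolding moment_def weighted_integral_cmult[symmetric]
    by (intro weighted_integral_add continuous_on_mult_left continuous_on_moment_integrand F)
  finally show ?thesis by simp
qed

section \<open>Completeness of the moments\<close>

text \<open>Why exponentials and not polynomials: the moments involve powers of a single s and a
  single t, and products of different linear forms would require polarization. Exponentials multiply
  by adding exponents, so their sums already form an algebra.\<close>

inductive_set exp_sums :: "('b::real_inner \<Rightarrow> real) set" where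
  exp_sums_term: "(\<lambda>z. c * exp (z \<bullet> W)) \<in> exp_sums"
| exp_sums_add: "r \<in> exp_sums \<Longrightarrow> r' \<in> exp_sums \<Longrightarrow> (\<lambda>z. r z + r' z) \<in> exp_sums"

lemma exp_sums_mult:
  assumes "r \<in> exp_sums" "r' \<in> exp_sums"
  shows "(\<lambda>z. r z * r' z) \<in> exp_sums"
  using assms(1)
proof induction
  case (exp_sums_term c W)
  show ?case using assms(2)
  proof induction
    case (exp_sums_term c' W')
    have "(\<lambda>z. c * exp (z \<bullet> W) * (c' * exp (z \<bullet> W'))) = (\<lambda>z. (c * c') * exp (z \<bullet> (W + W')))"
      by (simp add: inner_add_right exp_add fun_eq_iff)
    then show ?case by (metis exp_sums.exp_sums_term)
  next
    case (exp_sums_add r r')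
    then show ?case using exp_sums.exp_sums_add by (fastforce simp: distrib_left)
  qed
next
  case (exp_sums_add r1 r2)
  from exp_sums.exp_sums_add[OF exp_sums_add.IH] show ?case by (simp add: distrib_right)
qed

lemma continuous_on_exp_sums:
  assumes "r \<in> exp_sums" shows "continuous_on S r"
  using assms by induction (auto intro!: continuous_intros)

lemma function_ring_on_exp_sums:
  fixes K :: "'b::euclidean_space set"
  assumes "compact K"
  shows "function_ring_on exp_sums K"
proof
  show "(\<lambda>_. c) \<in> exp_sums" for c
    using exp_sums_term[of c 0] by simp
  fix x y :: 'b assume "x \<noteq> y"
  then have "(x - y) \<bullet> (x - y) \<noteq> 0" by simp
  then have "x \<bullet> (x - y) \<noteq> y \<bullet> (x - y)" by (simp only: inner_diff_left)
  then show "\<exists>r\<in>exp_sums. r x \<noteq> r y"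
    using exp_sums_term[of 1 "x - y"] by (intro bexI[of _ "\<lambda>z. 1 * exp (z \<bullet> (x - y))"]) auto
qed (use assms exp_sums_add exp_sums_mult continuous_on_exp_sums in auto)

lemma abs_sph_le: "\<bar>sph w x\<bar> \<le> norm w"
proof (cases "x = 0")
  case False
  then show ?thesis
    using Cauchy_Schwarz_ineq2[of x w] by (simp add: sph_def abs_mult field_simps)
qed (simp add: sph_def)

text \<open>The exponential series is integrated term by term; by the binomial theorem each power (s
  + t)^n is a combination of test functions with m + j = n.\<close>

lemma weighted_integral_exp_eq_0:
  fixes F :: "'a::euclidean_space coords \<Rightarrow> real"
  assumes F: "smooth_on_open off_axis F" and 0: "\<And>m j w z. moment F m j w z u = 0"
  shows "weighted_integral (\<lambda>p. F (fst p, u, snd p) * exp (sph w (fst p) + cis (snd p) \<bullet> z)) = 0"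
proof -
  define t where "t p = sph w (fst p) + cis (snd p) \<bullet> z" for p :: "'a \<times> real"
  let ?g = "\<lambda>n p. F (fst p, u, snd p) * (t p ^ n /\<^sub>R fact n)"
  let ?C = "cyl :: ('a \<times> real) set"
  have cF: "continuous_on {p :: 'a \<times> real. fst p \<noteq> 0} (\<lambda>p. F (fst p, u, snd p))"
    by (intro continuous_on_slice[OF F] continuous_intros) auto
  have ct: "continuous_on {p. fst p \<noteq> 0} t"
    unfolding t_def cis_inner by (intro continuous_intros) auto
  have cFn: "continuous_on {p. fst p \<noteq> 0} (\<lambda>p. ?g n p)" for n
    by (intro continuous_on_mult continuous_on_scaleR continuous_on_power continuous_on_const cF ct)
  have pow0: "weighted_integral (\<lambda>p. ?g n p) = 0" for n
  proof -
    have "?g n p = (\<Sum>k\<le>n. (real (n choose k) / fact n) * (F (fst p, u, snd p) * tst k (n - k) w z p))" for p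
    proof -
      have "t p ^ n = (\<Sum>k\<le>n. of_nat (n choose k) * sph w (fst p) ^ k * (cis (snd p) \<bullet> z) ^ (n - k))"
        unfolding t_def by (rule binomial_ring)
      then have "?g n p = (\<Sum>k\<le>n. F (fst p, u, snd p) * (inverse (fact n) * (of_nat (n choose k) * sph w (fst p) ^ k * (cis (snd p) \<bullet> z) ^ (n - k))))"
        by (simp only: real_scaleR_def sum_distrib_left)
      also have "\<dots> = (\<Sum>k\<le>n. (real (n choose k) / fact n) * (F (fst p, u, snd p) * tst k (n - k) w z p))"
        by (intro sum.cong refl) (simp add: tst_def divide_inverse)
      finally show ?thesis .
    qed
    then have "weighted_integral (\<lambda>p. ?g n p)
        = weighted_integral (\<lambda>p. \<Sum>k\<le>n. (real (n choose k) / fact n) * (F (fst p, u, snd p) * tst k (n - k) w z p))"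
      by (intro weighted_integral_cong)
    also have "\<dots> = (\<Sum>k\<le>n. weighted_integral (\<lambda>p. (real (n choose k) / fact n) * (F (fst p, u, snd p) * tst k (n - k) w z p)))"
      by (intro weighted_integral_sum continuous_on_mult_left continuous_on_moment_integrand F)
    also have "\<dots> = 0"
      unfolding weighted_integral_cmult moment_def[symmetric] 0 by simp
    finally show ?thesis .
  qed
  have "compact ((\<lambda>p. bump (fst p \<bullet> fst p) * F (fst p, u, snd p)) ` ?C)"
    by (intro compact_continuous_image continuous_on_weighted cF compact_cbox)
  from compact_imp_bounded[OF this] obtain M where M: "\<And>p. p \<in> ?C \<Longrightarrow> \<bar>bump (fst p \<bullet> fst p) * F (fst p, u, snd p)\<bar> \<le> M"
    unfolding bounded_iff by auto
  define R where "R = norm w + norm z"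
  have tR: "\<bar>t p\<bar> \<le> R" for p
  proof -
    have "\<bar>cis (snd p) \<bullet> z\<bar> \<le> norm z"
      using Cauchy_Schwarz_ineq2[of "cis (snd p)" z] by simp
    then show ?thesis using abs_sph_le[of w "fst p"] by (simp add: t_def R_def)
  qed
  \<comment> \<open>The weight is kept inside the series: it makes the partial sums continuous
    across the axis, and |s + t| \<le> |w| + |z| bounds the terms uniformly.\<close>
  have ul: "uniform_limit ?C (\<lambda>N p. \<Sum>n<N. bump (fst p \<bullet> fst p) * ?g n p)
     (\<lambda>p. \<Sum>n. bump (fst p \<bullet> fst p) * ?g n p) sequentially"
  proof (rule Weierstrass_m_test)
    fix n p assume p: "p \<in> ?C"
    have "norm (bump (fst p \<bullet> fst p) * ?g n p)
        = \<bar>bump (fst p \<bullet> fst p) * F (fst p, u, snd p)\<bar> * (\<bar>t p\<bar> ^ n /\<^sub>R fact n)"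
      by (simp add: abs_mult power_abs mult_ac)
    also have "\<dots> \<le> M * (R ^ n /\<^sub>R fact n)"
    proof (rule mult_mono[OF M[OF p]])
      show "\<bar>t p\<bar> ^ n /\<^sub>R fact n \<le> R ^ n /\<^sub>R fact n"
        using power_mono[OF tR, of p n] by (simp add: mult_left_mono)
      show "0 \<le> M" using M[OF p] by linarith
    qed simp
    finally show "norm (bump (fst p \<bullet> fst p) * ?g n p) \<le> M * (R ^ n /\<^sub>R fact n)" .
  next
    show "summable (\<lambda>n. M * (R ^ n /\<^sub>R fact n))"
      by (rule summable_mult) (rule sums_summable[OF exp_converges])
  qed
  have lim: "(\<Sum>n. bump (fst p \<bullet> fst p) * ?g n p) = bump (fst p \<bullet> fst p) * (F (fst p, u, snd p) * exp (t p))" for p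
  proof -
    have "(\<lambda>n. bump (fst p \<bullet> fst p) * ?g n p) sums (bump (fst p \<bullet> fst p) * (F (fst p, u, snd p) * exp (t p)))"
      by (intro sums_mult exp_converges)
    then show ?thesis by (rule sums_unique[symmetric])
  qed
  obtain I J where I: "\<And>N. ((\<lambda>p. \<Sum>n<N. bump (fst p \<bullet> fst p) * ?g n p) has_integral I N) ?C"
    and J: "((\<lambda>p. \<Sum>n. bump (fst p \<bullet> fst p) * ?g n p) has_integral J) ?C"
    and IJ: "I \<longlonglongrightarrow> J"
  proof (rule uniform_limit_integral_cbox[OF ul])
    show "continuous_on ?C (\<lambda>p. \<Sum>n<N. bump (fst p \<bullet> fst p) * ?g n p)" for N
      by (intro continuous_on_sum continuous_on_weighted cFn)
  qed auto
  have "I N = 0" for N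
  proof -
    have "I N = (\<Sum>n<N. weighted_integral (\<lambda>p. ?g n p))"
      unfolding integral_unique[OF I, symmetric] weighted_integral_def
      by (intro integral_sum integrable_continuous continuous_on_weighted cFn) simp
    then show ?thesis using pow0 by simp
  qed
  then have "I = (\<lambda>_. 0)" by (simp add: fun_eq_iff)
  then have "J = 0" using IJ by (simp add: LIMSEQ_const_iff)
  moreover have "integral ?C (\<lambda>p. bump (fst p \<bullet> fst p) * (F (fst p, u, snd p) * exp (t p))) = J"
    using integral_unique[OF J] by (simp only: lim)
  ultimately show ?thesis
    by (simp only: weighted_integral_def t_def)
qed

lemma cis_Arg2pi: "norm z = 1 \<Longrightarrow> cis (Arg2pi z) = z"
  by (simp add: complex_norm_eq_1_exp cis_conv_exp)

lemma cis_Arg_unit: "norm z = 1 \<Longrightarrow> cis (Arg z) = z"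
  by (subst cis_Arg) (auto simp: sgn_div_norm)

text \<open>At the fixed u, F is a continuous function h on the product of the sphere and the
  circle. If r is a sum of exponentials within \<epsilon> of h, the integral of F^2 equals that of F
  (h - r) and is at most \<epsilon> times the integral of |F|.\<close>

lemma moments_determine:
  fixes F :: "'a::euclidean_space coords \<Rightarrow> real"
  assumes F: "smooth_on_open off_axis F"
    and rad: "\<And>x v r. x \<noteq> 0 \<Longrightarrow> r > 0 \<Longrightarrow> F (r *\<^sub>R x, u, v) = F (x, u, v)"
    and per: "\<And>x v. x \<noteq> 0 \<Longrightarrow> F (x, u, v + 2 * pi) = F (x, u, v)"
    and 0: "\<And>m j w z. moment F m j w z u = 0" and x: "x \<noteq> 0"
  shows "F (x, u, v) = 0"
proof -
  have per_n: "F (x, u, v + 2 * pi * real n) = F (x, u, v)" if "x \<noteq> 0" for x v n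
  proof (induction n)
    case (Suc n)
    then show ?case using per[OF that, of "v + 2 * pi * real n"] by (simp add: algebra_simps)
  qed simp
  have F_cis: "F (x, u, v) = F (x, u, v')" if x: "x \<noteq> 0" and c: "cis v = cis v'" for x v v'
  proof -
    have "sin v = sin v' \<and> cos v = cos v'" using c by (simp add: complex_eq_iff)
    then obtain n :: int where n: "v = v' + 2 * pi * n" unfolding sin_cos_eq_iff by blast
    show ?thesis
    proof (cases "n \<ge> 0")
      case True
      then have "v = v' + 2 * pi * real (nat n)" using n by simp
      then show ?thesis using per_n[OF x] by simp
    next
      case False
      then have "v' = v + 2 * pi * real (nat (- n))" using n by simp
      then show ?thesis using per_n[OF x] by simp
    qed
  qed
  define K where "K = sphere (0::'a) 1 \<times> sphere (0::complex) 1"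
  \<comment> \<open>A branch of the argument turns a point of the circle into an angle; by
    periodicity F does not depend on the branch.\<close>
  define h where "h q = F (fst q, u, Arg (snd q))" for q :: "'a \<times> complex"
  have h_Arg2pi: "h q = F (fst q, u, Arg2pi (snd q))" if "q \<in> K" for q
    unfolding h_def using that
    by (intro F_cis) (auto simp: K_def cis_Arg_unit cis_Arg2pi)
  have cF: "continuous_on {q. fst q \<noteq> 0} (\<lambda>p :: 'a \<times> real. F (fst p, u, snd p))"
    by (intro continuous_on_slice[OF F] continuous_intros) auto
  have o: "open {q :: 'a \<times> real. fst q \<noteq> 0}"
    by (intro open_Collect_neq continuous_intros)
  have comp: "continuous (at q within K) (\<lambda>q. F (fst q, u, A (snd q)))" if "q \<in> K" "continuous (at (snd q)) A" for q A
  proof -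
    have "fst q \<noteq> 0" using that(1) by (auto simp: K_def)
    then have "isCont (\<lambda>p :: 'a \<times> real. F (fst p, u, snd p)) (fst q, A (snd q))"
      using cF o by (simp add: continuous_on_eq_continuous_at)
    moreover have "continuous (at q within K) (\<lambda>q. A (snd q))"
      by (rule continuous_within_compose3[where g=A and f=snd]) (use that(2) in \<open>auto intro!: continuous_intros\<close>)
    then have "continuous (at q within K) (\<lambda>q. (fst q, A (snd q)))"
      by (intro continuous_Pair continuous_fst continuous_ident)
    ultimately have "continuous (at q within K) (\<lambda>q. (\<lambda>p. F (fst p, u, snd p)) (fst q, A (snd q)))"
      by (rule continuous_within_compose3[where g="\<lambda>p. F (fst p, u, snd p)" and f="\<lambda>q. (fst q, A (snd q))"])
    then show ?thesis by simp
  qed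
  have "continuous_on K h"
    unfolding continuous_on_eq_continuous_within
  proof
    fix q assume q: "q \<in> K"
    show "continuous (at q within K) h"
    proof (cases "snd q \<in> \<real>\<^sub>\<le>\<^sub>0")
      case False
      then show ?thesis unfolding h_def[abs_def] by (intro comp q continuous_at_Arg)
    next
      case True
      \<comment> \<open>\<open>Arg\<close> jumps on the negative axis, so there it is replaced by
        \<open>Arg2pi\<close>, whose cut is the positive axis.\<close>
      have "snd q \<notin> \<real>\<^sub>\<ge>\<^sub>0"
      proof
        assume "snd q \<in> \<real>\<^sub>\<ge>\<^sub>0"
        with True have "snd q = 0"
          by (simp add: complex_nonpos_Reals_iff complex_nonneg_Reals_iff complex_eq_iff)
        with q show False by (auto simp: K_def)
      qed
      then have "continuous (at q within K) (\<lambda>q. F (fst q, u, Arg2pi (snd q)))"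
        by (intro comp q continuous_at_Arg2pi)
      then show ?thesis
        by (rule continuous_transform_within[OF _ zero_less_one q]) (use h_Arg2pi in auto)
    qed
  qed
  define Fu where "Fu p = F (fst p, u, snd p)" for p
  \<comment> \<open>Pulled back along \<open>\<pi>\<close>, the exponential of a linear form W = (w,
    z) on \<open>K\<close> becomes e^(s + t).\<close>
  define \<pi> where "\<pi> p = (fst p /\<^sub>R norm (fst p), cis (snd p))" for p :: "'a \<times> real"
  have h\<pi>: "h (\<pi> p) = Fu p" and \<pi>K: "\<pi> p \<in> K" if "fst p \<noteq> 0" for p
  proof -
    show "\<pi> p \<in> K" using that by (simp add: \<pi>_def K_def)
    have "F (fst p /\<^sub>R norm (fst p), u, Arg (cis (snd p))) = F (fst p /\<^sub>R norm (fst p), u, snd p)"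
      using that by (intro F_cis) (auto simp: cis_Arg_unit)
    also have "\<dots> = F (fst p, u, snd p)" using that by (intro rad) auto
    finally show "h (\<pi> p) = Fu p" by (simp add: h_def \<pi>_def Fu_def)
  qed
  have c\<pi>: "continuous_on {p. fst p \<noteq> 0} \<pi>"
    unfolding \<pi>_def cis_conv_exp by (auto intro!: continuous_intros)
  have cFu: "continuous_on {p. fst p \<noteq> 0} Fu" using cF by (simp add: Fu_def[abs_def])
  have cr: "continuous_on {p. fst p \<noteq> 0} (\<lambda>p. Fu p * r (\<pi> p))" if "r \<in> exp_sums" for r
    by (intro continuous_on_mult cFu continuous_on_compose2[OF continuous_on_exp_sums[OF that, of UNIV] c\<pi>]) simp
  have r0: "weighted_integral (\<lambda>p. Fu p * r (\<pi> p)) = 0" if "r \<in> exp_sums" for r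
    using that
  proof induction
    case (exp_sums_term c W)
    have "(\<lambda>p. Fu p * (c * exp (\<pi> p \<bullet> W))) = (\<lambda>p. c * (F (fst p, u, snd p) * exp (sph (fst W) (fst p) + cis (snd p) \<bullet> snd W)))"
      by (simp add: fun_eq_iff Fu_def \<pi>_def inner_prod_def sph_def mult_ac)
    then show ?case
      by (simp only: weighted_integral_cmult weighted_integral_exp_eq_0[OF F 0] mult_zero_right)
  next
    case (exp_sums_add r r')
    have "weighted_integral (\<lambda>p. Fu p * r (\<pi> p) + Fu p * r' (\<pi> p)) = 0"
      using weighted_integral_add[OF cr[OF exp_sums_add.hyps(1)] cr[OF exp_sums_add.hyps(2)]] exp_sums_add.IH by simp
    then show ?case by (simp add: distrib_left)
  qed
  have cK: "compact K" unfolding K_def by (intro compact_Times compact_sphere)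
  define A where "A = weighted_integral (\<lambda>p. Fu p * Fu p)"
  define N where "N = weighted_integral (\<lambda>p. \<bar>Fu p\<bar>)"
  have wi: "(\<lambda>p. bump (fst p \<bullet> fst p) * Q p) integrable_on cyl" if "continuous_on {p. fst p \<noteq> 0} Q" for Q :: "'a \<times> real \<Rightarrow> real"
    by (intro integrable_continuous continuous_on_weighted that)
  have N0: "N \<ge> 0"
    unfolding N_def weighted_integral_def by (intro integral_nonneg wi continuous_on_rabs cFu) (simp add: bump_nonneg)
  have A_le: "A \<le> \<epsilon> * N" if \<epsilon>: "\<epsilon> > 0" for \<epsilon>
  proof -
    obtain r where r: "r \<in> exp_sums" and appr: "\<And>q. q \<in> K \<Longrightarrow> \<bar>h q - r q\<bar> < \<epsilon>"
      using function_ring_on.Stone_Weierstrass_basic[OF function_ring_on_exp_sums[OF cK] \<open>continuous_on K h\<close> \<epsilon>] by blast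
    have cFF: "continuous_on {p. fst p \<noteq> 0} (\<lambda>p. Fu p * Fu p)" by (intro continuous_on_mult cFu)
    have "A = weighted_integral (\<lambda>p. Fu p * Fu p) + (-1) * weighted_integral (\<lambda>p. Fu p * r (\<pi> p))"
      unfolding A_def using r0[OF r] by simp
    also have "\<dots> = weighted_integral (\<lambda>p. Fu p * Fu p + (-1) * (Fu p * r (\<pi> p)))"
      unfolding weighted_integral_cmult[symmetric]
      by (rule weighted_integral_add[OF cFF continuous_on_mult_left[OF cr[OF r]], symmetric])
    also have "\<dots> \<le> weighted_integral (\<lambda>p. \<epsilon> * \<bar>Fu p\<bar>)"
      unfolding weighted_integral_def
    proof (rule integral_le)
      fix p :: "'a \<times> real"
      show "bump (fst p \<bullet> fst p) * (Fu p * Fu p + (-1) * (Fu p * r (\<pi> p))) \<le> bump (fst p \<bullet> fst p) * (\<epsilon> * \<bar>Fu p\<bar>)"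
      proof (cases "fst p = 0")
        case False
        have "Fu p * Fu p + (-1) * (Fu p * r (\<pi> p)) = Fu p * (h (\<pi> p) - r (\<pi> p))"
          using h\<pi>[OF False] by (simp add: algebra_simps)
        also have "\<dots> \<le> \<bar>Fu p\<bar> * \<bar>h (\<pi> p) - r (\<pi> p)\<bar>" by (metis abs_ge_self abs_mult)
        also have "\<dots> \<le> \<bar>Fu p\<bar> * \<epsilon>"
          using appr[OF \<pi>K[OF False]] by (intro mult_left_mono) auto
        finally show ?thesis by (intro mult_left_mono) (auto simp: bump_nonneg mult.commute)
      qed (simp add: bump_eq_0)
    qed (intro wi continuous_on_add cFF continuous_on_mult_left cr r continuous_on_rabs cFu)+
    also have "\<dots> = \<epsilon> * N" unfolding N_def by (rule weighted_integral_cmult)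
    finally show ?thesis .
  qed
  have "A \<le> 0"
  proof (rule field_le_epsilon)
    fix e :: real assume "e > 0"
    \<comment> \<open>The denominator N + 1 guards against N = 0.\<close>
    have "A \<le> (e / (N + 1)) * N" using \<open>e > 0\<close> N0 by (intro A_le) simp
    also have "\<dots> \<le> e" using \<open>e > 0\<close> N0 by (simp add: field_simps)
    finally show "A \<le> 0 + e" by simp
  qed
  moreover have "A \<ge> 0"
    unfolding A_def weighted_integral_def by (intro integral_nonneg wi continuous_on_mult cFu) (simp add: bump_nonneg)
  ultimately have A0: "integral cyl (\<lambda>p. bump (fst p \<bullet> fst p) * (Fu p * Fu p)) = 0"
    by (simp add: A_def weighted_integral_def)
  have box: "box (- corner, 0) (corner, 2 * pi) \<noteq> ({} :: ('a \<times> real) set)"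
    unfolding box_ne_empty by (auto simp: Basis_prod_def)
  have z: "\<forall>p\<in>cyl. bump (fst p \<bullet> fst p) * (Fu p * Fu p) = 0"
    using A0 integral_cbox_eq_0_iff[OF continuous_on_weighted[OF continuous_on_mult[OF cFu cFu]] box] by (simp add: bump_nonneg)
  \<comment> \<open>The ray through \<open>x\<close> is met at radius 3/2, inside the annulus 1 <
    |x| < 2 where the weight is positive, and the angle is moved into one period.\<close>
  define x' where "x' = (3 / 2 / norm x) *\<^sub>R x"
  define v' where "v' = Arg2pi (cis v)"
  have nx': "norm x' = 3 / 2" using x by (simp add: x'_def)
  have "0 \<le> v'" "v' \<le> 2 * pi" using Arg2pi[of "cis v"] by (auto simp: v'_def)
  then have "(x', v') \<in> cyl"
    using in_corner_box[of x'] nx' by (simp add: cbox_Pair_eq)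
  from bspec[OF z this] have "bump (x' \<bullet> x') * (Fu (x', v') * Fu (x', v')) = 0" by simp
  moreover have "bump (x' \<bullet> x') > 0"
    unfolding dot_square_norm nx' by (simp add: bump_def power2_eq_square)
  ultimately have "F (x', u, v') = 0" by (simp add: Fu_def)
  moreover have "F (x', u, v') = F (x, u, v')" unfolding x'_def using x by (intro rad) auto
  moreover have "F (x, u, v') = F (x, u, v)"
    using x unfolding v'_def by (intro F_cis) (simp_all add: cis_Arg2pi)
  ultimately show ?thesis by simp
qed

section \<open>From the manifold to the ordinary differential equation\<close>

text \<open>The extension constant along rays: composing with the radial projection replaces the
  local extensions in \<open>smooth_map_on\<close> by a single function that is smooth off the
  axis.\<close>

definition pullback :: "('a::euclidean_space coords \<Rightarrow> real) \<Rightarrow> 'a coords \<Rightarrow> real" where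
  "pullback \<zeta> q = \<zeta> (fst q /\<^sub>R norm (fst q), snd q)"

lemma smooth_pullback:
  fixes \<zeta> :: "'a::euclidean_space coords \<Rightarrow> real"
  assumes "smooth_map_on M_dom \<zeta>"
  shows "smooth_on_open off_axis (pullback \<zeta>)"
proof (rule smooth_on_open_local[OF open_off_axis])
  fix p :: "'a coords" assume p: "p \<in> off_axis"
  define \<pi> where "\<pi> q = (inverse (norm (fst q)) *\<^sub>R fst q, snd q)" for q :: "'a coords"
  have \<pi>M: "\<pi> q \<in> M_dom" if "q \<in> off_axis" for q
  proof -
    have "norm (fst q) \<noteq> 0" using that by auto
    then show ?thesis by (cases q) (simp add: \<pi>_def M_dom_def)
  qed
  have s\<pi>: "smooth_on_open off_axis \<pi>"
    unfolding \<pi>_def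
    by (intro smooth_on_open_intros smooth_on_open_norm open_off_axis) auto
  obtain W G where W: "open W" "\<pi> p \<in> W" "smooth_on_open W G" "\<And>q. q \<in> M_dom \<inter> W \<Longrightarrow> G q = \<zeta> q"
    using assms \<pi>M[OF p] unfolding smooth_map_on_def by meson
  define V where "V = \<pi> -` W \<inter> off_axis"
  have oV: "open V"
    unfolding V_def using continuous_on_open_vimage[OF open_off_axis] smooth_on_openD(3)[OF s\<pi> open_off_axis] W(1) by blast
  have "smooth_on_open V (\<lambda>q. G (\<pi> q))"
    by (rule smooth_on_open_compose[OF oV W(1,3) smooth_on_open_subset[OF s\<pi>]]) (auto simp: V_def)
  then have "smooth_on_open V (pullback \<zeta>)"
  proof (rule smooth_on_open_cong[OF oV, rotated])
    fix q assume "q \<in> V"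
    then have "\<pi> q \<in> M_dom \<inter> W" using \<pi>M by (auto simp: V_def)
    from W(4)[OF this] show "G (\<pi> q) = pullback \<zeta> q" by (simp add: pullback_def \<pi>_def)
  qed
  then show "\<exists>V. open V \<and> p \<in> V \<and> smooth_on_open V (pullback \<zeta>)"
    using oV p W(2) unfolding V_def by blast
qed

text \<open>Chain rule for a dilation in \<open>y\<close>. The factor \<open>c\<close> lets it be
  applied again to a first derivative in \<open>y\<close>, which is homogeneous of degree
  -1.\<close>

lemma frechet_of_scaled:
  fixes H K :: "'a::euclidean_space coords \<Rightarrow> real"
  assumes K: "smooth_on_open off_axis K" and r: "r \<noteq> 0"
    and eq: "\<And>q. q \<in> off_axis \<Longrightarrow> H q = c * K (r *\<^sub>R fst q, snd q)" and q: "q \<in> off_axis"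
  shows "frechet_derivative H (at q) X = c * frechet_derivative K (at (r *\<^sub>R fst q, snd q)) (r *\<^sub>R fst X, snd X)"
proof -
  have S: "((\<lambda>q :: 'a coords. (r *\<^sub>R fst q, snd q)) has_derivative (\<lambda>X. (r *\<^sub>R fst X, snd X))) (at q)"
    by (auto intro!: derivative_eq_intros)
  have "(K has_derivative frechet_derivative K (at (r *\<^sub>R fst q, snd q))) (at (r *\<^sub>R fst q, snd q))"
    by (rule smooth_on_openD(1)[OF K open_off_axis]) (use q r in auto)
  from has_derivative_mult_right[OF has_derivative_compose[OF S this], of c]
  have "(H has_derivative (\<lambda>X. c * frechet_derivative K (at (r *\<^sub>R fst q, snd q)) (r *\<^sub>R fst X, snd X))) (at q)"
    by (rule has_derivative_transform_within_open[OF _ open_off_axis q]) (simp add: eq)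
  from fun_cong[OF frechet_derivative_at[OF this], of X] show ?thesis by simp
qed

definition radially_constant :: "('a::real_vector coords \<Rightarrow> real) \<Rightarrow> bool" where
  "radially_constant F \<longleftrightarrow> (\<forall>x u v r. x \<noteq> 0 \<longrightarrow> r > 0 \<longrightarrow> F (r *\<^sub>R x, u, v) = F (x, u, v))"

lemma radially_constantD: "radially_constant F \<Longrightarrow> x \<noteq> 0 \<Longrightarrow> r > 0 \<Longrightarrow> F (r *\<^sub>R x, u, v) = F (x, u, v)"
  by (simp add: radially_constant_def)

text \<open>All of this comes from differentiating F(r x, u, v) = F(x, u, v), along the ray or in
  the other directions; each derivative in \<open>y\<close> contributes one factor r.\<close>

lemma radially_constant_derivatives:
  fixes F :: "'a::euclidean_space coords \<Rightarrow> real"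
  assumes F: "smooth_on_open off_axis F"
    and rad: "radially_constant F"
    and x: "x \<noteq> 0"
  shows "Dy x F (x, u, v) = 0"
    and "Dy x (Dy x F) (x, u, v) = 0"
    and "r > 0 \<Longrightarrow> lap_y F (x, u, v) = r\<^sup>2 * lap_y F (r *\<^sub>R x, u, v)"
    and "r > 0 \<Longrightarrow> Du F (x, u, v) = Du F (r *\<^sub>R x, u, v)"
    and "r > 0 \<Longrightarrow> Du (Du F) (x, u, v) = Du (Du F) (r *\<^sub>R x, u, v)"
    and "r > 0 \<Longrightarrow> Dv (Dv F) (x, u, v) = Dv (Dv F) (r *\<^sub>R x, u, v)"
proof -
  have lin: "linear (frechet_derivative F (at q))" if "q \<in> off_axis" for q
    using has_derivative_linear[OF smooth_on_openD(1)[OF F open_off_axis that]] .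
  note F1 = smooth_on_openD(2)[OF F open_off_axis]
  have 1: "Dy x F (x, u, v) = 0" if "x \<noteq> 0" for x u v
  proof -
    have "((\<lambda>t. F ((x, u, v) + t *\<^sub>R (x, 0, 0))) has_vector_derivative Dy x F (x, u, v)) (at 0)"
      by (rule has_vector_derivative_along_line[OF smooth_on_openD(1)[OF F open_off_axis]]) (use that in simp)
    then have "((\<lambda>t. F (x, u, v)) has_vector_derivative Dy x F (x, u, v)) (at 0)"
    proof (rule has_vector_derivative_transform_within_open[where S="{-1<..<1}"])
      fix t :: real assume "t \<in> {-1<..<1}"
      then show "F ((x, u, v) + t *\<^sub>R (x, 0, 0)) = F (x, u, v)"
        using radially_constantD[OF rad that, of "1 + t" u v] by (simp add: scaleR_add_left)
    qed auto
    from vector_derivative_unique_at[OF this has_vector_derivative_const] show ?thesis .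
  qed
  then show "Dy x F (x, u, v) = 0" using x .
  let ?X = "(x, 0, 0) :: 'a coords"
  have "((\<lambda>t. (\<lambda>q. frechet_derivative F (at q) ?X) ((x, u, v) + t *\<^sub>R ?X)) has_vector_derivative
      frechet_derivative (\<lambda>q. frechet_derivative F (at q) ?X) (at (x, u, v)) ?X) (at 0)"
    by (rule has_vector_derivative_along_line[OF smooth_on_openD(1)[OF F1 open_off_axis]]) (use x in simp)
  then have "((\<lambda>t. 0) has_vector_derivative
      frechet_derivative (\<lambda>q. frechet_derivative F (at q) ?X) (at (x, u, v)) ?X) (at 0)"
  proof (rule has_vector_derivative_transform_within_open[where S="{-1<..<1}"])
    fix t :: real assume t: "t \<in> {-1<..<1}"
    have q: "((1 + t) *\<^sub>R x, u, v) \<in> off_axis" using x t by auto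
    \<comment> \<open>The direction is frozen at \<open>x\<close> while the point moves to (1 + t)
      x, whose own radial direction is (1 + t) x; linearity passes from one to the other.\<close>
    have "(1 + t) *\<^sub>R frechet_derivative F (at ((1 + t) *\<^sub>R x, u, v)) ?X = frechet_derivative F (at ((1 + t) *\<^sub>R x, u, v)) ((1 + t) *\<^sub>R ?X)"
      by (rule linear_cmul[OF lin[OF q], symmetric])
    also have "\<dots> = 0" using 1[of "(1 + t) *\<^sub>R x" u v] x t by simp
    finally show "(\<lambda>q. frechet_derivative F (at q) ?X) ((x, u, v) + t *\<^sub>R ?X) = 0"
      using t by (simp add: scaleR_add_left)
  qed auto
  from vector_derivative_unique_at[OF this has_vector_derivative_const]
  show "frechet_derivative (\<lambda>q. frechet_derivative F (at q) ?X) (at (x, u, v)) ?X = 0" .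
  assume r: "r > 0"
  then have r0: "r \<noteq> 0" by simp
  have xq: "(x, u, v) \<in> off_axis" using x by simp
  have eq: "F q = 1 * F (r *\<^sub>R fst q, snd q)" if "q \<in> off_axis" for q
  proof -
    have "fst q \<noteq> 0" using that by auto
    from radially_constantD[OF rad this r, of "fst (snd q)" "snd (snd q)"] show ?thesis by simp
  qed
  have D: "frechet_derivative F (at q) X = 1 * frechet_derivative F (at (r *\<^sub>R fst q, snd q)) (r *\<^sub>R fst X, snd X)" if "q \<in> off_axis" for q X
    by (rule frechet_of_scaled[OF F r0 eq that])
  show "Du F (x, u, v) = Du F (r *\<^sub>R x, u, v)"
    using D[OF xq, of "(0, 1, 0)"] by simp
  show "Du (Du F) (x, u, v) = Du (Du F) (r *\<^sub>R x, u, v)"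
    using frechet_of_scaled[where H="Du F" and c=1, OF F1[of "(0, 1, 0)"] r0 _ xq, of "(0, 1, 0)"] D[of _ "(0, 1, 0)"] by simp
  show "Dv (Dv F) (x, u, v) = Dv (Dv F) (r *\<^sub>R x, u, v)"
    using frechet_of_scaled[where H="Dv F" and c=1, OF F1[of "(0, 0, 1)"] r0 _ xq, of "(0, 0, 1)"] D[of _ "(0, 0, 1)"] by simp
  have DD: "Dy e (Dy e F) (x, u, v)
     = r\<^sup>2 * Dy e (Dy e F) (r *\<^sub>R x, u, v)" for e
  proof -
    let ?K = "\<lambda>q. Dy e F q"
    have sc: "(r *\<^sub>R e, 0, 0) = r *\<^sub>R (e, 0::real, 0::real)" by simp
    have rq: "(r *\<^sub>R x, u, v) \<in> off_axis" using x r by simp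
    have e: "?K q = r * ?K (r *\<^sub>R fst q, snd q)" if "q \<in> off_axis" for q
    proof -
      have "(r *\<^sub>R fst q, snd q) \<in> off_axis" using that r by auto
      from linear_cmul[OF lin[OF this], of r "(e, 0, 0)"] D[OF that, of "(e, 0, 0)"]
      show ?thesis unfolding sc[symmetric] by simp
    qed
    have "Dy e ?K (x, u, v) = r * Dy (r *\<^sub>R e) ?K (r *\<^sub>R x, u, v)"
      using frechet_of_scaled[where H="?K" and c=r, OF F1[of "(e, 0, 0)"] r0 e xq, of "(e, 0, 0)"] by simp
    also have "Dy (r *\<^sub>R e) ?K (r *\<^sub>R x, u, v) = r *\<^sub>R Dy e ?K (r *\<^sub>R x, u, v)"
      unfolding sc by (rule linear_cmul[OF has_derivative_linear[OF smooth_on_openD(1)[OF F1 open_off_axis rq]]])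
    finally show ?thesis by (simp add: power2_eq_square)
  qed
  show "lap_y F (x, u, v) = r\<^sup>2 * lap_y F (r *\<^sub>R x, u, v)"
    unfolding lap_y_def sum_distrib_left by (rule sum.cong[OF refl DD])
qed

section \<open>The differential equation of a moment of least order\<close>

lemma least_nonzero_moment:
  fixes F :: "'a::euclidean_space coords \<Rightarrow> real"
  assumes "moment F m0 j0 w0 z0 u0 \<noteq> 0"
  shows "\<exists>m j w z. (\<exists>u. moment F m j w z u \<noteq> 0) \<and> (\<forall>m' j' u. m' + j' < m + j \<longrightarrow> moment F m' j' w z u = 0)"
proof -
  define P where "P n \<longleftrightarrow> (\<exists>m j w z u. m + j = n \<and> moment F m j w z u \<noteq> 0)" for n
  have "P (m0 + j0)" unfolding P_def using assms by blast
  then obtain n where n: "P n" "\<forall>n'<n. \<not> P n'" using exists_least_iff[of P] by blast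
  then obtain m j w z u where *: "m + j = n" "moment F m j w z u \<noteq> 0" unfolding P_def by blast
  have "moment F m' j' w z u' = 0" if "m' + j' < m + j" for m' j' u'
  proof -
    have "\<not> P (m' + j')" using n(2) *(1) that by blast
    then show ?thesis unfolding P_def by blast
  qed
  then show ?thesis using *(2) by blast
qed

context profile_curve
begin

lemma L_op_eq:
  "L_op f1 f2 k i j \<eta> u = 1 / w2 u * (deriv (deriv \<eta>) u + (real k * (f' u / f u) + f2' u / f2 u
      - f' u * f'' u / w2 u) * deriv \<eta> u) - (\<alpha> k i / (f u)\<^sup>2 + (real j)\<^sup>2 / (f2 u)\<^sup>2) * \<eta> u"
  by (simp add: L_op_def Let_def w2_def)

text \<open>Everything takes place at one \<open>u\<close>, so the potential enters as a number
  \<open>b\<close>. Integration by parts moves the operators in \<open>y\<close> and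
  \<open>v\<close> onto the test function; what they produce besides the wanted multiples are
  moments of order m + j - 2, which vanish by \<open>least\<close>.\<close>

lemma moment_ODE:
  fixes F :: "'a::euclidean_space coords \<Rightarrow> real"
  assumes F: "smooth_on_open off_axis F"
    and rad: "radially_constant F"
    and per: "\<And>x u v. x \<noteq> 0 \<Longrightarrow> F (x, u, v + 2 * pi) = F (x, u, v)"
    and dim: "DIM('a) = k + 1"
    and pde: "\<And>y v. norm y = 1 \<Longrightarrow> lap_formula F (y, u, v) + b * F (y, u, v) = 0"
    and least: "\<And>m' j'. m' + j' < m + j \<Longrightarrow> moment F m' j' w z u = 0"
  shows "L_op f1 f2 k m j (moment F m j w z) u + b * moment F m j w z u = 0"
proof -
  define a where "a = real k * (f' u / f u) + f2' u / f2 u - f' u * f'' u / w2 u"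
  define T1 T2 T3 T4 T5 where
    "T1 p = ((fst p \<bullet> fst p) * lap_y F (fst p, u, snd p)) * tst m j w z p" and
    "T2 p = Du (Du F) (fst p, u, snd p) * tst m j w z p" and
    "T3 p = Du F (fst p, u, snd p) * tst m j w z p" and
    "T4 p = Dv (Dv F) (fst p, u, snd p) * tst m j w z p" and
    "T5 p = F (fst p, u, snd p) * tst m j w z p" for p
  note F1 = smooth_on_openD(2)[OF F open_off_axis]
  note F2 = smooth_on_openD(2)[OF F1 open_off_axis]
  have c2: "continuous_on {p. fst p \<noteq> 0} T2" "continuous_on {p. fst p \<noteq> 0} T3" "continuous_on {p. fst p \<noteq> 0} T4" "continuous_on {p. fst p \<noteq> 0} T5"
    unfolding T2_def T3_def T4_def T5_def
    by (rule continuous_on_moment_integrand[OF F2] continuous_on_moment_integrand[OF F1] continuous_on_moment_integrand[OF F])+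
  have c1: "continuous_on {p. fst p \<noteq> 0} T1"
  proof -
    have T1: "T1 = (\<lambda>p. (fst p \<bullet> fst p) * (\<Sum>e\<in>Basis. Dy e (Dy e F) (fst p, u, snd p) * tst m j w z p))"
      by (simp add: T1_def lap_y_def fun_eq_iff sum_distrib_right mult.assoc)
    show ?thesis
      unfolding T1
      by (intro continuous_on_mult continuous_on_sum continuous_on_moment_integrand[OF F2] continuous_intros)
  qed
  \<comment> \<open>The equation is known on the unit sphere only. It is read at x/|x| and
    transported back along the ray, which puts the factor x . x in front of the flat
    Laplacian.\<close>
  have eq0: "(1 / (f u)\<^sup>2) * T1 (x, v) + ((1 / w2 u) * T2 (x, v) + ((a / w2 u) * T3 (x, v) + ((1 / (f2 u)\<^sup>2) * T4 (x, v) + b * T5 (x, v)))) = 0"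
    if x: "x \<noteq> 0" for x v
  proof -
    define r where "r = inverse (norm x)"
    have r: "r > 0" using x by (simp add: r_def)
    have rx: "r\<^sup>2 * (x \<bullet> x) = 1" using x by (simp add: r_def dot_square_norm power_inverse)
    note R = radially_constant_derivatives[OF F rad]
    have y: "norm (r *\<^sub>R x) = 1" "r *\<^sub>R x \<noteq> 0" using x by (auto simp: r_def)
    have "(x \<bullet> x) * lap_y F (x, u, v) = (r\<^sup>2 * (x \<bullet> x)) * lap_y F (r *\<^sub>R x, u, v)"
      using R(3)[OF x r, of u v] by simp
    then have l: "lap_y F (r *\<^sub>R x, u, v) = (x \<bullet> x) * lap_y F (x, u, v)" unfolding rx by simp
    have "(x \<bullet> x) * lap_y F (x, u, v) / (f u)\<^sup>2 + 1 / w2 u * (Du (Du F) (x, u, v) + a * Du F (x, u, v)) + Dv (Dv F) (x, u, v) / (f2 u)\<^sup>2 + b * F (x, u, v) = 0"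
      using pde[OF y(1), of v] R(4-6)[OF x r, of u v] R(1,2)[OF y(2), of u v] radially_constantD[OF rad x r, of u v] l dim
      by (simp add: lap_formula_def Let_def a_def)
    then have "((x \<bullet> x) * lap_y F (x, u, v) / (f u)\<^sup>2 + 1 / w2 u * (Du (Du F) (x, u, v) + a * Du F (x, u, v)) + Dv (Dv F) (x, u, v) / (f2 u)\<^sup>2 + b * F (x, u, v)) * tst m j w z (x, v) = 0"
      by simp
    then show ?thesis
      by (simp add: T1_def T2_def T3_def T4_def T5_def algebra_simps)
  qed
  have "weighted_integral (\<lambda>p. (1 / (f u)\<^sup>2) * T1 p + ((1 / w2 u) * T2 p + ((a / w2 u) * T3 p + ((1 / (f2 u)\<^sup>2) * T4 p + b * T5 p)))) = weighted_integral (\<lambda>_ :: 'a \<times> real. 0)"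
    by (rule weighted_integral_cong) (rule eq0)
  also have "\<dots> = 0" by (simp add: weighted_integral_def)
  also have "weighted_integral (\<lambda>p. (1 / (f u)\<^sup>2) * T1 p + ((1 / w2 u) * T2 p + ((a / w2 u) * T3 p + ((1 / (f2 u)\<^sup>2) * T4 p + b * T5 p))))
     = (1 / (f u)\<^sup>2) * weighted_integral T1 + ((1 / w2 u) * weighted_integral T2 + ((a / w2 u) * weighted_integral T3 + ((1 / (f2 u)\<^sup>2) * weighted_integral T4 + b * weighted_integral T5)))"
    unfolding weighted_integral_cmult[symmetric]
    by (subst weighted_integral_add, (intro continuous_on_add continuous_on_mult_left c1 c2)+)+ (rule refl)
  finally have I: "(1 / (f u)\<^sup>2) * weighted_integral T1 + ((1 / w2 u) * weighted_integral T2 + ((a / w2 u) * weighted_integral T3 + ((1 / (f2 u)\<^sup>2) * weighted_integral T4 + b * weighted_integral T5))) = 0" .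
  let ?Z = "moment F m j w z"
  have I1: "weighted_integral T1 = - \<alpha> k m * ?Z u"
  proof -
    have "real m * (real m - 1) * (w \<bullet> w) * moment F (m - 2) j w z u = 0"
    proof (cases "m < 2")
      case True
      then have "m = 0 \<or> m = 1" by auto
      then show ?thesis by auto
    next
      case False
      then show ?thesis using least[of "m - 2" j] by simp
    qed
    then show ?thesis
      unfolding T1_def
      by (subst moment_lap_y[OF F])
         (use radially_constant_derivatives(1)[OF F rad] dim in \<open>simp_all add: \<alpha>_def algebra_simps\<close>)
  qed
  have I4: "weighted_integral T4 = - (real j)\<^sup>2 * ?Z u"
  proof -
    have "real j * (real j - 1) * (z \<bullet> z) * moment F m (j - 2) w z u = 0"
    proof (cases "j < 2")
      case True
      then have "j = 0 \<or> j = 1" by auto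
      then show ?thesis by auto
    next
      case False
      then show ?thesis using least[of m "j - 2"] by simp
    qed
    then show ?thesis
      unfolding T4_def by (subst moment_Dv_Dv[OF F]) (use per in simp_all)
  qed
  have d1: "deriv ?Z = moment (Du F) m j w z"
    by (rule ext) (rule DERIV_imp_deriv[OF moment_deriv[OF F]])
  have d2: "deriv (deriv ?Z) u = moment (Du (Du F)) m j w z u"
    unfolding d1 by (rule DERIV_imp_deriv[OF moment_deriv[OF F1]])
  have "weighted_integral T2 = deriv (deriv ?Z) u" "weighted_integral T3 = deriv ?Z u" "weighted_integral T5 = ?Z u"
    unfolding d2 unfolding d1 moment_def T2_def T3_def T5_def by simp_all
  then show ?thesis
    using I unfolding L_op_eq a_def[symmetric] I1 I4 by (simp add: algebra_simps add_divide_distrib)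
qed

lemma eigenfunction_descends:
  fixes \<zeta> :: "'a::euclidean_space coords \<Rightarrow> real"
  assumes \<zeta>: "\<zeta> \<in> M_functions T" and nz: "p0 \<in> M_dom" "\<zeta> p0 \<noteq> 0"
    and dim: "DIM('a) = k + 1"
    and eig: "\<And>p. p \<in> M_dom \<Longrightarrow> laplacian M_dom \<phi> \<zeta> p + b (fst (snd p)) * \<zeta> p = 0"
  obtains i j \<eta> where "\<eta> \<in> periodic_functions T" "\<exists>u. \<eta> u \<noteq> 0" "\<And>u. L_op f1 f2 k i j \<eta> u + b u * \<eta> u = 0"
proof -
  define F where "F = pullback \<zeta>"
  have F: "smooth_on_open off_axis F"
    unfolding F_def using \<zeta> by (intro smooth_pullback) (simp add: M_functions_def)
  have F\<zeta>: "F q = \<zeta> q" if "q \<in> M_dom" for q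
    using that by (auto simp: F_def pullback_def M_dom_def)
  have rad: "radially_constant F"
    unfolding radially_constant_def
  proof (intro allI impI)
    fix x :: 'a and u v r :: real assume "x \<noteq> 0" "r > 0"
    then have "(r *\<^sub>R x) /\<^sub>R norm (r *\<^sub>R x) = x /\<^sub>R norm x" by (simp add: field_simps)
    then show "F (r *\<^sub>R x, u, v) = F (x, u, v)" by (simp only: F_def pullback_def fst_conv snd_conv)
  qed
  have inM: "(x /\<^sub>R norm x, u, v) \<in> M_dom" if "x \<noteq> 0" for x :: 'a and u v
    using that by (simp add: M_dom_def)
  have per: "F (x, u, v + 2 * pi) = F (x, u, v)" and perT: "F (x, u + T, v) = F (x, u, v)" if "x \<noteq> 0" for x u v
    using \<zeta> inM[OF that, of u v] by (auto simp: F_def pullback_def M_functions_def)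
  have pde: "lap_formula F (y, u, v) + b u * F (y, u, v) = 0" if "norm y = 1" for y u v
  proof -
    have p: "(y, u, v) \<in> M_dom \<inter> off_axis" using that by (auto simp: M_dom_def)
    have "laplacian M_dom \<phi> \<zeta> (y, u, v) = lap_formula F (y, u, v)"
      by (rule laplacian_eq[OF open_off_axis F _ p]) (simp add: F\<zeta>)
    then show ?thesis using eig[of "(y, u, v)"] F\<zeta>[of "(y, u, v)"] p by simp
  qed
  obtain y0 u0 v0 where p0: "p0 = (y0, u0, v0)" by (metis prod_cases3)
  have y0: "y0 \<noteq> 0" using nz(1) p0 by (auto simp: M_dom_def)
  have "\<exists>m j w z. moment F m j w z u0 \<noteq> 0"
  proof (rule ccontr)
    assume "\<not> ?thesis"
    then have "F (y0, u0, v0) = 0"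
      by (intro moments_determine[OF F] radially_constantD[OF rad] per y0) auto
    then show False using F\<zeta>[OF nz(1)] nz(2) p0 by simp
  qed
  then obtain m0 j0 w0 z0 where "moment F m0 j0 w0 z0 u0 \<noteq> 0" by blast
  from least_nonzero_moment[OF this] obtain m j w z where Z: "\<exists>u. moment F m j w z u \<noteq> 0"
    "\<forall>m' j' u. m' + j' < m + j \<longrightarrow> moment F m' j' w z u = 0"
    by blast
  show thesis
  proof (rule that[of "moment F m j w z" m j])
    have "moment F m j w z (u + T) = moment F m j w z u" for u
      unfolding moment_def by (rule weighted_integral_cong) (simp add: perT)
    then show "moment F m j w z \<in> periodic_functions T"
      using smooth_moment[OF F] by (simp add: periodic_functions_def)
    show "L_op f1 f2 k m j (moment F m j w z) u + b u * moment F m j w z u = 0" for u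
    proof (rule moment_ODE[OF F rad _ dim])
      show "F (x, u, v + 2 * pi) = F (x, u, v)" if "x \<noteq> 0" for x u v by (rule per[OF that])
      show "lap_formula F (y, u, v) + b u * F (y, u, v) = 0" if "norm y = 1" for y v by (rule pde[OF that])
      show "moment F m' j' w z u = 0" if "m' + j' < m + j" for m' j' using Z(2) that by blast
    qed
  qed (rule Z(1))
qed

end

section \<open>From the ordinary differential equation to the manifold\<close>

definition plane_coord :: "'a::euclidean_space \<Rightarrow> 'a \<Rightarrow> 'a \<Rightarrow> complex" where
  "plane_coord a b y = Complex (y \<bullet> a) (y \<bullet> b)"

lemma has_derivative_Re_plane_power:
  "((\<lambda>y. Re (c * plane_coord a b y ^ n)) has_derivative
     (\<lambda>h. Re ((c * of_nat n * plane_coord a b h) * plane_coord a b y ^ (n - 1)))) (at y)"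
proof -
  have "plane_coord a b = (\<lambda>y. of_real (y \<bullet> a) + \<i> * of_real (y \<bullet> b))"
    by (simp add: plane_coord_def Complex_eq fun_eq_iff)
  then have "(plane_coord a b has_derivative plane_coord a b) (at y)"
    by (auto intro!: derivative_eq_intros)
  from has_derivative_Re[OF has_derivative_mult_right[OF has_derivative_power[OF this, of n], of c]]
  show ?thesis by (rule has_derivative_eq_rhs) (simp add: fun_eq_iff mult_ac)
qed

text \<open>A complex coefficient keeps the family closed: differentiating in the direction h
  multiplies it by n and by the complex number \<open>plane_coord a b h\<close>.\<close>

lemma smooth_Re_plane_power: "smooth_on_open UNIV (\<lambda>y. Re (c * plane_coord a b y ^ n))"
proof (rule smooth_on_openI[where P="\<lambda>F. \<exists>c n. F = (\<lambda>y. Re (c * plane_coord a b y ^ n))"])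
  fix F assume "\<exists>c n. F = (\<lambda>y. Re (c * plane_coord a b y ^ n))"
  then obtain c n where F: "F = (\<lambda>y. Re (c * plane_coord a b y ^ n))" by blast
  show "\<exists>F'. (\<forall>p\<in>UNIV. (F has_derivative F' p) (at p)) \<and> (\<forall>X. \<exists>c n. (\<lambda>p. F' p X) = (\<lambda>y. Re (c * plane_coord a b y ^ n)))"
  proof (intro exI[of _ "\<lambda>y h. Re ((c * of_nat n * plane_coord a b h) * plane_coord a b y ^ (n - 1))"] conjI ballI allI)
    show "(F has_derivative (\<lambda>h. Re ((c * of_nat n * plane_coord a b h) * plane_coord a b p ^ (n - 1)))) (at p)" for p
      unfolding F by (rule has_derivative_Re_plane_power)
  qed blast
qed blast+

text \<open>The coefficient, the exponent and both factors are parameters so that all partial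
  derivatives of a mode are modes again.\<close>

definition mode :: "'a::euclidean_space \<Rightarrow> 'a \<Rightarrow> complex \<Rightarrow> nat \<Rightarrow> (real \<Rightarrow> real) \<Rightarrow> (real \<Rightarrow> real) \<Rightarrow> 'a coords \<Rightarrow> real" where
  "mode a b c n A B q = Re (c * plane_coord a b (fst q) ^ n) * (A (fst (snd q)) * B (snd (snd q)))"

lemma smooth_mode:
  assumes "smooth_on_open UNIV A" "smooth_on_open UNIV B"
  shows "smooth_on_open UNIV (mode a b c n A B)"
proof -
  note I = smooth_on_open_ident[OF open_UNIV]
  note S = smooth_on_open_snd[OF open_UNIV I]
  show ?thesis
    unfolding mode_def
    by (intro smooth_on_open_mult open_UNIV
        smooth_on_open_compose[OF open_UNIV open_UNIV smooth_Re_plane_power smooth_on_open_fst[OF open_UNIV I]]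
        smooth_on_open_compose[OF open_UNIV open_UNIV assms(1) smooth_on_open_fst[OF open_UNIV S]]
        smooth_on_open_compose[OF open_UNIV open_UNIV assms(2) smooth_on_open_snd[OF open_UNIV S]] subset_UNIV)
qed

lemma frechet_derivative_mode:
  assumes A: "\<And>u. (A has_field_derivative A' u) (at u)" and B: "\<And>v. (B has_field_derivative B' v) (at v)"
  shows "(Dy e (mode a b c n A B)) = mode a b (c * of_nat n * plane_coord a b e) (n - 1) A B"
    and "Du (mode a b c n A B) = mode a b c n A' B"
    and "Dv (mode a b c n A B) = mode a b c n A B'"
proof -
  have "(mode a b c n A B has_derivative (\<lambda>X. Re (c * plane_coord a b (fst q) ^ n) * (A (fst (snd q)) * (B' (snd (snd q)) * snd (snd X)) + (A' (fst (snd q)) * fst (snd X)) * B (snd (snd q)))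
      + Re ((c * of_nat n * plane_coord a b (fst X)) * plane_coord a b (fst q) ^ (n - 1)) * (A (fst (snd q)) * B (snd (snd q))))) (at q)" for q
    unfolding mode_def
    by (intro has_derivative_mult has_derivative_snd_comp[OF A] has_derivative_snd_comp[OF B]
        has_derivative_compose[OF has_derivative_fst[OF has_derivative_ident] has_derivative_Re_plane_power])
  note D = fun_cong[OF frechet_derivative_at[OF this], symmetric]
  have z: "plane_coord a b 0 = 0" by (simp add: plane_coord_def complex_eq_iff)
  show "(Dy e (mode a b c n A B)) = mode a b (c * of_nat n * plane_coord a b e) (n - 1) A B"
    "Du (mode a b c n A B) = mode a b c n A' B" "Dv (mode a b c n A B) = mode a b c n A B'"
    unfolding D by (simp_all add: fun_eq_iff mode_def z)
qed

context profile_curve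
begin

text \<open>With z = \<open>plane_coord a b y\<close>, the power z^i is harmonic on the ambient
  space and homogeneous of degree i. The radial corrections in \<open>lap_formula\<close> therefore
  contribute i (i - 1) + k i = \<open>\<alpha> k i\<close>.\<close>

lemma lap_formula_mode:
  fixes a b y :: "'a::euclidean_space"
  assumes ab: "a \<in> Basis" "b \<in> Basis" "a \<noteq> b" and dim: "DIM('a) = k + 1" and \<eta>: "smooth_on_open UNIV \<eta>"
  shows "lap_formula (mode a b 1 i \<eta> (\<lambda>v. cos (real j * v))) (y, u, v)
     = Re (plane_coord a b y ^ i) * cos (real j * v) * L_op f1 f2 k i j \<eta> u"
proof -
  note d\<eta> = smooth_real_deriv(1)[OF \<eta>] and d2\<eta> = smooth_real_deriv(1)[OF smooth_real_deriv(2)[OF \<eta>]]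
  have dc: "((\<lambda>v. cos (real j * v)) has_field_derivative - real j * sin (real j * v)) (at v)"
    "((\<lambda>v. - real j * sin (real j * v)) has_field_derivative - (real j)\<^sup>2 * cos (real j * v)) (at v)" for v
    by (auto intro!: derivative_eq_intros simp: power2_eq_square)
  let ?B = "\<lambda>v. cos (real j * v)" and ?z = "plane_coord a b"
  note M = frechet_derivative_mode[where a=a and b=b, OF d\<eta> dc(1)]
  have yy: "frechet_derivative (Dy e (mode a b 1 i \<eta> ?B)) (at q) (e, 0, 0)
     = mode a b (of_nat i * ?z e * of_nat (i - 1) * ?z e) (i - 2) \<eta> ?B q" for e q
    using fun_cong[OF M(1)[of "of_nat i * ?z e" "i - 1" e], of q] unfolding M(1) by (simp add: numeral_2_eq_2)
  \<comment> \<open>The complex vector with real part \<open>a\<close> and imaginary part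
    \<open>b\<close> is isotropic; this is what makes its powers harmonic.\<close>
  have zz: "(\<Sum>e\<in>Basis. ?z e * ?z e) = 0"
  proof -
    have "(\<Sum>e\<in>Basis. ?z e * ?z e) = (\<Sum>e\<in>Basis. Complex ((a \<bullet> e) * (a \<bullet> e) - (b \<bullet> e) * (b \<bullet> e)) (2 * ((a \<bullet> e) * (b \<bullet> e))))"
      by (intro sum.cong refl) (simp add: plane_coord_def complex_eq_iff inner_commute)
    also have "\<dots> = Complex (a \<bullet> a - b \<bullet> b) (2 * (a \<bullet> b))"
      unfolding complex_eq_iff Re_sum Im_sum by (simp add: sum_subtractf sum_distrib_left[symmetric] sum_Basis_inner)
    also have "\<dots> = 0" using ab by (simp add: inner_Basis complex_eq_iff)
    finally show ?thesis .
  qed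
  have lap: "lap_y (mode a b 1 i \<eta> ?B) (y, u, v) = 0"
  proof -
    have "lap_y (mode a b 1 i \<eta> ?B) (y, u, v) = (\<Sum>e\<in>Basis. Re ((of_nat i * of_nat (i - 1) * ?z y ^ (i - 2)) * (?z e * ?z e))) * (\<eta> u * ?B v)"
      unfolding lap_y_def yy sum_distrib_right by (intro sum.cong refl) (simp add: mode_def mult_ac)
    also have "\<dots> = Re ((of_nat i * of_nat (i - 1) * ?z y ^ (i - 2)) * (\<Sum>e\<in>Basis. ?z e * ?z e)) * (\<eta> u * ?B v)"
      by (simp only: Re_sum[symmetric] sum_distrib_left[symmetric])
    finally show ?thesis unfolding zz by simp
  qed
  have y1: "Dy y (mode a b 1 i \<eta> ?B) (y, u, v) = real i * (Re (?z y ^ i) * (\<eta> u * ?B v))"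
    using fun_cong[OF M(1)[of 1 i y], of "(y, u, v)"] by (cases i) (simp_all add: mode_def mult_ac)
  have y2: "mode a b (of_nat i * ?z y * of_nat (i - 1) * ?z y) (i - 2) \<eta> ?B (y, u, v) = real i * (real i - 1) * (Re (?z y ^ i) * (\<eta> u * ?B v))"
  proof -
    consider "i = 0" | "i = 1" | l where "i = Suc (Suc l)" by (metis One_nat_def not0_implies_Suc)
    then show ?thesis
    proof cases
      case 3
      have "mode a b (of_nat i * ?z y * of_nat (i - 1) * ?z y) (i - 2) \<eta> ?B (y, u, v)
         = Re (of_nat i * ?z y * of_nat (i - 1) * ?z y * ?z y ^ (i - 2)) * (\<eta> u * ?B v)"
        by (simp only: mode_def fst_conv snd_conv)
      also have "of_nat i * ?z y * of_nat (i - 1) * ?z y * ?z y ^ (i - 2) = of_real (real i * real (i - 1)) * ?z y ^ i"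
        using 3 by (simp add: mult_ac)
      also have "Re (of_real r * w) = r * Re w" for r w by simp
      finally show ?thesis using 3 by (simp add: mult_ac)
    qed (simp_all add: mode_def)
  qed
  have uu: "Du (mode a b 1 i \<eta> ?B) (y, u, v) = Re (?z y ^ i) * (deriv \<eta> u * ?B v)"
    by (rule trans[OF fun_cong[OF M(2)[of 1 i], of "(y, u, v)"]]) (simp add: mode_def)
  have uuu: "Du (Du (mode a b 1 i \<eta> ?B)) (y, u, v) = Re (?z y ^ i) * (deriv (deriv \<eta>) u * ?B v)"
    unfolding M(2)
    by (rule trans[OF fun_cong[OF frechet_derivative_mode(2)[where a=a and b=b and c=1 and n=i, OF d2\<eta> dc(1)], of "(y, u, v)"]]) (simp add: mode_def)
  have vv: "Dv (Dv (mode a b 1 i \<eta> ?B)) (y, u, v) = - (real j)\<^sup>2 * (Re (?z y ^ i) * (\<eta> u * ?B v))"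
    unfolding M(3)
    by (rule trans[OF fun_cong[OF frechet_derivative_mode(3)[where a=a and b=b and c=1 and n=i, OF d\<eta> dc(2)], of "(y, u, v)"]]) (simp add: mode_def)
  have r: "real DIM('a) - 1 = real k" using dim by simp
  show ?thesis
    unfolding lap_formula_def Let_def fst_conv snd_conv lap yy y1 y2 uu uuu vv r L_op_eq \<alpha>_def
    by (simp add: algebra_simps add_divide_distrib diff_divide_distrib)
qed

lemma eigenfunction_lifts:
  fixes \<eta> :: "real \<Rightarrow> real"
  assumes dim: "DIM('a::euclidean_space) = k + 1" and k: "k \<ge> 1"
    and \<eta>: "\<eta> \<in> periodic_functions T" and nz: "\<eta> u0 \<noteq> 0"
    and eig: "\<And>u. L_op f1 f2 k i j \<eta> u + b u * \<eta> u = 0"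
  obtains \<zeta> :: "'a::euclidean_space coords \<Rightarrow> real" and p0 where "\<zeta> \<in> M_functions T" "p0 \<in> M_dom" "\<zeta> p0 \<noteq> 0"
    "\<And>p. p \<in> M_dom \<Longrightarrow> laplacian M_dom \<phi> \<zeta> p + b (fst (snd p)) * \<zeta> p = 0"
proof -
  \<comment> \<open>Two coordinate directions exist because k \<ge> 1. At \<open>e1\<close> the
    harmonic polynomial takes the value 1, so \<zeta> is nonzero where \<eta> is.\<close>
  obtain e1 e2 :: 'a where e: "e1 \<in> Basis" "e2 \<in> Basis" "e1 \<noteq> e2"
  proof -
    have "card (Basis :: 'a set) > Suc 0" using dim k by simp
    then show thesis using that card_le_Suc0_iff_eq[OF finite_Basis] by (metis not_less)
  qed
  have s\<eta>: "smooth_on_open UNIV \<eta>" and per: "\<And>u. \<eta> (u + T) = \<eta> u"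
    using \<eta> by (auto simp: periodic_functions_def)
  define \<zeta> where "\<zeta> = mode e1 e2 1 i \<eta> (\<lambda>v. cos (real j * v))"
  have s: "smooth_on_open UNIV \<zeta>"
    unfolding \<zeta>_def
    by (intro smooth_mode s\<eta> smooth_on_open_cos smooth_on_open_mult smooth_on_open_const smooth_on_open_ident open_UNIV)
  have cosper: "cos (real j * (v + 2 * pi)) = cos (real j * v)" for v
    using cos_int_2pin[of "int j"] sin_int_2pin[of "int j"] by (simp add: distrib_left cos_add mult_ac)
  show thesis
  proof (rule that[of \<zeta> "(e1, u0, 0)"])
    show "\<zeta> \<in> M_functions T"
      unfolding M_functions_def smooth_map_on_def
      using s by (auto simp: \<zeta>_def mode_def per cosper intro!: exI[of _ UNIV])
    show "(e1, u0, 0) \<in> M_dom" using e by (simp add: M_dom_def)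
    have "plane_coord e1 e2 e1 = 1" using e by (simp add: plane_coord_def inner_Basis complex_eq_iff)
    then show "\<zeta> (e1, u0, 0) \<noteq> 0" using nz by (simp add: \<zeta>_def mode_def)
    fix p :: "'a coords" assume p: "p \<in> M_dom"
    obtain y u v where yuv: "p = (y, u, v)" by (metis prod_cases3)
    have "laplacian M_dom \<phi> \<zeta> p = lap_formula \<zeta> p"
      by (rule laplacian_eq[OF open_UNIV s]) (use p in auto)
    also have "\<dots> = Re (plane_coord e1 e2 y ^ i) * cos (real j * v) * L_op f1 f2 k i j \<eta> u"
      unfolding \<zeta>_def yuv by (rule lap_formula_mode[OF e dim s\<eta>])
    also have "L_op f1 f2 k i j \<eta> u = - b u * \<eta> u" using eig[of u] by simp
    finally have "laplacian M_dom \<phi> \<zeta> p = - (b u * (Re (plane_coord e1 e2 y ^ i) * (\<eta> u * cos (real j * v))))" by simp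
    moreover have "\<zeta> p = Re (plane_coord e1 e2 y ^ i) * (\<eta> u * cos (real j * v))"
      by (simp add: yuv \<zeta>_def mode_def)
    ultimately show "laplacian M_dom \<phi> \<zeta> p + b (fst (snd p)) * \<zeta> p = 0"
      by (simp add: yuv)
  qed
qed

text \<open>The potential \<open>b\<close> is \<open>0\<close> for the Laplacian and \<open>n + |A|\<^sup>2\<close> for the stability operator.\<close>

lemma spectrum_eq:
  fixes P :: "('a::euclidean_space coords \<Rightarrow> real) \<Rightarrow> 'a coords \<Rightarrow> real"
  assumes dim: "DIM('a) = k + 1" and k: "k \<ge> 1"
    and P: "\<And>\<zeta> p. p \<in> M_dom \<Longrightarrow> P \<zeta> p = laplacian M_dom \<phi> \<zeta> p + b (fst (snd p)) * \<zeta> p"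
    and Q: "\<And>i j \<eta> u. Q i j \<eta> u = L_op f1 f2 k i j \<eta> u + b u * \<eta> u"
  shows "spectrum_of M_dom (M_functions T) P = (\<Union>i. \<Union>j. spectrum_of UNIV (periodic_functions T) (Q i j))"
proof (intro equalityI subsetI)
  fix \<mu> assume "\<mu> \<in> spectrum_of M_dom (M_functions T) P"
  then obtain \<zeta> p0 where \<zeta>: "\<zeta> \<in> M_functions T" "p0 \<in> M_dom" "\<zeta> p0 \<noteq> 0"
    and e: "\<forall>p\<in>M_dom. P \<zeta> p + \<mu> * \<zeta> p = 0"
    unfolding spectrum_of_def by blast
  \<comment> \<open>The eigenvalue is absorbed into the potential.\<close>
  obtain i j \<eta> where \<eta>: "\<eta> \<in> periodic_functions T" "\<exists>u. \<eta> u \<noteq> 0" "\<And>u. L_op f1 f2 k i j \<eta> u + (b u + \<mu>) * \<eta> u = 0"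
  proof (rule eigenfunction_descends[OF \<zeta> dim, of "\<lambda>u. b u + \<mu>"])
    fix p :: "'a coords" assume p: "p \<in> M_dom"
    show "laplacian M_dom \<phi> \<zeta> p + (b (fst (snd p)) + \<mu>) * \<zeta> p = 0"
      using bspec[OF e p] P[OF p, of \<zeta>] by (simp add: distrib_right)
  qed blast
  have "\<mu> \<in> spectrum_of UNIV (periodic_functions T) (Q i j)"
    unfolding spectrum_of_def Q
    using \<eta> by (auto intro!: bexI[of _ \<eta>] simp: algebra_simps)
  then show "\<mu> \<in> (\<Union>i. \<Union>j. spectrum_of UNIV (periodic_functions T) (Q i j))" by blast
next
  fix \<mu> assume "\<mu> \<in> (\<Union>i. \<Union>j. spectrum_of UNIV (periodic_functions T) (Q i j))"
  then obtain i j where "\<mu> \<in> spectrum_of UNIV (periodic_functions T) (Q i j)" by blast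
  then obtain \<eta> u0 where \<eta>: "\<eta> \<in> periodic_functions T" "\<eta> u0 \<noteq> 0" and e: "\<forall>u. Q i j \<eta> u + \<mu> * \<eta> u = 0"
    unfolding spectrum_of_def by blast
  have e': "L_op f1 f2 k i j \<eta> u + (b u + \<mu>) * \<eta> u = 0" for u
    using spec[OF e, of u] unfolding Q by (simp add: distrib_right add.assoc)
  obtain \<zeta> :: "'a coords \<Rightarrow> real" and p0 where \<zeta>: "\<zeta> \<in> M_functions T" "p0 \<in> M_dom" "\<zeta> p0 \<noteq> 0"
    "\<And>p. p \<in> M_dom \<Longrightarrow> laplacian M_dom \<phi> \<zeta> p + (b (fst (snd p)) + \<mu>) * \<zeta> p = 0"
    using eigenfunction_lifts[OF dim k \<eta> e'] by blast
  have "P \<zeta> p + \<mu> * \<zeta> p = 0" if "p \<in> M_dom" for p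
    using \<zeta>(4)[OF that] P[OF that, of \<zeta>] by (simp add: distrib_right)
  then show "\<mu> \<in> spectrum_of M_dom (M_functions T) P"
    unfolding spectrum_of_def using \<zeta>(1-3) by blast
qed

text \<open>The potential is written as an abstraction applied to \<open>fst (snd p)\<close>, which
  is the shape \<open>b (fst (snd p))\<close> in \<open>spectrum_eq\<close>.\<close>

lemma stability_operator_eq:
  fixes \<zeta> :: "'a::euclidean_space coords \<Rightarrow> real"
  assumes "DIM('a) = k + 1" "k \<ge> 1" "p \<in> M_dom"
  shows "stability_operator k M_dom \<phi> \<zeta> p = laplacian M_dom \<phi> \<zeta> p
     + (\<lambda>u. real k + 2 + (real k * (lam0 f1 f2 u)\<^sup>2 + (lam1 f1 f2 u)\<^sup>2 + (lam2 f1 f2 u)\<^sup>2)) (fst (snd p)) * \<zeta> p"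
  unfolding stability_operator_def norm_A_squared_eq[OF assms(3,1,2)] by simp

end

theorem theorem3p4:
  fixes k n :: nat and T :: real and f1 f2 :: "real \<Rightarrow> real"
    and N :: "('a::euclidean_space \<times> real \<times> real) set"
    and \<phi> :: "'a \<times> real \<times> real \<Rightarrow> 'a \<times> real \<times> real \<times> real"
  assumes "k \<ge> 1" and "n = k + 2" and "DIM('a) = k + 1"
    and "T > 0"
    and "smooth_on_open UNIV f1" and "smooth_on_open UNIV f2"
    and "\<forall>u. f1 (u + T) = f1 u" and "\<forall>u. f2 (u + T) = f2 u"
    and "\<forall>u. f2 u > 0"
    and "\<forall>u. (f1 u)\<^sup>2 + (f2 u)\<^sup>2 < 1"
    and "\<forall>u. (deriv f1 u)\<^sup>2 + (deriv f2 u)\<^sup>2 = 1"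
    and "N = M_dom" and "\<phi> = immersion_\<phi> f1 f2"
  shows "(spectrum_of N (M_functions T) (laplacian N \<phi>)
            = (\<Union>i. \<Union>j. spectrum_of UNIV (periodic_functions T) (L_op f1 f2 k i j)))
       \<and> (spectrum_of N (M_functions T) (stability_operator k N \<phi>)
            = (\<Union>i. \<Union>j. spectrum_of UNIV (periodic_functions T) (S_op f1 f2 k n i j)))"
proof -
  interpret profile_curve f1 f2
    using assms by unfold_locales auto
  have "spectrum_of M_dom (M_functions T) (laplacian M_dom (immersion_\<phi> f1 f2) :: ('a \<times> real \<times> real \<Rightarrow> real) \<Rightarrow> _)
            = (\<Union>i. \<Union>j. spectrum_of UNIV (periodic_functions T) (L_op f1 f2 k i j))"
    by (rule spectrum_eq[OF assms(3,1), where b="\<lambda>_. 0"]) simp_all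
  moreover have "spectrum_of M_dom (M_functions T) (stability_operator k M_dom (immersion_\<phi> f1 f2) :: ('a \<times> real \<times> real \<Rightarrow> real) \<Rightarrow> _)
            = (\<Union>i. \<Union>j. spectrum_of UNIV (periodic_functions T) (S_op f1 f2 k n i j))"
    by (rule spectrum_eq[OF assms(3,1) stability_operator_eq[OF assms(3,1)]])
       (simp_all add: S_op_def L_op_def Let_def assms(2) algebra_simps)
  ultimately show ?thesis
    unfolding assms(12,13) by (rule conjI)
qed

end
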